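(* Let $R$ be a commutative Noetherian ring, $M$ a finitely generated $R$-module, and $\mathfrak{a}$ an ideal of $R$. Let $t, n_0$ be positive integers such that $\mathfrak{a}^{n_0}H^{i}_\mathfrak{a}(M) = 0$ for all $i<t$. Then for every $\mathfrak{a}$-filter regular element $x$ of $M$ with $x \in \mathfrak{a}^{2n_0}$ one has $$H^{i}_\mathfrak{a}(M/xM)\cong H^{i}_\mathfrak{a}(M)\oplus H^{i+1}_\mathfrak{a}(M)\quad\text{for all } i<t-1,$$ and $$0:_{H^{t-1}_\mathfrak{a}(M/xM)}\mathfrak{a}^{n_0} \;\cong\; H^{t-1}_\mathfrak{a}(M)\oplus \bigl(0:_{H^{t}_\mathfrak{a}(M)}\mathfrak{a}^{n_0}\bigr).$$
   Context: $H^i_{\mathfrak{a}}(\cdot)$ denotes the $i$-th local cohomology functor with respect to $\mathfrak{a}$. For an $R$-module $N$ and an ideal $I$, $0:_N I=\{z\in N: Iz=0\}$. An element $x\in\mathfrak{a}$ is called an $\mathfrak{a}$-filter regular element of $M$ if $x\notin\mathfrak{p}$ for all $\mathfrak{p}\in \mathrm{Ass}\,M\setminus V(\mathfrak{a})$, where $V(\mathfrak{a})$ is the set of prime ideals of $R$ containing $\mathfrak{a}$. *)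

theory Defs
  imports "HOL-Algebra.Module" "HOL-Algebra.Ideal_Product" "HOL-Algebra.Ring_Divisibility"
begin

section \<open>Modules\<close>

definition mod_hom ::
    "('a, 'k) ring_scheme \<Rightarrow> ('a, 'b) module \<Rightarrow> ('a, 'c) module \<Rightarrow> ('b \<Rightarrow> 'c) set"
  where "mod_hom R M N =
    {f \<in> carrier M \<rightarrow> carrier N.
       (\<forall>u\<in>carrier M. \<forall>v\<in>carrier M. f (u \<oplus>\<^bsub>M\<^esub> v) = f u \<oplus>\<^bsub>N\<^esub> f v) \<and>
       (\<forall>r\<in>carrier R. \<forall>u\<in>carrier M. f (r \<odot>\<^bsub>M\<^esub> u) = r \<odot>\<^bsub>N\<^esub> f u)}"

definition mod_isomorphic ::
    "('a, 'k) ring_scheme \<Rightarrow> ('a, 'b) module \<Rightarrow> ('a, 'c) module \<Rightarrow> bool"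
  where "mod_isomorphic R M N \<longleftrightarrow> (\<exists>f \<in> mod_hom R M N. bij_betw f (carrier M) (carrier N))"

text \<open>The fields \<open>mult\<close> and \<open>one\<close> of the record type of modules play no role for modules
  and are left unspecified.\<close>

definition direct_sum :: "('a, 'b) module \<Rightarrow> ('a, 'c) module \<Rightarrow> ('a, 'b \<times> 'c) module"
  where "direct_sum M N =
    \<lparr>carrier = carrier M \<times> carrier N, monoid.mult = undefined, one = undefined,
     zero = (\<zero>\<^bsub>M\<^esub>, \<zero>\<^bsub>N\<^esub>),
     add = (\<lambda>(u, v) (u', v'). (u \<oplus>\<^bsub>M\<^esub> u', v \<oplus>\<^bsub>N\<^esub> v')),
     smult = (\<lambda>r (u, v). (r \<odot>\<^bsub>M\<^esub> u, r \<odot>\<^bsub>N\<^esub> v))\<rparr>"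

definition quot_module :: "('a, 'b) module \<Rightarrow> 'b set \<Rightarrow> ('a, 'b set) module"
  where "quot_module M N =
    \<lparr>carrier = a_rcosets\<^bsub>M\<^esub> N, monoid.mult = undefined, one = undefined,
     zero = N, add = set_add M,
     smult = (\<lambda>r X. \<Union>u\<in>X. N +>\<^bsub>M\<^esub> (r \<odot>\<^bsub>M\<^esub> u))\<rparr>"

definition finitely_generated_module :: "('a, 'k) ring_scheme \<Rightarrow> ('a, 'b) module \<Rightarrow> bool"
  where "finitely_generated_module R M \<longleftrightarrow>
    (\<exists>S. finite S \<and> S \<subseteq> carrier M \<and>
      (\<forall>u\<in>carrier M. \<exists>c \<in> S \<rightarrow> carrier R. u = (\<Oplus>\<^bsub>M\<^esub>s\<in>S. c s \<odot>\<^bsub>M\<^esub> s)))"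

definition smult_image :: "('a, 'b) module \<Rightarrow> 'a \<Rightarrow> 'b set"
  where "smult_image M x = (\<lambda>u. x \<odot>\<^bsub>M\<^esub> u) ` carrier M"

text \<open>The module \<open>0 :\<^sub>M I\<close>.\<close>

definition zero_colon :: "('a, 'b) module \<Rightarrow> 'a set \<Rightarrow> ('a, 'b) module"
  where "zero_colon M I = M\<lparr>carrier := {u \<in> carrier M. \<forall>r\<in>I. r \<odot>\<^bsub>M\<^esub> u = \<zero>\<^bsub>M\<^esub>}\<rparr>"

text \<open>\<open>I M = 0\<close>\<close>

definition annihilates :: "'a set \<Rightarrow> ('a, 'b) module \<Rightarrow> bool"
  where "annihilates I M \<longleftrightarrow> (\<forall>r\<in>I. \<forall>u\<in>carrier M. r \<odot>\<^bsub>M\<^esub> u = \<zero>\<^bsub>M\<^esub>)"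

abbreviation ideal_power :: "('a, 'k) ring_scheme \<Rightarrow> 'a set \<Rightarrow> nat \<Rightarrow> 'a set"
  where "ideal_power R I n \<equiv> I [^]\<^bsub>ideals_set R\<^esub> n"


section \<open>Filter regular elements\<close>

definition Ass :: "('a, 'k) ring_scheme \<Rightarrow> ('a, 'b) module \<Rightarrow> 'a set set"
  where "Ass R M =
    {p. primeideal p R \<and> (\<exists>u\<in>carrier M. p = {r \<in> carrier R. r \<odot>\<^bsub>M\<^esub> u = \<zero>\<^bsub>M\<^esub>})}"

definition primes_above :: "('a, 'k) ring_scheme \<Rightarrow> 'a set \<Rightarrow> 'a set set"
  where "primes_above R \<aa> = {p. primeideal p R \<and> \<aa> \<subseteq> p}"

definition filter_regular ::
    "('a, 'k) ring_scheme \<Rightarrow> 'a set \<Rightarrow> ('a, 'b) module \<Rightarrow> 'a \<Rightarrow> bool"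
  where "filter_regular R \<aa> M x \<longleftrightarrow> x \<in> \<aa> \<and> (\<forall>p \<in> Ass R M - primes_above R \<aa>. x \<notin> p)"


section \<open>Injective resolutions\<close>

text \<open>A definition cannot quantify over types. The test modules \<open>A\<close> and \<open>B\<close> range over the
  modules whose elements have the same type as those of \<open>R\<close>. They include the ideals of \<open>R\<close>
  and \<open>R\<close> itself, so by Baer's criterion nothing is lost: lemma \<open>injective_module_extend\<close>
  gives the extension property for test modules of arbitrary types.\<close>

definition injective_module :: "('a, 'k) ring_scheme \<Rightarrow> ('a, 'b) module \<Rightarrow> bool"
  where "injective_module R E \<longleftrightarrow> module R E \<and>
    (\<forall>(A :: ('a, 'a) module) (B :: ('a, 'a) module). module R A \<longrightarrow> module R B \<longrightarrow>
      (\<forall>f \<in> mod_hom R A B. inj_on f (carrier A) \<longrightarrow>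
        (\<forall>g \<in> mod_hom R A E. \<exists>h \<in> mod_hom R B E. \<forall>u\<in>carrier A. h (f u) = g u)))"

definition self_module :: "('a, 'k) ring_scheme \<Rightarrow> ('a, 'a) module"
  where "self_module R =
    \<lparr>carrier = carrier R, monoid.mult = monoid.mult R, one = \<one>\<^bsub>R\<^esub>, zero = \<zero>\<^bsub>R\<^esub>,
     add = add R, smult = monoid.mult R\<rparr>"

lemma module_self_module:
  assumes "cring R"
  shows "module R (self_module R)"
proof -
  interpret R: cring R by fact
  have "\<exists>s\<in>carrier R. s \<oplus>\<^bsub>R\<^esub> r = \<zero>\<^bsub>R\<^esub>" if "r \<in> carrier R" for r
    using that R.l_neg R.a_inv_closed by blast
  then show ?thesis
    by (intro moduleI abelian_groupI assms)
       (simp_all add: self_module_def R.l_distr R.r_distr R.m_assoc R.a_ac)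
qed

lemma injective_module_extend_ideal:
  assumes R: "cring R" and E: "injective_module R E" and I: "ideal I R"
    and cl: "\<And>r. r \<in> I \<Longrightarrow> g r \<in> carrier E"
    and add: "\<And>r s. r \<in> I \<Longrightarrow> s \<in> I \<Longrightarrow> g (r \<oplus>\<^bsub>R\<^esub> s) = g r \<oplus>\<^bsub>E\<^esub> g s"
    and sm: "\<And>r s. r \<in> carrier R \<Longrightarrow> s \<in> I \<Longrightarrow> g (r \<otimes>\<^bsub>R\<^esub> s) = r \<odot>\<^bsub>E\<^esub> g s"
  shows "\<exists>v\<in>carrier E. \<forall>r\<in>I. g r = r \<odot>\<^bsub>E\<^esub> v"
proof -
  interpret R: cring R by fact
  interpret I: ideal I R by fact
  define S where "S = self_module R"
  have S: "module R S"
    unfolding S_def by (rule module_self_module[OF R])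
  interpret S: module R S by fact
  have minus: "\<ominus>\<^bsub>S\<^esub> r = \<ominus>\<^bsub>R\<^esub> r" for r
    by (simp add: S_def self_module_def a_inv_def m_inv_def)
  have "submodule I R S"
    by (rule S.submoduleI; (simp only: minus)?)
       (auto simp: S_def self_module_def I.I_l_closed I.Icarr)
  then have A: "module R (S\<lparr>carrier := I\<rparr>)"
    using submodule.submodule_is_module S by blast
  have f: "(\<lambda>r. r) \<in> mod_hom R (S\<lparr>carrier := I\<rparr>) S"
    using I.Icarr by (auto simp: mod_hom_def S_def self_module_def)
  have g: "g \<in> mod_hom R (S\<lparr>carrier := I\<rparr>) E"
    using cl add sm by (auto simp: mod_hom_def S_def self_module_def)
  obtain h where h: "h \<in> mod_hom R S E" "\<And>r. r \<in> I \<Longrightarrow> h r = g r"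
  proof -
    have "inj_on (\<lambda>r. r) (carrier (S\<lparr>carrier := I\<rparr>))" by simp
    then have "\<exists>h \<in> mod_hom R S E. \<forall>r\<in>carrier (S\<lparr>carrier := I\<rparr>). h r = g r"
      using E[unfolded injective_module_def] A S f g by blast
    then show thesis using that by auto
  qed
  have "h \<one>\<^bsub>R\<^esub> \<in> carrier E"
    using h(1) by (auto simp: mod_hom_def S_def self_module_def)
  moreover have "g r = r \<odot>\<^bsub>E\<^esub> h \<one>\<^bsub>R\<^esub>" if "r \<in> I" for r
  proof -
    have "h (r \<otimes>\<^bsub>R\<^esub> \<one>\<^bsub>R\<^esub>) = r \<odot>\<^bsub>E\<^esub> h \<one>\<^bsub>R\<^esub>"
      using h(1) I.Icarr[OF that] R.one_closed
      by (simp add: mod_hom_def S_def self_module_def del: R.r_one)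
    then show ?thesis using h(2)[OF that] I.Icarr[OF that] by simp
  qed
  ultimately show ?thesis by blast
qed

lemma injective_module_extend:
  fixes A :: "('a, 'p) module" and B :: "('a, 'q) module"
  assumes E: "injective_module R E" and A: "module R A" and B: "module R B"
    and f: "f \<in> mod_hom R A B" and inj: "inj_on f (carrier A)" and g: "g \<in> mod_hom R A E"
  shows "\<exists>h \<in> mod_hom R B E. \<forall>u\<in>carrier A. h (f u) = g u"
proof -
  have EM: "module R E" using E by (simp add: injective_module_def)
  interpret A: module R A by fact
  interpret B: module R B by fact
  interpret E: module R E by fact
  have fc: "f u \<in> carrier B" if "u \<in> carrier A" for u
    using f that by (auto simp: mod_hom_def)
  have gc: "g u \<in> carrier E" if "u \<in> carrier A" for u
    using g that by (auto simp: mod_hom_def)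
  have f0: "f \<zero>\<^bsub>A\<^esub> = \<zero>\<^bsub>B\<^esub>"
  proof -
    have "f (\<zero>\<^bsub>R\<^esub> \<odot>\<^bsub>A\<^esub> \<zero>\<^bsub>A\<^esub>) = \<zero>\<^bsub>R\<^esub> \<odot>\<^bsub>B\<^esub> f \<zero>\<^bsub>A\<^esub>"
      using f A.R.zero_closed A.M.zero_closed unfolding mod_hom_def by blast
    then show ?thesis using fc by simp
  qed
  have g0: "g \<zero>\<^bsub>A\<^esub> = \<zero>\<^bsub>E\<^esub>"
  proof -
    have "g (\<zero>\<^bsub>R\<^esub> \<odot>\<^bsub>A\<^esub> \<zero>\<^bsub>A\<^esub>) = \<zero>\<^bsub>R\<^esub> \<odot>\<^bsub>E\<^esub> g \<zero>\<^bsub>A\<^esub>"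
      using g A.R.zero_closed A.M.zero_closed unfolding mod_hom_def by blast
    then show ?thesis using gc by simp
  qed
  define P where "P = (\<lambda>G. G \<subseteq> carrier B \<times> carrier E \<and>
    (\<forall>u\<in>carrier A. (f u, g u) \<in> G) \<and>
    (\<forall>y v y' v'. (y, v) \<in> G \<longrightarrow> (y', v') \<in> G \<longrightarrow> (y \<oplus>\<^bsub>B\<^esub> y', v \<oplus>\<^bsub>E\<^esub> v') \<in> G) \<and>
    (\<forall>r\<in>carrier R. \<forall>y v. (y, v) \<in> G \<longrightarrow> (r \<odot>\<^bsub>B\<^esub> y, r \<odot>\<^bsub>E\<^esub> v) \<in> G) \<and>
    (\<forall>v. (\<zero>\<^bsub>B\<^esub>, v) \<in> G \<longrightarrow> v = \<zero>\<^bsub>E\<^esub>))"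
  have ex: "P ((\<lambda>u. (f u, g u)) ` carrier A)"
  proof -
    have "v = \<zero>\<^bsub>E\<^esub>" if "(\<zero>\<^bsub>B\<^esub>, v) \<in> (\<lambda>u. (f u, g u)) ` carrier A" for v
    proof -
      from that obtain u where u: "u \<in> carrier A" "f u = \<zero>\<^bsub>B\<^esub>" "v = g u" by auto
      then have "u = \<zero>\<^bsub>A\<^esub>" using inj f0 by (metis A.M.zero_closed inj_onD)
      with u g0 show ?thesis by simp
    qed
    moreover have "(f u \<oplus>\<^bsub>B\<^esub> f u', g u \<oplus>\<^bsub>E\<^esub> g u') \<in> (\<lambda>u. (f u, g u)) ` carrier A"
      if "u \<in> carrier A" "u' \<in> carrier A" for u u'
      by (rule image_eqI[where x = "u \<oplus>\<^bsub>A\<^esub> u'"])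
         (use that f g in \<open>auto simp: mod_hom_def\<close>)
    moreover have "(r \<odot>\<^bsub>B\<^esub> f u, r \<odot>\<^bsub>E\<^esub> g u) \<in> (\<lambda>u. (f u, g u)) ` carrier A"
      if "u \<in> carrier A" "r \<in> carrier R" for r u
      by (rule image_eqI[where x = "r \<odot>\<^bsub>A\<^esub> u"])
         (use that f g in \<open>auto simp: mod_hom_def\<close>)
    ultimately show ?thesis
      using fc gc unfolding P_def by auto
  qed
  have "\<exists>G\<in>Collect P. \<forall>X\<in>Collect P. G \<subseteq> X \<longrightarrow> X = G"
  proof (rule subset_Zorn_nonempty)
    show "Collect P \<noteq> {}" using ex by blast
  next
    fix C assume ne: "C \<noteq> {}" and C: "subset.chain (Collect P) C"
    have CP: "P G" if "G \<in> C" for G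
      using C that by (auto simp: subset.chain_def)
    have tot: "G \<subseteq> G' \<or> G' \<subseteq> G" if "G \<in> C" "G' \<in> C" for G G'
      using C that by (auto simp: subset_chain_def)
    have "(y \<oplus>\<^bsub>B\<^esub> y', v \<oplus>\<^bsub>E\<^esub> v') \<in> \<Union>C" if yy: "(y, v) \<in> \<Union>C" "(y', v') \<in> \<Union>C" for y v y' v'
    proof -
      obtain G G' where G: "G \<in> C" "(y, v) \<in> G" "G' \<in> C" "(y', v') \<in> G'" using yy by blast
      with tot obtain H where "H \<in> C" "(y, v) \<in> H" "(y', v') \<in> H" by blast
      with CP[of H] show ?thesis unfolding P_def by blast
    qed
    moreover have "\<Union>C \<subseteq> carrier B \<times> carrier E" using CP unfolding P_def by blast
    moreover have "\<forall>u\<in>carrier A. (f u, g u) \<in> \<Union>C" using CP ne unfolding P_def by blast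
    moreover have "\<forall>r\<in>carrier R. \<forall>y v. (y, v) \<in> \<Union>C \<longrightarrow> (r \<odot>\<^bsub>B\<^esub> y, r \<odot>\<^bsub>E\<^esub> v) \<in> \<Union>C"
      using CP unfolding P_def by blast
    moreover have "\<forall>v. (\<zero>\<^bsub>B\<^esub>, v) \<in> \<Union>C \<longrightarrow> v = \<zero>\<^bsub>E\<^esub>" using CP unfolding P_def by blast
    ultimately show "\<Union>C \<in> Collect P" unfolding P_def by blast
  qed
  then obtain G where PG: "P G" and max: "\<And>X. P X \<Longrightarrow> G \<subseteq> X \<Longrightarrow> X = G" by blast
  have Gc: "\<And>y v. (y, v) \<in> G \<Longrightarrow> y \<in> carrier B \<and> v \<in> carrier E"
    and Gf: "\<And>u. u \<in> carrier A \<Longrightarrow> (f u, g u) \<in> G"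
    and Ga: "\<And>y v y' v'. (y, v) \<in> G \<Longrightarrow> (y', v') \<in> G \<Longrightarrow> (y \<oplus>\<^bsub>B\<^esub> y', v \<oplus>\<^bsub>E\<^esub> v') \<in> G"
    and Gs: "\<And>r y v. r \<in> carrier R \<Longrightarrow> (y, v) \<in> G \<Longrightarrow> (r \<odot>\<^bsub>B\<^esub> y, r \<odot>\<^bsub>E\<^esub> v) \<in> G"
    and G0: "\<And>v. (\<zero>\<^bsub>B\<^esub>, v) \<in> G \<Longrightarrow> v = \<zero>\<^bsub>E\<^esub>"
    using PG unfolding P_def by blast+
  have Gz: "(\<zero>\<^bsub>B\<^esub>, \<zero>\<^bsub>E\<^esub>) \<in> G" using Gf[of "\<zero>\<^bsub>A\<^esub>"] f0 g0 by simp
  have Gm: "(\<ominus>\<^bsub>B\<^esub> y, \<ominus>\<^bsub>E\<^esub> v) \<in> G" if "(y, v) \<in> G" for y v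
    using Gs[of "\<ominus>\<^bsub>R\<^esub> \<one>\<^bsub>R\<^esub>", OF _ that] Gc[OF that]
    by (simp add: B.smult_l_minus E.smult_l_minus)
  have Gu: "v = v'" if "(y, v) \<in> G" "(y, v') \<in> G" for y v v'
  proof -
    have "(y \<oplus>\<^bsub>B\<^esub> \<ominus>\<^bsub>B\<^esub> y, v \<oplus>\<^bsub>E\<^esub> \<ominus>\<^bsub>E\<^esub> v') \<in> G" using Ga[OF that(1) Gm[OF that(2)]] .
    then have "v \<oplus>\<^bsub>E\<^esub> \<ominus>\<^bsub>E\<^esub> v' = \<zero>\<^bsub>E\<^esub>" using Gc[OF that(1)] by (simp add: B.M.r_neg G0)
    then show ?thesis using Gc[OF that(1)] Gc[OF that(2)]
      by (metis E.M.minus_equality E.M.minus_minus E.M.a_inv_closed)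
  qed
  have dom: "\<exists>v. (b, v) \<in> G" if b: "b \<in> carrier B" for b
  proof -
    define I where "I = {r \<in> carrier R. \<exists>v. (r \<odot>\<^bsub>B\<^esub> b, v) \<in> G}"
    define k where "k r = (SOME v. (r \<odot>\<^bsub>B\<^esub> b, v) \<in> G)" for r
    have kG: "(r \<odot>\<^bsub>B\<^esub> b, k r) \<in> G" if "r \<in> I" for r
      unfolding k_def by (rule someI_ex) (use that in \<open>auto simp: I_def\<close>)
    have Ir: "r \<in> carrier R" if "r \<in> I" for r using that by (simp add: I_def)
    have Iadd: "r \<oplus>\<^bsub>R\<^esub> s \<in> I \<and> ((r \<oplus>\<^bsub>R\<^esub> s) \<odot>\<^bsub>B\<^esub> b, k r \<oplus>\<^bsub>E\<^esub> k s) \<in> G" if "r \<in> I" "s \<in> I" for r s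
      using Ga[OF kG[OF that(1)] kG[OF that(2)]] Ir[OF that(1)] Ir[OF that(2)] b
      by (auto simp: I_def B.smult_l_distr)
    have Ism: "r \<otimes>\<^bsub>R\<^esub> s \<in> I \<and> ((r \<otimes>\<^bsub>R\<^esub> s) \<odot>\<^bsub>B\<^esub> b, r \<odot>\<^bsub>E\<^esub> k s) \<in> G"
      if "r \<in> carrier R" "s \<in> I" for r s
      using Gs[OF that(1) kG[OF that(2)]] that(1) Ir[OF that(2)] b
      by (auto simp: I_def B.smult_assoc1)
    have I0: "\<zero>\<^bsub>R\<^esub> \<in> I" using Gz b by (auto simp: I_def)
    have Im: "\<ominus>\<^bsub>R\<^esub> r \<in> I" if "r \<in> I" for r
      using Ism[of "\<ominus>\<^bsub>R\<^esub> \<one>\<^bsub>R\<^esub>" r] that Ir[OF that] by (simp add: A.R.l_minus)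
    have I: "ideal I R"
    proof (rule idealI)
      show "ring R" by (rule A.R.ring_axioms)
      show "subgroup I (add_monoid R)"
        by (rule A.R.add.subgroupI) (use Ir I0 Im Iadd in \<open>auto simp: a_inv_def[symmetric]\<close>)
      show "s \<otimes>\<^bsub>R\<^esub> r \<in> I" if "r \<in> I" "s \<in> carrier R" for r s
        using Ism that by blast
      show "r \<otimes>\<^bsub>R\<^esub> s \<in> I" if "r \<in> I" "s \<in> carrier R" for r s
        using Ism[OF that(2,1)] A.R.m_comm[OF that(2) Ir[OF that(1)]] by simp
    qed
    have "\<exists>w\<in>carrier E. \<forall>r\<in>I. k r = r \<odot>\<^bsub>E\<^esub> w"
    proof (rule injective_module_extend_ideal[OF A.R.cring_axioms E I])
      show "k r \<in> carrier E" if "r \<in> I" for r using Gc[OF kG[OF that]] by blast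
      show "k (r \<oplus>\<^bsub>R\<^esub> s) = k r \<oplus>\<^bsub>E\<^esub> k s" if "r \<in> I" "s \<in> I" for r s
        using Gu kG Iadd[OF that] by blast
      show "k (r \<otimes>\<^bsub>R\<^esub> s) = r \<odot>\<^bsub>E\<^esub> k s" if "r \<in> carrier R" "s \<in> I" for r s
        using Gu kG Ism[OF that] by blast
    qed
    then obtain w where w: "w \<in> carrier E" and kw: "\<And>r. r \<in> I \<Longrightarrow> k r = r \<odot>\<^bsub>E\<^esub> w" by blast
    define X where "X = {(y \<oplus>\<^bsub>B\<^esub> r \<odot>\<^bsub>B\<^esub> b, v \<oplus>\<^bsub>E\<^esub> r \<odot>\<^bsub>E\<^esub> w) | y v r. (y, v) \<in> G \<and> r \<in> carrier R}"
    have GX: "G \<subseteq> X"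
    proof
      fix p assume "p \<in> G"
      then obtain y v where p: "p = (y, v)" "(y, v) \<in> G" by (cases p) auto
      then have "p = (y \<oplus>\<^bsub>B\<^esub> \<zero>\<^bsub>R\<^esub> \<odot>\<^bsub>B\<^esub> b, v \<oplus>\<^bsub>E\<^esub> \<zero>\<^bsub>R\<^esub> \<odot>\<^bsub>E\<^esub> w)" using Gc b w by simp
      with p show "p \<in> X" unfolding X_def by blast
    qed
    have "P X"
      unfolding P_def
    proof (intro conjI allI impI ballI)
      show "X \<subseteq> carrier B \<times> carrier E" using Gc b w by (auto simp: X_def)
      show "(f u, g u) \<in> X" if "u \<in> carrier A" for u using Gf that GX by blast
    next
      fix y v y' v' assume "(y, v) \<in> X" "(y', v') \<in> X"
      then obtain z q r z' q' r' where *: "(z, q) \<in> G" "r \<in> carrier R" "(z', q') \<in> G" "r' \<in> carrier R"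
        "y = z \<oplus>\<^bsub>B\<^esub> r \<odot>\<^bsub>B\<^esub> b" "v = q \<oplus>\<^bsub>E\<^esub> r \<odot>\<^bsub>E\<^esub> w"
        "y' = z' \<oplus>\<^bsub>B\<^esub> r' \<odot>\<^bsub>B\<^esub> b" "v' = q' \<oplus>\<^bsub>E\<^esub> r' \<odot>\<^bsub>E\<^esub> w"
        by (auto simp: X_def)
      have "y \<oplus>\<^bsub>B\<^esub> y' = (z \<oplus>\<^bsub>B\<^esub> z') \<oplus>\<^bsub>B\<^esub> (r \<oplus>\<^bsub>R\<^esub> r') \<odot>\<^bsub>B\<^esub> b"
        using * Gc b by (simp add: B.smult_l_distr B.M.a_ac)
      moreover have "v \<oplus>\<^bsub>E\<^esub> v' = (q \<oplus>\<^bsub>E\<^esub> q') \<oplus>\<^bsub>E\<^esub> (r \<oplus>\<^bsub>R\<^esub> r') \<odot>\<^bsub>E\<^esub> w"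
        using *(1-4,6,8) Gc[OF *(1)] Gc[OF *(3)] w by (simp add: E.smult_l_distr E.M.a_ac)
      ultimately show "(y \<oplus>\<^bsub>B\<^esub> y', v \<oplus>\<^bsub>E\<^esub> v') \<in> X"
        unfolding X_def using Ga[OF *(1,3)] A.R.a_closed[OF *(2,4)] by blast
    next
      fix s y v assume s: "s \<in> carrier R" and "(y, v) \<in> X"
      then obtain z q r where *: "(z, q) \<in> G" "r \<in> carrier R"
        "y = z \<oplus>\<^bsub>B\<^esub> r \<odot>\<^bsub>B\<^esub> b" "v = q \<oplus>\<^bsub>E\<^esub> r \<odot>\<^bsub>E\<^esub> w"
        by (auto simp: X_def)
      have "s \<odot>\<^bsub>B\<^esub> y = s \<odot>\<^bsub>B\<^esub> z \<oplus>\<^bsub>B\<^esub> (s \<otimes>\<^bsub>R\<^esub> r) \<odot>\<^bsub>B\<^esub> b"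
        using * s Gc[OF *(1)] b by (simp add: B.smult_r_distr B.smult_assoc1)
      moreover have "s \<odot>\<^bsub>E\<^esub> v = s \<odot>\<^bsub>E\<^esub> q \<oplus>\<^bsub>E\<^esub> (s \<otimes>\<^bsub>R\<^esub> r) \<odot>\<^bsub>E\<^esub> w"
        using * s Gc[OF *(1)] w by (simp add: E.smult_r_distr E.smult_assoc1)
      ultimately show "(s \<odot>\<^bsub>B\<^esub> y, s \<odot>\<^bsub>E\<^esub> v) \<in> X"
        unfolding X_def using Gs[OF s *(1)] A.R.m_closed[OF s *(2)] by blast
    next
      fix v assume "(\<zero>\<^bsub>B\<^esub>, v) \<in> X"
      then obtain z q r where *: "(z, q) \<in> G" "r \<in> carrier R"
        "\<zero>\<^bsub>B\<^esub> = z \<oplus>\<^bsub>B\<^esub> r \<odot>\<^bsub>B\<^esub> b" "v = q \<oplus>\<^bsub>E\<^esub> r \<odot>\<^bsub>E\<^esub> w"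
        by (auto simp: X_def)
      have zc: "z \<in> carrier B" "q \<in> carrier E" using Gc[OF *(1)] by auto
      have rb: "r \<odot>\<^bsub>B\<^esub> b = \<ominus>\<^bsub>B\<^esub> z"
        using *(2,3) zc b
        by (metis B.M.a_comm B.M.minus_equality B.smult_closed)
      then have "r \<in> I" using Gm[OF *(1)] *(2) by (auto simp: I_def)
      then have "r \<odot>\<^bsub>E\<^esub> w = \<ominus>\<^bsub>E\<^esub> q"
        using Gu[OF kG Gm[OF *(1), folded rb]] kw by metis
      then show "v = \<zero>\<^bsub>E\<^esub>" using *(4) zc by (simp add: E.M.r_neg)
    qed
    then have "X = G" using max GX by blast
    moreover have "(\<zero>\<^bsub>B\<^esub> \<oplus>\<^bsub>B\<^esub> \<one>\<^bsub>R\<^esub> \<odot>\<^bsub>B\<^esub> b, \<zero>\<^bsub>E\<^esub> \<oplus>\<^bsub>E\<^esub> \<one>\<^bsub>R\<^esub> \<odot>\<^bsub>E\<^esub> w) \<in> X"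
      unfolding X_def using Gz A.R.one_closed by blast
    ultimately show ?thesis using b by auto
  qed
  define h where "h b = (THE v. (b, v) \<in> G)" for b
  have hI: "h b = v" if "(b, v) \<in> G" for b v
    unfolding h_def using Gu that by blast
  have hG: "(b, h b) \<in> G" if "b \<in> carrier B" for b
    using dom[OF that] hI by auto
  have "h \<in> mod_hom R B E"
    unfolding mod_hom_def using hG Gc by (auto intro!: hI Ga Gs)
  moreover have "\<forall>u\<in>carrier A. h (f u) = g u"
    using Gf hI by blast
  ultimately show ?thesis by blast
qed

text \<open>\<open>0 \<rightarrow> M \<rightarrow> E 0 \<rightarrow> E 1 \<rightarrow> \<dots>\<close> is exact, with augmentation \<open>e\<close> and differentials
  \<open>d n : E n \<rightarrow> E (n + 1)\<close>.\<close>

definition injective_resolution ::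
    "('a, 'k) ring_scheme \<Rightarrow> ('a, 'b) module \<Rightarrow>
     (nat \<Rightarrow> ('a, 'c) module) \<Rightarrow> (nat \<Rightarrow> 'c \<Rightarrow> 'c) \<Rightarrow> ('b \<Rightarrow> 'c) \<Rightarrow> bool"
  where "injective_resolution R M E d e \<longleftrightarrow>
    (\<forall>n. injective_module R (E n)) \<and>
    (\<forall>n. d n \<in> mod_hom R (E n) (E (Suc n))) \<and>
    e \<in> mod_hom R M (E 0) \<and>
    inj_on e (carrier M) \<and>
    e ` carrier M = {z \<in> carrier (E 0). d 0 z = \<zero>\<^bsub>E 1\<^esub>} \<and>
    (\<forall>n. d n ` carrier (E n) = {z \<in> carrier (E (Suc n)). d (Suc n) z = \<zero>\<^bsub>E (Suc (Suc n))\<^esub>})"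


section \<open>Local cohomology\<close>

text \<open>The \<open>\<aa>\<close>-torsion functor \<open>\<Gamma>\<^sub>\<aa>\<close> on objects; on homomorphisms it is restriction.\<close>

definition torsion_part ::
    "('a, 'k) ring_scheme \<Rightarrow> 'a set \<Rightarrow> ('a, 'b) module \<Rightarrow> ('a, 'b) module"
  where "torsion_part R \<aa> M =
    M\<lparr>carrier := {u \<in> carrier M. \<exists>n. \<forall>r \<in> ideal_power R \<aa> n. r \<odot>\<^bsub>M\<^esub> u = \<zero>\<^bsub>M\<^esub>}\<rparr>"

definition cocycles ::
    "(nat \<Rightarrow> ('a, 'c) module) \<Rightarrow> (nat \<Rightarrow> 'c \<Rightarrow> 'c) \<Rightarrow> nat \<Rightarrow> 'c set"
  where "cocycles C d i = {z \<in> carrier (C i). d i z = \<zero>\<^bsub>C (Suc i)\<^esub>}"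

fun coboundaries ::
    "(nat \<Rightarrow> ('a, 'c) module) \<Rightarrow> (nat \<Rightarrow> 'c \<Rightarrow> 'c) \<Rightarrow> nat \<Rightarrow> 'c set"
  where
    "coboundaries C d 0 = {\<zero>\<^bsub>C 0\<^esub>}"
  | "coboundaries C d (Suc i) = d i ` carrier (C i)"

definition cohomology ::
    "(nat \<Rightarrow> ('a, 'c) module) \<Rightarrow> (nat \<Rightarrow> 'c \<Rightarrow> 'c) \<Rightarrow> nat \<Rightarrow> ('a, 'c set) module"
  where "cohomology C d i = quot_module ((C i)\<lparr>carrier := cocycles C d i\<rparr>) (coboundaries C d i)"

text \<open>\<open>H\<^sup>i\<^sub>\<aa>(M)\<close> is the \<open>i\<close>-th right derived functor of \<open>\<Gamma>\<^sub>\<aa>\<close>, computed from an injective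
  resolution \<open>(E, d)\<close> of \<open>M\<close>. The resolution is an explicit argument: it determines the result
  up to isomorphism, and its elements may live in a different type from those of \<open>M\<close>.\<close>

definition local_cohomology ::
    "('a, 'k) ring_scheme \<Rightarrow> 'a set \<Rightarrow>
     (nat \<Rightarrow> ('a, 'c) module) \<Rightarrow> (nat \<Rightarrow> 'c \<Rightarrow> 'c) \<Rightarrow> nat \<Rightarrow> ('a, 'c set) module"
  where "local_cohomology R \<aa> E d i = cohomology (\<lambda>n. torsion_part R \<aa> (E n)) d i"

end

theory Submission
  imports Defs
begin

text \<open>Let \<open>(E, d)\<close> be the resolution of \<open>M\<close> and let \<open>C = \<Gamma>\<^sub>\<aa> E\<close>. Filter regularity makes \<open>0 :\<^sub>M x\<close> torsion,
  hence \<open>\<Gamma>\<^sub>\<aa>\<close>-acyclic over a Noetherian ring, so \<open>H\<^sup>i\<^sub>\<aa>(M / x M)\<close> is the cohomology of the cone of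
  \<open>x : C \<rightarrow> C\<close>: pairs \<open>(c', c)\<close> with \<open>d c' = 0\<close> and \<open>x c' = d c\<close>, modulo the pairs \<open>(d w, x w - d v)\<close>.
  Write \<open>x = \<Sum> a\<^sub>j b\<^sub>j\<close> with \<open>a\<^sub>j, b\<^sub>j \<in> \<aa>\<^sup>n\<close>. A cocycle \<open>c'\<close> whose class is killed by \<open>\<aa>\<^sup>n\<close> has
  \<open>b\<^sub>j c' = d s\<^sub>j\<close> for some \<open>s\<^sub>j\<close>, and \<open>c' \<mapsto> (c', \<Sum> a\<^sub>j s\<^sub>j)\<close> is a well-defined homomorphism on classes:
  \<open>s\<^sub>j\<close> is unique up to a cocycle, and \<open>a\<^sub>j\<close> kills \<open>H\<^sup>i\<^sub>\<aa>(M)\<close>. It splits the projection to \<open>H\<^sup>i\<^sup>+\<^sup>1\<^sub>\<aa>(M)\<close> over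
  the part of it killed by \<open>\<aa>\<^sup>n\<close>.\<close>

section \<open>Homomorphisms and submodules\<close>

text \<open>The long exact sequence of multiplication by \<open>x\<close> shows only that the middle
  module is an extension of the outer two. Splitting the extension needs representatives, hence the
  work with cochains. The exponent \<open>2 * n\<^sub>0\<close> pays for two factors: one makes
  \<open>b c'\<close> a coboundary, the other removes the ambiguity of \<open>s\<close>. The
  elements \<open>s\<close> cannot be chosen linearly, so the splitting is kept as a submodule of
  pairs and becomes a map only on classes. The resolutions \<open>E\<close> and \<open>E'\<close>
  are unrelated, so the cone of \<open>x\<close> on \<open>E\<close> has to be compared with
  \<open>E'\<close> through a constructed cochain map. The cone of that map consists of injectives
  and is exact except at the bottom, where it has the torsion module of elements killed by
  \<open>x\<close>. What remains is that a resolution of a torsion module by injectives stays exact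
  in positive degrees after taking torsion; this rests on the torsion of an injective module being a
  direct summand. The terms of \<open>E\<close> are in general far from Noetherian, so every chain
  condition is applied to ideals of \<open>R\<close>.\<close>

lemma (in abelian_group) diff_eq_zero_iff:
  assumes "u \<in> carrier G" and "v \<in> carrier G"
  shows "u \<ominus> v = \<zero> \<longleftrightarrow> u = v"
  using assms by (metis a_inv_closed minus_eq minus_equality minus_minus r_neg)

text \<open>Sorting by \<open>a_ac\<close> may leave one term between \<open>u\<close> and
  \<open>\<ominus> u\<close>. These rules restore the cancellation when \<open>diff_simps\<close>
  normalises sums and differences.\<close>

lemma (in abelian_group) cancel_distant:
  assumes "u \<in> carrier G" and "v \<in> carrier G" and "w \<in> carrier G"
  shows "u \<oplus> (v \<oplus> \<ominus> u) = v" and "\<ominus> u \<oplus> (v \<oplus> u) = v"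
    and "u \<oplus> (v \<oplus> (\<ominus> u \<oplus> w)) = v \<oplus> w" and "\<ominus> u \<oplus> (v \<oplus> (u \<oplus> w)) = v \<oplus> w"
  using assms by (metis a_comm a_inv_closed a_lcomm add.m_closed r_neg1 r_neg2)+

lemmas (in abelian_group) diff_simps =
  minus_eq a_ac minus_add minus_minus r_neg1 r_neg2 l_neg r_neg cancel_distant

lemma (in abelian_group) diff_zero:
  assumes "u \<in> carrier G"
  shows "u \<ominus> \<zero> = u"
  using assms minus_equality[of \<zero> \<zero>] by (simp add: minus_eq)

lemma (in abelian_group) add_diff_cancel_left:
  assumes "u \<in> carrier G" and "v \<in> carrier G"
  shows "(u \<oplus> v) \<ominus> u = v"
  using assms by (simp add: diff_simps)

lemma mod_homD:
  assumes "f \<in> mod_hom R M N"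
  shows mod_hom_closed: "u \<in> carrier M \<Longrightarrow> f u \<in> carrier N"
    and mod_hom_add: "u \<in> carrier M \<Longrightarrow> v \<in> carrier M \<Longrightarrow> f (u \<oplus>\<^bsub>M\<^esub> v) = f u \<oplus>\<^bsub>N\<^esub> f v"
    and mod_hom_smult: "r \<in> carrier R \<Longrightarrow> u \<in> carrier M \<Longrightarrow> f (r \<odot>\<^bsub>M\<^esub> u) = r \<odot>\<^bsub>N\<^esub> f u"
  using assms by (auto simp: mod_hom_def)

lemma mod_homI:
  assumes "\<And>u. u \<in> carrier M \<Longrightarrow> f u \<in> carrier N"
    and "\<And>u v. u \<in> carrier M \<Longrightarrow> v \<in> carrier M \<Longrightarrow> f (u \<oplus>\<^bsub>M\<^esub> v) = f u \<oplus>\<^bsub>N\<^esub> f v"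
    and "\<And>r u. r \<in> carrier R \<Longrightarrow> u \<in> carrier M \<Longrightarrow> f (r \<odot>\<^bsub>M\<^esub> u) = r \<odot>\<^bsub>N\<^esub> f u"
  shows "f \<in> mod_hom R M N"
  using assms by (auto simp: mod_hom_def)

lemma mod_hom_zero:
  assumes "module R M" and "module R N" and f: "f \<in> mod_hom R M N"
  shows "f \<zero>\<^bsub>M\<^esub> = \<zero>\<^bsub>N\<^esub>"
proof -
  interpret M: module R M by fact
  interpret N: module R N by fact
  have "f (\<zero>\<^bsub>R\<^esub> \<odot>\<^bsub>M\<^esub> \<zero>\<^bsub>M\<^esub>) = \<zero>\<^bsub>R\<^esub> \<odot>\<^bsub>N\<^esub> f \<zero>\<^bsub>M\<^esub>"
    using mod_hom_smult[OF f] by blast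
  then show ?thesis using mod_hom_closed[OF f] by simp
qed

lemma mod_hom_minus:
  assumes "module R M" and "module R N" and f: "f \<in> mod_hom R M N"
    and u: "u \<in> carrier M"
  shows "f (\<ominus>\<^bsub>M\<^esub> u) = \<ominus>\<^bsub>N\<^esub> f u"
proof -
  interpret M: module R M by fact
  interpret N: module R N by fact
  have "f (\<ominus>\<^bsub>M\<^esub> u) \<oplus>\<^bsub>N\<^esub> f u = \<zero>\<^bsub>N\<^esub>"
    using mod_hom_add[OF f, of "\<ominus>\<^bsub>M\<^esub> u" u] u mod_hom_zero[OF assms(1-3)] by (simp add: M.M.l_neg)
  then show ?thesis
    using mod_hom_closed[OF f] u by (simp add: N.M.minus_equality)
qed

lemma mod_hom_diff:
  assumes "module R M" and "module R N" and f: "f \<in> mod_hom R M N"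
    and u: "u \<in> carrier M" and v: "v \<in> carrier M"
  shows "f (u \<ominus>\<^bsub>M\<^esub> v) = f u \<ominus>\<^bsub>N\<^esub> f v"
proof -
  interpret M: module R M by fact
  show ?thesis
    using mod_hom_add[OF f, of u "\<ominus>\<^bsub>M\<^esub> v"] mod_hom_minus[OF assms(1-3)] u v
    by (simp add: a_minus_def)
qed

lemma mod_hom_compose:
  assumes "f \<in> mod_hom R M N" and "g \<in> mod_hom R N L"
  shows "(\<lambda>u. g (f u)) \<in> mod_hom R M L"
  using assms by (auto simp: mod_hom_def Pi_def)

lemma mod_hom_const_zero:
  assumes "module R N"
  shows "(\<lambda>_. \<zero>\<^bsub>N\<^esub>) \<in> mod_hom R M N"
proof -
  interpret N: module R N by fact
  show ?thesis by (auto simp: mod_hom_def)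
qed

lemma mod_hom_id: "(\<lambda>u. u) \<in> mod_hom R M M"
  by (auto simp: mod_hom_def)

lemma mod_hom_smult_const:
  assumes "module R M" and r: "r \<in> carrier R"
  shows "(\<lambda>u. r \<odot>\<^bsub>M\<^esub> u) \<in> mod_hom R M M"
proof -
  interpret M: module R M by fact
  show ?thesis
    using r by (auto intro!: mod_homI simp: M.smult_r_distr M.smult_assoc1[symmetric] M.R.m_comm)
qed

lemma mod_hom_sum:
  assumes "module R N" and f: "f \<in> mod_hom R M N" and g: "g \<in> mod_hom R M N"
  shows "(\<lambda>u. f u \<oplus>\<^bsub>N\<^esub> g u) \<in> mod_hom R M N"
proof -
  interpret N: module R N by fact
  show ?thesis
    using mod_homD[OF f] mod_homD[OF g]
    by (auto intro!: mod_homI simp: N.M.a_ac N.smult_r_distr)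
qed

lemma mod_hom_difference:
  assumes "module R N" and f: "f \<in> mod_hom R M N" and g: "g \<in> mod_hom R M N"
  shows "(\<lambda>u. f u \<ominus>\<^bsub>N\<^esub> g u) \<in> mod_hom R M N"
proof -
  interpret N: module R N by fact
  show ?thesis
    using mod_homD[OF f] mod_homD[OF g]
    by (auto intro!: mod_homI simp: a_minus_def N.M.a_ac N.smult_r_distr N.M.minus_add N.smult_r_minus)
qed

lemma mod_hom_corestrict:
  assumes "f \<in> mod_hom R M N" and "\<And>u. u \<in> carrier M \<Longrightarrow> f u \<in> H"
  shows "f \<in> mod_hom R M (N\<lparr>carrier := H\<rparr>)"
  using assms by (auto simp: mod_hom_def)

lemma submodule_image:
  assumes "module R M" and "module R N" and f: "f \<in> mod_hom R M N"
  shows "submodule (f ` carrier M) R N"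
proof -
  interpret M: module R M by fact
  interpret N: module R N by fact
  show ?thesis
  proof (rule N.submoduleI)
    show "f ` carrier M \<subseteq> carrier N" using mod_hom_closed[OF f] by blast
    show "\<zero>\<^bsub>N\<^esub> \<in> f ` carrier M"
      using mod_hom_zero[OF assms] M.M.zero_closed by (metis image_eqI)
    show "\<ominus>\<^bsub>N\<^esub> a \<in> f ` carrier M" if "a \<in> f ` carrier M" for a
      using that mod_hom_minus[OF assms] M.M.a_inv_closed by (metis (no_types, lifting) imageE image_eqI)
    show "a \<oplus>\<^bsub>N\<^esub> b \<in> f ` carrier M" if "a \<in> f ` carrier M" "b \<in> f ` carrier M" for a b
      using that mod_hom_add[OF f] M.M.a_closed by (metis (no_types, lifting) imageE image_eqI)
    show "r \<odot>\<^bsub>N\<^esub> a \<in> f ` carrier M" if "r \<in> carrier R" "a \<in> f ` carrier M" for r a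
      using that mod_hom_smult[OF f] M.smult_closed by (metis (no_types, lifting) imageE image_eqI)
  qed
qed

lemma submodule_module:
  "module R M \<Longrightarrow> submodule H R M \<Longrightarrow> module R (M\<lparr>carrier := H\<rparr>)"
  using submodule.submodule_is_module .

lemma (in module) submodule_zero:
  assumes "submodule H R M"
  shows "\<zero>\<^bsub>M\<^esub> \<in> H"
  using submodule.axioms(1)[OF assms] subgroup.one_closed by fastforce

lemma (in module) submodule_diff:
  assumes "submodule H R M" and "u \<in> H" and "v \<in> H"
  shows "u \<ominus>\<^bsub>M\<^esub> v \<in> H"
  using assms submoduleE by (simp add: a_minus_def)

lemma injective_module_module: "injective_module R E \<Longrightarrow> module R E"
  by (simp add: injective_module_def)

text \<open>An arbitrary \<open>f\<close> is reduced to the inclusion of its image.\<close>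

lemma injective_module_factor:
  assumes E: "injective_module R E" and A: "module R A" and B: "module R B"
    and f: "f \<in> mod_hom R A B" and g: "g \<in> mod_hom R A E"
    and ker: "\<And>u. u \<in> carrier A \<Longrightarrow> f u = \<zero>\<^bsub>B\<^esub> \<Longrightarrow> g u = \<zero>\<^bsub>E\<^esub>"
  obtains h where "h \<in> mod_hom R B E" "\<And>u. u \<in> carrier A \<Longrightarrow> h (f u) = g u"
proof -
  interpret A: module R A by fact
  interpret B: module R B by fact
  have EM: "module R E" using E by (rule injective_module_module)
  interpret E: module R E by fact
  define I where "I = B\<lparr>carrier := f ` carrier A\<rparr>"
  have I: "module R I"
    unfolding I_def by (rule submodule_module[OF B submodule_image[OF A B f]])
  \<comment> \<open>Preimages under \<open>f\<close> are chosen arbitrarily; \<open>ker\<close>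
    makes the value of \<open>g\<close> independent of the choice, which gives linearity.\<close>
  define k where "k y = g (SOME u. u \<in> carrier A \<and> f u = y)" for y
  have k: "k (f u) = g u" if u: "u \<in> carrier A" for u
  proof -
    define v where "v = (SOME v. v \<in> carrier A \<and> f v = f u)"
    have v: "v \<in> carrier A \<and> f v = f u"
      unfolding v_def by (rule someI_ex) (use u in blast)
    then have "f (v \<ominus>\<^bsub>A\<^esub> u) = \<zero>\<^bsub>B\<^esub>"
      using mod_hom_diff[OF A B f] u mod_hom_closed[OF f] by (simp add: a_minus_def B.M.r_neg)
    then have "g v \<ominus>\<^bsub>E\<^esub> g u = \<zero>\<^bsub>E\<^esub>"
      using ker[of "v \<ominus>\<^bsub>A\<^esub> u"] mod_hom_diff[OF A EM g] u v by simp
    then have "g v = g u"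
      using mod_hom_closed[OF g] u v by (simp add: E.M.diff_eq_zero_iff)
    then show ?thesis by (simp add: k_def v_def)
  qed
  have "k \<in> mod_hom R I E"
  proof (rule mod_homI)
    show "k y \<in> carrier E" if "y \<in> carrier I" for y
      using that k mod_hom_closed[OF g] by (auto simp: I_def)
    show "k (y \<oplus>\<^bsub>I\<^esub> z) = k y \<oplus>\<^bsub>E\<^esub> k z" if "y \<in> carrier I" "z \<in> carrier I" for y z
    proof -
      have "y \<in> f ` carrier A" "z \<in> f ` carrier A" using that by (simp_all add: I_def)
      then obtain u v where u: "u \<in> carrier A" "y = f u" and v: "v \<in> carrier A" "z = f v"
        by blast
      have "y \<oplus>\<^bsub>I\<^esub> z = f (u \<oplus>\<^bsub>A\<^esub> v)"
        using mod_hom_add[OF f u(1) v(1)] u v by (simp add: I_def)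
      then show ?thesis
        using mod_hom_add[OF g u(1) v(1)] k u v by simp
    qed
    show "k (r \<odot>\<^bsub>I\<^esub> y) = r \<odot>\<^bsub>E\<^esub> k y" if "r \<in> carrier R" "y \<in> carrier I" for r y
    proof -
      have "y \<in> f ` carrier A" using that(2) by (simp add: I_def)
      then obtain u where "u \<in> carrier A" "y = f u" by blast
      moreover from this have "r \<odot>\<^bsub>I\<^esub> y = f (r \<odot>\<^bsub>A\<^esub> u)"
        using mod_hom_smult[OF f that(1), of u] by (simp add: I_def)
      ultimately show ?thesis
        using mod_hom_smult[OF g that(1), of u] k that(1) by simp
    qed
  qed
  moreover have "(\<lambda>y. y) \<in> mod_hom R I B"
    using mod_hom_closed[OF f] by (auto simp: I_def mod_hom_def)
  ultimately obtain h where "h \<in> mod_hom R B E" "\<forall>y\<in>carrier I. h y = k y"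
    using injective_module_extend[OF E I B, of "\<lambda>y. y" k] by auto
  with k show thesis by (intro that[of h]) (auto simp: I_def)
qed

lemma module_direct_sum:
  assumes "module R M" and "module R N"
  shows "module R (direct_sum M N)"
proof -
  interpret M: module R M by fact
  interpret N: module R N by fact
  show ?thesis
  proof (intro moduleI abelian_groupI M.R.cring_axioms)
    fix p assume "p \<in> carrier (direct_sum M N)"
    then show "\<exists>q\<in>carrier (direct_sum M N). q \<oplus>\<^bsub>direct_sum M N\<^esub> p = \<zero>\<^bsub>direct_sum M N\<^esub>"
      by (intro bexI[of _ "(\<ominus>\<^bsub>M\<^esub> fst p, \<ominus>\<^bsub>N\<^esub> snd p)"])
         (auto simp: direct_sum_def M.M.l_neg N.M.l_neg)
  qed (auto simp: direct_sum_def M.M.a_ac N.M.a_ac M.smult_l_distr N.smult_l_distr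
         M.smult_r_distr N.smult_r_distr M.smult_assoc1 N.smult_assoc1)
qed

lemma direct_sum_simps [simp]:
  "carrier (direct_sum M N) = carrier M \<times> carrier N"
  "\<zero>\<^bsub>direct_sum M N\<^esub> = (\<zero>\<^bsub>M\<^esub>, \<zero>\<^bsub>N\<^esub>)"
  "(u, v) \<oplus>\<^bsub>direct_sum M N\<^esub> (u', v') = (u \<oplus>\<^bsub>M\<^esub> u', v \<oplus>\<^bsub>N\<^esub> v')"
  "r \<odot>\<^bsub>direct_sum M N\<^esub> (u, v) = (r \<odot>\<^bsub>M\<^esub> u, r \<odot>\<^bsub>N\<^esub> v)"
  by (simp_all add: direct_sum_def)

lemma mod_hom_fst: "fst \<in> mod_hom R (direct_sum M N) M"
  by (auto simp: mod_hom_def)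

lemma mod_hom_snd: "snd \<in> mod_hom R (direct_sum M N) N"
  by (auto simp: mod_hom_def)

lemma mod_hom_Pair:
  assumes "f \<in> mod_hom R L M" and "g \<in> mod_hom R L N"
  shows "(\<lambda>u. (f u, g u)) \<in> mod_hom R L (direct_sum M N)"
  using assms by (auto simp: mod_hom_def)

text \<open>Makes the terms of a cone injective; the two coordinates of a map are extended
  separately.\<close>

lemma injective_direct_sum:
  assumes E: "injective_module R E" and F: "injective_module R F"
  shows "injective_module R (direct_sum E F)"
  unfolding injective_module_def
proof (intro conjI allI impI ballI)
  show "module R (direct_sum E F)"
    using assms by (intro module_direct_sum injective_module_module)
  fix A B :: "('a, 'a) module" and f g
  assume *: "module R A" "module R B" "f \<in> mod_hom R A B" "inj_on f (carrier A)"
    and g: "g \<in> mod_hom R A (direct_sum E F)"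
  obtain h where h: "h \<in> mod_hom R B E" "\<forall>u\<in>carrier A. h (f u) = fst (g u)"
    using injective_module_extend[OF E * mod_hom_compose[OF g mod_hom_fst]] by blast
  obtain k where k: "k \<in> mod_hom R B F" "\<forall>u\<in>carrier A. k (f u) = snd (g u)"
    using injective_module_extend[OF F * mod_hom_compose[OF g mod_hom_snd]] by blast
  show "\<exists>h\<in>mod_hom R B (direct_sum E F). \<forall>u\<in>carrier A. h (f u) = g u"
    by (rule bexI[OF _ mod_hom_Pair[OF h(1) k(1)]]) (use h(2) k(2) in simp)
qed

text \<open>Provides degree -1 of a shifted complex, so that a cone of complexes of injectives has
  an injective term in degree 0 too.\<close>

lemma injective_zero_module:
  assumes "module R M"
  shows "injective_module R (M\<lparr>carrier := {\<zero>\<^bsub>M\<^esub>}\<rparr>)"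
proof -
  interpret M: module R M by fact
  have "submodule {\<zero>\<^bsub>M\<^esub>} R M" by (rule M.submoduleI) auto
  then have Z: "module R (M\<lparr>carrier := {\<zero>\<^bsub>M\<^esub>}\<rparr>)" by (rule submodule_module[OF assms])
  show ?thesis
    unfolding injective_module_def
  proof (intro conjI allI impI ballI)
    fix A B :: "('a, 'a) module" and f g
    assume g: "g \<in> mod_hom R A (M\<lparr>carrier := {\<zero>\<^bsub>M\<^esub>}\<rparr>)"
    show "\<exists>h\<in>mod_hom R B (M\<lparr>carrier := {\<zero>\<^bsub>M\<^esub>}\<rparr>). \<forall>u\<in>carrier A. h (f u) = g u"
      using mod_hom_const_zero[OF Z, of B] mod_hom_closed[OF g]
      by (intro bexI[of _ "\<lambda>_. \<zero>\<^bsub>M\<^esub>"]) auto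
  qed (rule Z)
qed

text \<open>Zero and negatives come from the scalars \<open>\<zero>\<close> and
  \<open>\<ominus> \<one>\<close>.\<close>

lemma (in module) submoduleI_nonempty:
  assumes "H \<subseteq> carrier M" and "H \<noteq> {}"
    and "\<And>u v. u \<in> H \<Longrightarrow> v \<in> H \<Longrightarrow> u \<oplus>\<^bsub>M\<^esub> v \<in> H"
    and sm: "\<And>r u. r \<in> carrier R \<Longrightarrow> u \<in> H \<Longrightarrow> r \<odot>\<^bsub>M\<^esub> u \<in> H"
  shows "submodule H R M"
proof (rule submoduleI)
  obtain u where "u \<in> H" using assms(2) by blast
  then show "\<zero>\<^bsub>M\<^esub> \<in> H" using sm[OF R.zero_closed, of u] assms(1) by (metis smult_l_null subsetD)
  show "\<ominus>\<^bsub>M\<^esub> v \<in> H" if "v \<in> H" for v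
    using sm[of "\<ominus> \<one>" v] that assms(1) by (auto simp: smult_l_minus)
qed (use assms in auto)

lemma submodule_preimage:
  assumes "module R M" and "module R N" and f: "f \<in> mod_hom R M N" and H: "submodule H R N"
  shows "submodule {u \<in> carrier M. f u \<in> H} R M"
proof -
  interpret M: module R M by fact
  interpret N: module R N by fact
  note H' = N.submoduleE[OF H]
  show ?thesis
    using mod_homD[OF f] mod_hom_zero[OF assms(1-3)] N.submodule_zero[OF H] H'(4,5)
    by (intro M.submoduleI_nonempty) auto
qed

lemma submodule_Times:
  assumes "module R M" and "module R N" and G: "submodule G R M" and H: "submodule H R N"
  shows "submodule (G \<times> H) R (direct_sum M N)"
proof -
  interpret M: module R M by fact
  interpret N: module R N by fact
  interpret S: module R "direct_sum M N" by (rule module_direct_sum) fact+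
  show ?thesis
    using M.submoduleE[OF G] N.submoduleE[OF H]
    by (intro S.submoduleI_nonempty) auto
qed

text \<open>Two surjections with the same fibres: \<open>q\<close> factors through \<open>p\<close>
  as a bijection. This yields an isomorphism between modules of classes from a module
  \<open>U\<close> of representatives, so that no map has to be defined on cosets by hand.\<close>

lemma mod_isomorphic_span:
  assumes p: "p \<in> mod_hom R U A" and q: "q \<in> mod_hom R U B" and U: "module R U"
    and pA: "p ` carrier U = carrier A" and qB: "q ` carrier U = carrier B"
    and eq: "\<And>u v. u \<in> carrier U \<Longrightarrow> v \<in> carrier U \<Longrightarrow> p u = p v \<longleftrightarrow> q u = q v"
  shows "mod_isomorphic R A B"
proof -
  interpret U: module R U by fact
  define f where "f a = q (SOME u. u \<in> carrier U \<and> p u = a)" for a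
  have f: "f (p u) = q u" if u: "u \<in> carrier U" for u
  proof -
    have "(SOME v. v \<in> carrier U \<and> p v = p u) \<in> carrier U \<and> p (SOME v. v \<in> carrier U \<and> p v = p u) = p u"
      by (rule someI_ex) (use u in blast)
    then show ?thesis unfolding f_def using eq[OF _ u] by blast
  qed
  have A: "\<exists>u\<in>carrier U. a = p u" if "a \<in> carrier A" for a using pA that by auto
  have "f \<in> mod_hom R A B"
  proof (rule mod_homI)
    show "f a \<in> carrier B" if "a \<in> carrier A" for a
      using A[OF that] f mod_hom_closed[OF q] by auto
    fix a b assume "a \<in> carrier A" "b \<in> carrier A"
    then obtain u v where uv: "u \<in> carrier U" "a = p u" "v \<in> carrier U" "b = p v" using A by metis
    have "f (p (u \<oplus>\<^bsub>U\<^esub> v)) = q (u \<oplus>\<^bsub>U\<^esub> v)" using f uv by simp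
    then show "f (a \<oplus>\<^bsub>A\<^esub> b) = f a \<oplus>\<^bsub>B\<^esub> f b"
      using uv f mod_hom_add[OF p] mod_hom_add[OF q] by simp
  next
    fix r a assume r: "r \<in> carrier R" and "a \<in> carrier A"
    then obtain u where u: "u \<in> carrier U" "a = p u" using A by metis
    have "f (p (r \<odot>\<^bsub>U\<^esub> u)) = q (r \<odot>\<^bsub>U\<^esub> u)" using f u r by simp
    then show "f (r \<odot>\<^bsub>A\<^esub> a) = r \<odot>\<^bsub>B\<^esub> f a"
      using u r f mod_hom_smult[OF p r] mod_hom_smult[OF q r] by simp
  qed
  moreover have "bij_betw f (carrier A) (carrier B)"
    unfolding bij_betw_def
  proof
    show "inj_on f (carrier A)" using A f eq by (auto intro!: inj_onI) metis
    have "f ` carrier A = q ` carrier U" using f by (auto simp: pA[symmetric] image_image)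
    then show "f ` carrier A = carrier B" using qB by simp
  qed
  ultimately show ?thesis unfolding mod_isomorphic_def by blast
qed

text \<open>Lets the isomorphisms in degrees below \<open>t - 1\<close> be read off from the one
  between modules with a colon.\<close>

lemma zero_colon_annihilates:
  assumes "annihilates I M"
  shows "zero_colon M I = M"
proof -
  have "{u \<in> carrier M. \<forall>r\<in>I. r \<odot>\<^bsub>M\<^esub> u = \<zero>\<^bsub>M\<^esub>} = carrier M"
    using assms by (auto simp: annihilates_def)
  then show ?thesis unfolding zero_colon_def by simp
qed

lemma submodule_zero_colon:
  assumes "module R M" and I: "I \<subseteq> carrier R"
  shows "submodule (carrier (zero_colon M I)) R M"
proof -
  interpret M: module R M by fact
  have I': "r \<in> carrier R" if "r \<in> I" for r using that I by blast
  have "r \<odot>\<^bsub>M\<^esub> (s \<odot>\<^bsub>M\<^esub> u) = s \<odot>\<^bsub>M\<^esub> (r \<odot>\<^bsub>M\<^esub> u)" if "r \<in> I" "s \<in> carrier R" "u \<in> carrier M" for r s u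
    using that I' by (metis M.smult_assoc1 M.R.m_comm)
  then show ?thesis
    by (intro M.submoduleI) (auto simp: zero_colon_def M.smult_r_distr M.smult_r_minus I')
qed

text \<open>This is the colon ideal \<open>H : v\<close>. Through it the Noetherian property of
  \<open>R\<close> is brought to bear on modules that need not be Noetherian themselves.\<close>

lemma ideal_smult_mem:
  assumes "module R M" and H: "submodule H R M" and v: "v \<in> carrier M"
  shows "ideal {r \<in> carrier R. r \<odot>\<^bsub>M\<^esub> v \<in> H} R"
proof -
  interpret M: module R M by fact
  note H' = M.submoduleE[OF H]
  show ?thesis
  proof (rule idealI)
    show "ring R" by (rule M.R.ring_axioms)
    show "subgroup {r \<in> carrier R. r \<odot>\<^bsub>M\<^esub> v \<in> H} (add_monoid R)"
    proof (rule M.R.add.subgroupI)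
      show "{r \<in> carrier R. r \<odot>\<^bsub>M\<^esub> v \<in> H} \<noteq> {}"
        using v M.submodule_zero[OF H] M.smult_l_null[OF v] M.R.zero_closed by (metis (mono_tags, lifting) empty_iff mem_Collect_eq)
      show "\<ominus>\<^bsub>R\<^esub> r \<in> {r \<in> carrier R. r \<odot>\<^bsub>M\<^esub> v \<in> H}"
        if "r \<in> {r \<in> carrier R. r \<odot>\<^bsub>M\<^esub> v \<in> H}" for r
        using that v H'(3) by (simp add: M.smult_l_minus)
    qed (use v H'(5) in \<open>auto simp: M.smult_l_distr\<close>)
    show "s \<otimes>\<^bsub>R\<^esub> r \<in> {r \<in> carrier R. r \<odot>\<^bsub>M\<^esub> v \<in> H}"
      if "r \<in> {r \<in> carrier R. r \<odot>\<^bsub>M\<^esub> v \<in> H}" "s \<in> carrier R" for r s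
      using that v H' by (auto simp: M.smult_assoc1)
    then show "r \<otimes>\<^bsub>R\<^esub> s \<in> {r \<in> carrier R. r \<odot>\<^bsub>M\<^esub> v \<in> H}"
      if "r \<in> {r \<in> carrier R. r \<odot>\<^bsub>M\<^esub> v \<in> H}" "s \<in> carrier R" for r s
      using that M.R.m_comm by fastforce
  qed
qed

section \<open>Torsion over a Noetherian ring\<close>

lemma (in noetherian_ring) ideal_sequence_stabilises:
  fixes Q :: "nat \<Rightarrow> 'a set"
  assumes I: "\<And>n. ideal (Q n) R" and mono: "\<And>m n. m \<le> n \<Longrightarrow> Q m \<subseteq> Q n"
  obtains k where "\<And>n. Q n \<subseteq> Q k"
proof -
  have "Q m \<subseteq> Q n \<or> Q n \<subseteq> Q m" for m n
    by (rule disjE[OF nat_le_linear[of m n]]) (simp_all add: mono)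
  then have "subset.chain {I. ideal I R} (range Q)"
    using I by (auto simp: subset_chain_def)
  then have "\<Union>(range Q) \<in> range Q"
    by (intro ideal_chain_is_trivial) auto
  then show thesis using that by blast
qed

text \<open>Over a Noetherian ring a nonempty chain of ideals contains its own union, so Zorn's
  lemma applies to an arbitrary nonempty set of ideals.\<close>

lemma (in noetherian_ring) ideal_maximal_exists:
  assumes "\<S> \<noteq> {}" and I: "\<And>I. I \<in> \<S> \<Longrightarrow> ideal I R"
  obtains P where "P \<in> \<S>" "\<And>Q. Q \<in> \<S> \<Longrightarrow> P \<subseteq> Q \<Longrightarrow> Q = P"
proof -
  have "\<exists>P\<in>\<S>. \<forall>Q\<in>\<S>. P \<subseteq> Q \<longrightarrow> Q = P"
  proof (rule subset_Zorn_nonempty[OF assms(1)])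
    fix C assume C: "C \<noteq> {}" "subset.chain \<S> C"
    then have "subset.chain {I. ideal I R} C"
      using I by (auto simp: subset_chain_def)
    with C show "\<Union>C \<in> \<S>"
      using ideal_chain_is_trivial by (auto simp: subset_chain_def)
  qed
  with that show thesis by blast
qed

section \<open>Powers of an ideal and the torsion submodule\<close>

locale noetherian_ideal = noetherian_ring R + cring R + ideal \<aa> R for R (structure) and \<aa>
begin

abbreviation tor :: "('a, 'c) module \<Rightarrow> 'c set"
  where "tor M \<equiv> carrier (torsion_part R \<aa> M)"

abbreviation power :: "nat \<Rightarrow> 'a set"
  where "power n \<equiv> ideal_power R \<aa> n"

text \<open>The exponent law in the monoid of ideals. With \<open>m = n\<close> it turns an even
  power into sums of products \<open>a b\<close> of two elements of the same power.\<close>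

lemma ideal_power_add: "power (m + n) = ideal_prod R (power m) (power n)"
proof -
  interpret S: monoid "ideals_set R"
    using ideals_set_is_comm_monoid comm_monoid.axioms(1) by blast
  show ?thesis
    using S.nat_pow_mult[of \<aa> m n] is_ideal by (simp add: ideals_set_def)
qed

lemma ideal_power_ideal: "ideal (power n) R"
proof -
  interpret S: monoid "ideals_set R"
    using ideals_set_is_comm_monoid comm_monoid.axioms(1) by blast
  show ?thesis
    using S.nat_pow_closed[of \<aa> n] is_ideal by (simp add: ideals_set_def)
qed

lemma ideal_power_carrier: "r \<in> power n \<Longrightarrow> r \<in> carrier R"
  using ideal.Icarr[OF ideal_power_ideal] .

lemma ideal_power_0: "power 0 = carrier R"
  by (simp add: ideals_set_def)

lemma ideal_power_Suc: "power (Suc n) = ideal_prod R (power n) \<aa>"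
  by (simp add: ideals_set_def)

lemma ideal_power_antimono:
  assumes "m \<le> n"
  shows "power n \<subseteq> power m"
  using assms ideal_power_add[of m "n - m"] ideal_prod_inter[OF ideal_power_ideal ideal_power_ideal]
  by auto

lemma nat_pow_in_ideal_power:
  assumes x: "x \<in> \<aa>"
  shows "x [^] (n::nat) \<in> power n"
proof (induction n)
  case 0
  show ?case by (simp only: ideal_power_0 nat_pow_0 one_closed)
next
  case (Suc n)
  then show ?case
    using x unfolding ideal_power_Suc nat_pow_Suc by (intro ideal_prod.prod)
qed

lemma torI:
  assumes "u \<in> carrier M" and "\<And>r. r \<in> power n \<Longrightarrow> r \<odot>\<^bsub>M\<^esub> u = \<zero>\<^bsub>M\<^esub>"
  shows "u \<in> tor M"
  using assms by (auto simp: torsion_part_def)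

lemma torE:
  assumes "u \<in> tor M"
  obtains n where "u \<in> carrier M" "\<And>r. r \<in> power n \<Longrightarrow> r \<odot>\<^bsub>M\<^esub> u = \<zero>\<^bsub>M\<^esub>"
  using assms by (auto simp: torsion_part_def)

lemma tor_carrier: "u \<in> tor M \<Longrightarrow> u \<in> carrier M"
  by (rule torE)

lemma torE2:
  assumes "u \<in> tor M" and "v \<in> tor N"
  obtains n where "\<And>r. r \<in> power n \<Longrightarrow> r \<odot>\<^bsub>M\<^esub> u = \<zero>\<^bsub>M\<^esub> \<and> r \<odot>\<^bsub>N\<^esub> v = \<zero>\<^bsub>N\<^esub>"
proof -
  obtain m where m: "\<And>r. r \<in> power m \<Longrightarrow> r \<odot>\<^bsub>M\<^esub> u = \<zero>\<^bsub>M\<^esub>" using torE[OF assms(1)] by blast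
  obtain n where n: "\<And>r. r \<in> power n \<Longrightarrow> r \<odot>\<^bsub>N\<^esub> v = \<zero>\<^bsub>N\<^esub>" using torE[OF assms(2)] by blast
  have "power (m + n) \<subseteq> power m" "power (m + n) \<subseteq> power n"
    by (rule ideal_power_antimono; simp)+
  with m n show thesis by (intro that[of "m + n"]) blast
qed

lemma tor_submodule:
  assumes "module R M"
  shows "submodule (tor M) R M"
proof -
  interpret M: module R M by fact
  show ?thesis
  proof (rule M.submoduleI)
    show "tor M \<subseteq> carrier M" by (rule subsetI) (rule tor_carrier)
    show "\<zero>\<^bsub>M\<^esub> \<in> tor M"
      by (rule torI[where n = 0]) (simp_all add: ideal_power_carrier[of _ 0])
    show "\<ominus>\<^bsub>M\<^esub> u \<in> tor M" if u: "u \<in> tor M" for u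
    proof -
      obtain n where "\<And>r. r \<in> power n \<Longrightarrow> r \<odot>\<^bsub>M\<^esub> u = \<zero>\<^bsub>M\<^esub>" using torE[OF u] by blast
      then show ?thesis
        using tor_carrier[OF u] by (intro torI[where n = n]) (simp_all add: M.smult_r_minus ideal_power_carrier[of _ n])
    qed
    show "u \<oplus>\<^bsub>M\<^esub> v \<in> tor M" if uv: "u \<in> tor M" "v \<in> tor M" for u v
    proof -
      obtain n where "\<And>r. r \<in> power n \<Longrightarrow> r \<odot>\<^bsub>M\<^esub> u = \<zero>\<^bsub>M\<^esub> \<and> r \<odot>\<^bsub>M\<^esub> v = \<zero>\<^bsub>M\<^esub>"
        using torE2[OF uv] by blast
      then show ?thesis
        using uv[THEN tor_carrier]
        by (intro torI[where n = n]) (simp_all add: M.smult_r_distr ideal_power_carrier[of _ n])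
    qed
    show "s \<odot>\<^bsub>M\<^esub> u \<in> tor M" if su: "s \<in> carrier R" "u \<in> tor M" for s u
    proof -
      obtain n where n: "\<And>r. r \<in> power n \<Longrightarrow> r \<odot>\<^bsub>M\<^esub> u = \<zero>\<^bsub>M\<^esub>" using torE[OF su(2)] by blast
      have "r \<odot>\<^bsub>M\<^esub> (s \<odot>\<^bsub>M\<^esub> u) = \<zero>\<^bsub>M\<^esub>" if "r \<in> power n" for r
        using n[OF that] ideal_power_carrier[OF that] su(1) tor_carrier[OF su(2)]
        by (metis M.smult_assoc1 m_comm M.smult_r_null)
      then show ?thesis
        using su(1) tor_carrier[OF su(2)] by (intro torI[where n = n]) simp_all
    qed
  qed
qed

lemma tor_module: "module R M \<Longrightarrow> module R (torsion_part R \<aa> M)"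
  using submodule_module[OF _ tor_submodule] by (simp add: torsion_part_def)

lemma tor_hom:
  assumes "module R M" and "module R N" and f: "f \<in> mod_hom R M N" and u: "u \<in> tor M"
  shows "f u \<in> tor N"
proof -
  obtain n where n: "\<And>r. r \<in> power n \<Longrightarrow> r \<odot>\<^bsub>M\<^esub> u = \<zero>\<^bsub>M\<^esub>" using torE[OF u] by blast
  have "r \<odot>\<^bsub>N\<^esub> f u = \<zero>\<^bsub>N\<^esub>" if "r \<in> power n" for r
    using n[OF that] mod_hom_smult[OF f ideal_power_carrier[OF that] tor_carrier[OF u]]
      mod_hom_zero[OF assms(1-3)] by simp
  then show ?thesis
    using mod_hom_closed[OF f tor_carrier[OF u]] by (rule torI[rotated])
qed

text \<open>Two torsion elements have a common exponent. It follows that the torsion of a cone can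
  be taken in each component.\<close>

lemma tor_direct_sum: "tor (direct_sum M N) = tor M \<times> tor N"
proof (intro equalityI subsetI)
  fix p assume "p \<in> tor (direct_sum M N)"
  then obtain n where "p \<in> carrier (direct_sum M N)"
    "\<And>r. r \<in> power n \<Longrightarrow> r \<odot>\<^bsub>direct_sum M N\<^esub> p = \<zero>\<^bsub>direct_sum M N\<^esub>"
    by (rule torE) blast
  then show "p \<in> tor M \<times> tor N"
    by (cases p) (auto intro: torI[where n = n])
next
  fix p assume p: "p \<in> tor M \<times> tor N"
  then obtain u v where uv: "p = (u, v)" "u \<in> tor M" "v \<in> tor N" by auto
  obtain n where "\<And>r. r \<in> power n \<Longrightarrow> r \<odot>\<^bsub>M\<^esub> u = \<zero>\<^bsub>M\<^esub> \<and> r \<odot>\<^bsub>N\<^esub> v = \<zero>\<^bsub>N\<^esub>"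
    using torE2[OF uv(2,3)] by blast
  then show "p \<in> tor (direct_sum M N)"
    using uv tor_carrier[OF uv(2)] tor_carrier[OF uv(3)] by (auto intro!: torI[where n = n])
qed

text \<open>The ideals \<open>Q n\<close> of all \<open>r\<close> such that \<open>power n\<close>
  kills \<open>r v\<close> increase with \<open>n\<close> and hence stabilise. So one exponent
  serves for all torsion elements of the cyclic submodule \<open>R v\<close>, although the torsion
  of \<open>M\<close> may have no common exponent.\<close>

lemma tor_smult_stabilises:
  assumes "module R M" and v: "v \<in> carrier M"
  obtains k where "\<And>r s. r \<in> carrier R \<Longrightarrow> r \<odot>\<^bsub>M\<^esub> v \<in> tor M \<Longrightarrow> s \<in> power k \<Longrightarrow>
    s \<odot>\<^bsub>M\<^esub> (r \<odot>\<^bsub>M\<^esub> v) = \<zero>\<^bsub>M\<^esub>"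
proof -
  define Q where "Q n = {r \<in> carrier R. r \<odot>\<^bsub>M\<^esub> v \<in> carrier (zero_colon M (power n))}" for n
  have "power n \<subseteq> carrier R" for n using ideal_power_carrier by blast
  then have "ideal (Q n) R" for n
    unfolding Q_def by (intro ideal_smult_mem submodule_zero_colon assms)
  moreover have "Q m \<subseteq> Q n" if "m \<le> n" for m n
    using ideal_power_antimono[OF that] by (auto simp: Q_def zero_colon_def)
  ultimately obtain k where k: "\<And>n. Q n \<subseteq> Q k"
    using ideal_sequence_stabilises[of Q] by blast
  show thesis
  proof (rule that)
    fix r s assume r: "r \<in> carrier R" "r \<odot>\<^bsub>M\<^esub> v \<in> tor M" and s: "s \<in> power k"
    from r(2) obtain n where "r \<odot>\<^bsub>M\<^esub> v \<in> carrier M" "\<And>s. s \<in> power n \<Longrightarrow> s \<odot>\<^bsub>M\<^esub> (r \<odot>\<^bsub>M\<^esub> v) = \<zero>\<^bsub>M\<^esub>"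
      by (rule torE) blast
    then have "r \<in> Q n" using r(1) by (simp add: Q_def zero_colon_def)
    with k s show "s \<odot>\<^bsub>M\<^esub> (r \<odot>\<^bsub>M\<^esub> v) = \<zero>\<^bsub>M\<^esub>" by (auto simp: Q_def zero_colon_def)
  qed
qed

text \<open>If \<open>power k\<close> kills every torsion multiple of \<open>v\<close>, then
  \<open>power (Suc k)\<close> kills \<open>v\<close>. In other words, no nonzero element of
  \<open>M\<close> modulo its torsion is killed by \<aa>.\<close>

lemma tor_if_smult_tor:
  assumes "module R M" and v: "v \<in> carrier M" and a: "\<And>r. r \<in> \<aa> \<Longrightarrow> r \<odot>\<^bsub>M\<^esub> v \<in> tor M"
  shows "v \<in> tor M"
proof -
  interpret M: module R M by fact
  obtain k where k: "\<And>r s. r \<in> carrier R \<Longrightarrow> r \<odot>\<^bsub>M\<^esub> v \<in> tor M \<Longrightarrow> s \<in> power k \<Longrightarrow>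
    s \<odot>\<^bsub>M\<^esub> (r \<odot>\<^bsub>M\<^esub> v) = \<zero>\<^bsub>M\<^esub>"
    using tor_smult_stabilises[OF assms(1) v] by blast
  show ?thesis
  proof (rule torI[OF v])
    fix r assume "r \<in> power (Suc k)"
    then have "r \<in> ideal_prod R (power k) \<aa>" by (simp only: ideal_power_Suc)
    then have "r \<in> carrier R \<and> r \<odot>\<^bsub>M\<^esub> v = \<zero>\<^bsub>M\<^esub>"
    proof induction
      case (prod i j)
      then show ?case
        using k[of j i] a[of j] v Icarr[of j] ideal_power_carrier[of i k] by (simp add: M.smult_assoc1)
    next
      case (sum r s)
      then show ?case using v by (simp add: M.smult_l_distr)
    qed
    then show "r \<odot>\<^bsub>M\<^esub> v = \<zero>\<^bsub>M\<^esub>" by simp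
  qed
qed

text \<open>The ideal below is an associated prime of \<open>M / \<Gamma>\<^sub>\<aa> M\<close>.\<close>

lemma prime_of_non_tor:
  assumes "module R M" and v: "v \<in> carrier M" "v \<notin> tor M"
  obtains r where "r \<in> carrier R" "primeideal {s \<in> carrier R. s \<odot>\<^bsub>M\<^esub> (r \<odot>\<^bsub>M\<^esub> v) \<in> tor M} R"
    "\<not> \<aa> \<subseteq> {s \<in> carrier R. s \<odot>\<^bsub>M\<^esub> (r \<odot>\<^bsub>M\<^esub> v) \<in> tor M}"
proof -
  interpret M: module R M by fact
  note T = tor_submodule[OF assms(1)]
  define P where "P u = {s \<in> carrier R. s \<odot>\<^bsub>M\<^esub> u \<in> tor M}" for u
  define \<S> where "\<S> = {P (r \<odot>\<^bsub>M\<^esub> v) | r. r \<in> carrier R \<and> r \<odot>\<^bsub>M\<^esub> v \<notin> tor M}"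
  have P: "ideal (P u) R" if "u \<in> carrier M" for u
    unfolding P_def by (rule ideal_smult_mem[OF assms(1) T that])
  have "\<one> \<odot>\<^bsub>M\<^esub> v \<notin> tor M" using v by simp
  then have "P (\<one> \<odot>\<^bsub>M\<^esub> v) \<in> \<S>" unfolding \<S>_def by blast
  then have "\<S> \<noteq> {}" by blast
  moreover have "ideal I R" if "I \<in> \<S>" for I using that P v by (auto simp: \<S>_def)
  ultimately obtain I where I: "I \<in> \<S>" and max: "\<And>Q. Q \<in> \<S> \<Longrightarrow> I \<subseteq> Q \<Longrightarrow> Q = I"
    by (rule ideal_maximal_exists) blast+
  from I obtain r where r: "r \<in> carrier R" "r \<odot>\<^bsub>M\<^esub> v \<notin> tor M" and Ir: "I = P (r \<odot>\<^bsub>M\<^esub> v)"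
    by (auto simp: \<S>_def)
  define u where "u = r \<odot>\<^bsub>M\<^esub> v"
  have u: "u \<in> carrier M" "u \<notin> tor M" using r v by (auto simp: u_def)
  have "primeideal I R"
  proof (rule primeidealI)
    show "ideal I R" unfolding Ir using P u by (simp add: u_def)
    show "cring R" by (rule is_cring)
    have "\<one> \<notin> I" using u by (simp add: Ir P_def flip: u_def)
    then show "carrier R \<noteq> I" by blast
    fix s t assume st: "s \<in> carrier R" "t \<in> carrier R" "s \<otimes> t \<in> I"
    show "s \<in> I \<or> t \<in> I"
    proof (cases "s \<in> I")
      \<comment> \<open>Now \<open>s u\<close> is a nontorsion multiple of \<open>v\<close> whose
        ideal contains \<open>I\<close>, hence equals \<open>I\<close> by maximality; and
        \<open>s t \<in> I\<close> says that \<open>t\<close> lies in it.\<close>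
      case False
      then have s: "s \<odot>\<^bsub>M\<^esub> u \<notin> tor M" using st by (simp add: Ir P_def u_def)
      moreover have su: "s \<odot>\<^bsub>M\<^esub> u = (s \<otimes> r) \<odot>\<^bsub>M\<^esub> v"
        using st r v by (simp add: u_def M.smult_assoc1)
      ultimately have "P (s \<odot>\<^bsub>M\<^esub> u) \<in> \<S>"
        using st r by (auto simp: \<S>_def)
      moreover have "I \<subseteq> P (s \<odot>\<^bsub>M\<^esub> u)"
      proof
        fix q assume q: "q \<in> I"
        then have q': "q \<in> carrier R" "q \<odot>\<^bsub>M\<^esub> u \<in> tor M" by (auto simp: Ir P_def u_def)
        then have "s \<odot>\<^bsub>M\<^esub> (q \<odot>\<^bsub>M\<^esub> u) \<in> tor M" using M.submoduleE(4)[OF T] st by blast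
        then show "q \<in> P (s \<odot>\<^bsub>M\<^esub> u)"
          using q' st u by (simp add: P_def m_comm flip: M.smult_assoc1)
      qed
      ultimately have "P (s \<odot>\<^bsub>M\<^esub> u) = I" using max by blast
      moreover have "t \<in> P (s \<odot>\<^bsub>M\<^esub> u)"
        using st u by (simp add: Ir P_def m_comm flip: M.smult_assoc1 u_def)
      ultimately show ?thesis by simp
    qed simp
  qed
  moreover have "\<not> \<aa> \<subseteq> I"
    using tor_if_smult_tor[OF assms(1) u(1)] u(2) by (auto simp: Ir P_def u_def)
  ultimately show thesis
    using that[of r] r(1) by (simp add: Ir P_def)
qed

text \<open>Otherwise some \<open>u = r v\<close> has, modulo torsion, a prime annihilator that does
  not contain \<aa>. Multiplying \<open>u\<close> by a suitable \<open>s\<close> from a power of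
  \<aa> makes this prime an annihilator in \<open>M\<close> itself, hence an associated prime
  outside the closed set of \<aa>. But \<open>x v = 0\<close> puts \<open>x\<close> into it.\<close>

lemma filter_regular_zero_divisor_tor:
  assumes "module R M" and x: "filter_regular R \<aa> M x"
    and v: "v \<in> carrier M" "x \<odot>\<^bsub>M\<^esub> v = \<zero>\<^bsub>M\<^esub>"
  shows "v \<in> tor M"
proof (rule ccontr)
  interpret M: module R M by fact
  assume "v \<notin> tor M"
  with assms(1) v(1) obtain r where r: "r \<in> carrier R"
    and p': "primeideal {s \<in> carrier R. s \<odot>\<^bsub>M\<^esub> (r \<odot>\<^bsub>M\<^esub> v) \<in> tor M} R"
      "\<not> \<aa> \<subseteq> {s \<in> carrier R. s \<odot>\<^bsub>M\<^esub> (r \<odot>\<^bsub>M\<^esub> v) \<in> tor M}"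
    by (rule prime_of_non_tor)
  let ?p = "{s \<in> carrier R. s \<odot>\<^bsub>M\<^esub> (r \<odot>\<^bsub>M\<^esub> v) \<in> tor M}"
  note p = p'(1) and ap = p'(2)
  define u where "u = r \<odot>\<^bsub>M\<^esub> v"
  have u: "u \<in> carrier M" using r v by (simp add: u_def)
  have xR: "x \<in> carrier R" using x Icarr by (simp add: filter_regular_def)
  obtain k where k: "\<And>t s. t \<in> carrier R \<Longrightarrow> t \<odot>\<^bsub>M\<^esub> u \<in> tor M \<Longrightarrow> s \<in> power k \<Longrightarrow>
    s \<odot>\<^bsub>M\<^esub> (t \<odot>\<^bsub>M\<^esub> u) = \<zero>\<^bsub>M\<^esub>"
    using tor_smult_stabilises[OF assms(1) u] by blast
  have nonmem: "\<exists>s. s \<in> power n \<and> s \<notin> ?p" for n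
  proof (induction n)
    case 0
    have "\<one> \<notin> ?p" using p by (metis ideal.one_imp_carrier primeideal.I_notcarr primeideal.axioms(1))
    then show ?case using ideal_power_0 by blast
  next
    case (Suc n)
    then obtain s where s: "s \<in> power n" "s \<notin> ?p" by blast
    obtain a where a: "a \<in> \<aa>" "a \<notin> ?p" using ap by blast
    have "s \<otimes> a \<notin> ?p"
      using primeideal.I_prime[OF p] ideal_power_carrier[OF s(1)] Icarr[OF a(1)] s(2) a(2) by blast
    moreover have "s \<otimes> a \<in> power (Suc n)"
      unfolding ideal_power_Suc by (rule ideal_prod.prod[OF s(1) a(1)])
    ultimately show ?case by blast
  qed
  obtain s where s: "s \<in> power k" "s \<notin> ?p" using nonmem by blast
  have sR: "s \<in> carrier R" by (rule ideal_power_carrier[OF s(1)])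
  \<comment> \<open>The power \<open>k\<close> kills all torsion in \<open>R u\<close>, so
    multiplying by \<open>s\<close> turns "torsion" into "zero". The converse cancels
    \<open>s\<close>, which lies outside the prime.\<close>
  have ann: "?p = {t \<in> carrier R. t \<odot>\<^bsub>M\<^esub> (s \<odot>\<^bsub>M\<^esub> u) = \<zero>\<^bsub>M\<^esub>}"
  proof (intro equalityI subsetI)
    fix t assume "t \<in> ?p"
    then have "t \<in> carrier R" "s \<odot>\<^bsub>M\<^esub> (t \<odot>\<^bsub>M\<^esub> u) = \<zero>\<^bsub>M\<^esub>" using k s by (auto simp: u_def)
    then show "t \<in> {t \<in> carrier R. t \<odot>\<^bsub>M\<^esub> (s \<odot>\<^bsub>M\<^esub> u) = \<zero>\<^bsub>M\<^esub>}"
      using sR u by (simp add: m_comm flip: M.smult_assoc1)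
  next
    fix t assume t: "t \<in> {t \<in> carrier R. t \<odot>\<^bsub>M\<^esub> (s \<odot>\<^bsub>M\<^esub> u) = \<zero>\<^bsub>M\<^esub>}"
    then have "(t \<otimes> s) \<odot>\<^bsub>M\<^esub> u = \<zero>\<^bsub>M\<^esub>" using sR u by (simp add: M.smult_assoc1)
    then have "t \<otimes> s \<in> ?p"
      using t sR M.submodule_zero[OF tor_submodule[OF assms(1)]] by (auto simp: u_def)
    then show "t \<in> ?p" using primeideal.I_prime[OF p] t sR s(2) by blast
  qed
  have "s \<odot>\<^bsub>M\<^esub> u \<in> carrier M" using sR u by simp
  then have "?p \<in> Ass R M" using p ann unfolding Ass_def by blast
  moreover have "?p \<notin> primes_above R \<aa>" using ap unfolding primes_above_def by blast
  ultimately have "?p \<in> Ass R M - primes_above R \<aa>" by (rule DiffI)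
  with x[unfolded filter_regular_def, THEN conjunct2] have "x \<notin> ?p" by (rule bspec)
  have "x \<odot>\<^bsub>M\<^esub> (r \<odot>\<^bsub>M\<^esub> v) = (r \<otimes> x) \<odot>\<^bsub>M\<^esub> v"
    using v(1) r xR by (simp add: m_comm flip: M.smult_assoc1)
  also have "\<dots> = \<zero>\<^bsub>M\<^esub>" using v r xR by (simp add: M.smult_assoc1)
  finally have "x \<in> ?p" using xR M.submodule_zero[OF tor_submodule[OF assms(1)]] by simp
  with \<open>x \<notin> ?p\<close> show False by contradiction
qed

end

section \<open>Torsion of injective modules\<close>

lemma submodule_self_module:
  assumes "cring R" and I: "ideal I R"
  shows "submodule I R (self_module R)"
proof -
  interpret R: cring R by fact
  interpret I: ideal I R by fact
  interpret S: module R "self_module R" by (rule module_self_module) fact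
  have minus: "\<ominus>\<^bsub>self_module R\<^esub> r = \<ominus>\<^bsub>R\<^esub> r" for r
    by (simp add: self_module_def a_inv_def m_inv_def)
  show ?thesis
    by (rule S.submoduleI; (simp only: minus)?) (auto simp: self_module_def I.I_l_closed I.Icarr)
qed

context noetherian_ideal
begin

text \<open>Among the elements \<open>v\<close> with \<open>g r = r v\<close> on \<open>J\<close>, one for which \<open>{r. r v \<in> \<Gamma>\<^sub>\<aa> E}\<close> is maximal
  is torsion: \<open>r \<mapsto> r v\<close> on that ideal extends by \<open>0\<close> to \<open>x\<^sup>m\<close> for some \<open>m\<close> depending on \<open>x \<in> \<aa>\<close>.\<close>

lemma tor_extend_ideal:
  assumes E: "injective_module R E" and J: "ideal J R"
    and tor: "\<And>r. r \<in> J \<Longrightarrow> g r \<in> tor E"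
    and add: "\<And>r s. r \<in> J \<Longrightarrow> s \<in> J \<Longrightarrow> g (r \<oplus> s) = g r \<oplus>\<^bsub>E\<^esub> g s"
    and sm: "\<And>r s. r \<in> carrier R \<Longrightarrow> s \<in> J \<Longrightarrow> g (r \<otimes> s) = r \<odot>\<^bsub>E\<^esub> g s"
  obtains w where "w \<in> tor E" "\<And>r. r \<in> J \<Longrightarrow> g r = r \<odot>\<^bsub>E\<^esub> w"
proof -
  have EM: "module R E" by (rule injective_module_module[OF E])
  interpret E: module R E by fact
  note T = tor_submodule[OF EM]
  define V where "V = {v \<in> carrier E. \<forall>r\<in>J. g r = r \<odot>\<^bsub>E\<^esub> v}"
  define P where "P v = {r \<in> carrier R. r \<odot>\<^bsub>E\<^esub> v \<in> tor E}" for v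
  have P: "ideal (P v) R" if "v \<in> carrier E" for v
    unfolding P_def by (rule ideal_smult_mem[OF EM T that])
  have "\<exists>v\<in>carrier E. \<forall>r\<in>J. g r = r \<odot>\<^bsub>E\<^esub> v"
    by (rule injective_module_extend_ideal[OF is_cring E J tor_carrier[OF tor] add sm])
  then have "P ` V \<noteq> {}" by (auto simp: V_def)
  moreover have "ideal I R" if "I \<in> P ` V" for I using that P by (auto simp: V_def)
  ultimately obtain I where I: "I \<in> P ` V" and max: "\<And>Q. Q \<in> P ` V \<Longrightarrow> I \<subseteq> Q \<Longrightarrow> Q = I"
    using ideal_maximal_exists[of "P ` V"] by blast
  from I obtain v where vV: "v \<in> V" and Iv: "I = P v" by blast
  then have v: "v \<in> carrier E" and gv: "\<And>r. r \<in> J \<Longrightarrow> g r = r \<odot>\<^bsub>E\<^esub> v" by (auto simp: V_def)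
  have "v \<in> tor E"
  proof (rule ccontr)
    assume "v \<notin> tor E"
    with EM v obtain r where r: "r \<in> carrier R"
      and q: "primeideal {s \<in> carrier R. s \<odot>\<^bsub>E\<^esub> (r \<odot>\<^bsub>E\<^esub> v) \<in> tor E} R"
        "\<not> \<aa> \<subseteq> {s \<in> carrier R. s \<odot>\<^bsub>E\<^esub> (r \<odot>\<^bsub>E\<^esub> v) \<in> tor E}"
      by (rule prime_of_non_tor)
    define q where "q = {s \<in> carrier R. s \<odot>\<^bsub>E\<^esub> (r \<odot>\<^bsub>E\<^esub> v) \<in> tor E}"
    have q: "primeideal q R" using q(1) by (simp add: q_def)
    obtain x where x: "x \<in> \<aa>" "x \<notin> q" using \<open>\<not> \<aa> \<subseteq> _\<close> by (auto simp: q_def)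
    have xR: "x [^] (n::nat) \<in> carrier R" for n using Icarr[OF x(1)] by simp
    \<comment> \<open>The chain stabilises at an exponent \<open>m\<close> such that
      \<open>x ^ m\<close> kills every multiple of \<open>v\<close> that is killed by some power of
      \<open>x\<close>.\<close>
    define Q where "Q n = {s \<in> carrier R. s \<odot>\<^bsub>E\<^esub> v \<in> carrier (zero_colon E {x [^] n})}" for n :: nat
    have Q: "s \<in> Q n \<longleftrightarrow> s \<in> carrier R \<and> x [^] n \<odot>\<^bsub>E\<^esub> (s \<odot>\<^bsub>E\<^esub> v) = \<zero>\<^bsub>E\<^esub>" for s n
      using v by (auto simp: Q_def zero_colon_def)
    have "ideal (Q n) R" for n
      unfolding Q_def by (intro ideal_smult_mem submodule_zero_colon EM v) (use xR in auto)
    moreover have "Q i \<subseteq> Q j" if "i \<le> j" for i j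
    proof
      fix s assume s: "s \<in> Q i"
      have "x [^] j = x [^] (j - i) \<otimes> x [^] i"
        using nat_pow_mult[OF Icarr[OF x(1)], of "j - i" i] that by simp
      then show "s \<in> Q j" using s xR v by (simp add: Q E.smult_assoc1)
    qed
    ultimately obtain m where m: "\<And>n. Q n \<subseteq> Q m"
      using ideal_sequence_stabilises[of Q] by blast
    define S where "S = self_module R"
    have S: "module R S" unfolding S_def by (rule module_self_module[OF is_cring])
    have A: "module R (S\<lparr>carrier := P v\<rparr>)"
      unfolding S_def by (intro submodule_module module_self_module submodule_self_module P v is_cring)
    have PR: "s \<in> carrier R" if "s \<in> P v" for s using that by (simp add: P_def)
    \<comment> \<open>The value \<open>s v\<close> is to depend only on the element
      \<open>s + x ^ m t\<close> of the ideal \<open>P v + x ^ m R\<close>. If that element is 0,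
      then \<open>x ^ m t v = - s v\<close> is torsion, so a further power of \<open>x\<close> kills
      it, and by the choice of \<open>m\<close> it is already 0.\<close>
    have "(\<lambda>(s, t). s \<oplus> x [^] m \<otimes> t) \<in> mod_hom R (direct_sum (S\<lparr>carrier := P v\<rparr>) S) S"
      using PR xR by (intro mod_homI) (auto simp: S_def self_module_def r_distr m_assoc m_lcomm a_ac)
    moreover have "(\<lambda>(s, t). s \<odot>\<^bsub>E\<^esub> v) \<in> mod_hom R (direct_sum (S\<lparr>carrier := P v\<rparr>) S) E"
      using PR v by (intro mod_homI) (auto simp: S_def self_module_def E.smult_l_distr E.smult_assoc1)
    moreover have "(case p of (s, t) \<Rightarrow> s \<odot>\<^bsub>E\<^esub> v) = \<zero>\<^bsub>E\<^esub>"
      if pc: "p \<in> carrier (direct_sum (S\<lparr>carrier := P v\<rparr>) S)"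
        and p0: "(case p of (s, t) \<Rightarrow> s \<oplus> x [^] m \<otimes> t) = \<zero>\<^bsub>S\<^esub>" for p
    proof -
      obtain s t where st: "p = (s, t)" "s \<in> P v" "t \<in> carrier R"
        using pc by (auto simp: S_def self_module_def)
      have z: "(s \<oplus> x [^] m \<otimes> t) \<odot>\<^bsub>E\<^esub> v = \<zero>\<^bsub>E\<^esub>"
        using p0 st v by (simp add: S_def self_module_def)
      have sm: "s \<odot>\<^bsub>E\<^esub> v \<oplus>\<^bsub>E\<^esub> x [^] m \<odot>\<^bsub>E\<^esub> (t \<odot>\<^bsub>E\<^esub> v) = \<zero>\<^bsub>E\<^esub>"
        using z PR[OF st(2)] st(3) xR v by (simp add: E.smult_l_distr E.smult_assoc1)
      then have "\<ominus>\<^bsub>E\<^esub> (s \<odot>\<^bsub>E\<^esub> v) = x [^] m \<odot>\<^bsub>E\<^esub> (t \<odot>\<^bsub>E\<^esub> v)"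
        using PR[OF st(2)] st(3) xR v by (simp add: E.M.minus_equality E.M.a_comm)
      moreover have "\<ominus>\<^bsub>E\<^esub> (s \<odot>\<^bsub>E\<^esub> v) \<in> tor E"
        using st(2) E.submoduleE(3)[OF T] by (simp add: P_def)
      ultimately have "x [^] m \<odot>\<^bsub>E\<^esub> (t \<odot>\<^bsub>E\<^esub> v) \<in> tor E" by simp
      then obtain n where "\<And>a. a \<in> power n \<Longrightarrow> a \<odot>\<^bsub>E\<^esub> (x [^] m \<odot>\<^bsub>E\<^esub> (t \<odot>\<^bsub>E\<^esub> v)) = \<zero>\<^bsub>E\<^esub>"
        by (rule torE) blast
      then have "x [^] n \<odot>\<^bsub>E\<^esub> (x [^] m \<odot>\<^bsub>E\<^esub> (t \<odot>\<^bsub>E\<^esub> v)) = \<zero>\<^bsub>E\<^esub>"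
        using nat_pow_in_ideal_power[OF x(1)] by blast
      then have "t \<in> Q (n + m)"
        using xR v st(3) by (simp add: Q nat_pow_mult[OF Icarr[OF x(1)], symmetric] E.smult_assoc1)
      then have "t \<in> Q m" using m by blast
      then show ?thesis using sm st PR v by (simp add: Q)
    qed
    ultimately obtain h where h: "h \<in> mod_hom R S E"
      and hf: "\<And>p. p \<in> carrier (direct_sum (S\<lparr>carrier := P v\<rparr>) S) \<Longrightarrow>
        h (case p of (s, t) \<Rightarrow> s \<oplus> x [^] m \<otimes> t) = (case p of (s, t) \<Rightarrow> s \<odot>\<^bsub>E\<^esub> v)"
      by (rule injective_module_factor[OF E module_direct_sum[OF A S] S]) blast+
    \<comment> \<open>The element \<open>w\<close> agrees with \<open>v\<close> on
      \<open>P v\<close>, which contains \<open>J\<close>, and satisfies \<open>x ^ m w = 0\<close>.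
      So \<open>w\<close> competes with \<open>v\<close>, and maximality forces \<open>x ^ m\<close>
      into \<open>P v\<close>; this contradicts that \<open>x\<close> lies outside the prime
      \<open>q\<close>.\<close>
    define w where "w = h \<one>"
    have w: "w \<in> carrier E" using mod_hom_closed[OF h] by (simp add: w_def S_def self_module_def)
    have hw: "h s = s \<odot>\<^bsub>E\<^esub> w" if "s \<in> carrier R" for s
      using mod_hom_smult[OF h that, of \<one>] that by (simp add: w_def S_def self_module_def)
    have 0: "\<zero> \<in> P v" using E.submodule_zero[OF T] v by (simp add: P_def)
    have Pw: "s \<odot>\<^bsub>E\<^esub> w = s \<odot>\<^bsub>E\<^esub> v" if "s \<in> P v" for s
      using hf[of "(s, \<zero>)"] hw[of s] that PR xR by (simp add: S_def self_module_def)
    have xw: "x [^] m \<odot>\<^bsub>E\<^esub> w = \<zero>\<^bsub>E\<^esub>"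
      using hf[of "(\<zero>, \<one>)"] hw[of "x [^] m"] 0 xR v by (simp add: S_def self_module_def)
    have JP: "J \<subseteq> P v"
    proof
      fix s assume s: "s \<in> J"
      then have "s \<odot>\<^bsub>E\<^esub> v \<in> tor E" using tor[OF s] gv[OF s] by simp
      then show "s \<in> P v" using ideal.Icarr[OF J s] by (simp add: P_def)
    qed
    have "w \<in> V" using w gv Pw JP by (auto simp: V_def)
    moreover have "P v \<subseteq> P w"
    proof
      fix s assume s: "s \<in> P v"
      then show "s \<in> P w" using Pw[OF s] by (simp add: P_def)
    qed
    ultimately have "P w = P v" using max Iv by blast
    moreover have "x [^] m \<in> P w" using xw xR E.submodule_zero[OF T] by (simp add: P_def)
    ultimately have "x [^] m \<odot>\<^bsub>E\<^esub> v \<in> tor E" by (simp add: P_def)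
    then have "r \<odot>\<^bsub>E\<^esub> (x [^] m \<odot>\<^bsub>E\<^esub> v) \<in> tor E" by (rule E.submoduleE(4)[OF T r])
    then have "x [^] m \<in> q"
      using xR r v by (simp add: q_def m_comm flip: E.smult_assoc1)
    then have "x \<in> q"
    proof (induction m)
      case 0
      then show ?case
        using q by (metis ideal.one_imp_carrier nat_pow_0 primeideal.I_notcarr primeideal.axioms(1))
    next
      case (Suc m)
      then show ?case
        using primeideal.I_prime[OF q xR[of m] Icarr[OF x(1)]] by auto
    qed
    with x(2) show False by contradiction
  qed
  then show thesis using gv by (rule that)
qed

text \<open>\<open>\<sigma>\<close> projects to a complement \<open>W\<close> of the torsion, which is any submodule maximal with
  \<open>W \<inter> \<Gamma>\<^sub>\<aa> E = 0\<close>.\<close>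

lemma injective_split_tor:
  assumes E: "injective_module R E"
  obtains \<sigma> where "\<sigma> \<in> mod_hom R E E" "\<And>u. u \<in> tor E \<Longrightarrow> \<sigma> u = \<zero>\<^bsub>E\<^esub>"
    "\<And>y. y \<in> carrier E \<Longrightarrow> y \<ominus>\<^bsub>E\<^esub> \<sigma> y \<in> tor E"
proof -
  have EM: "module R E" by (rule injective_module_module[OF E])
  interpret E: module R E by fact
  note T = tor_submodule[OF EM]
  note T' = E.submoduleE[OF T]
  define \<W> where "\<W> = {W. submodule W R E \<and> W \<inter> tor E \<subseteq> {\<zero>\<^bsub>E\<^esub>}}"
  have "\<exists>W\<in>\<W>. \<forall>X\<in>\<W>. W \<subseteq> X \<longrightarrow> X = W"
  proof (rule subset_Zorn_nonempty)
    have "submodule {\<zero>\<^bsub>E\<^esub>} R E" by (rule E.submoduleI) auto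
    then show "\<W> \<noteq> {}" by (auto simp: \<W>_def)
    fix C assume ne: "C \<noteq> {}" and C: "subset.chain \<W> C"
    have CW: "submodule W R E" "W \<inter> tor E \<subseteq> {\<zero>\<^bsub>E\<^esub>}" if "W \<in> C" for W
      using C that by (auto simp: subset_chain_def \<W>_def)
    have "submodule (\<Union>C) R E"
    proof (rule E.submoduleI)
      show "\<Union>C \<subseteq> carrier E" using E.submoduleE(1)[OF CW(1)] by blast
      show "\<zero>\<^bsub>E\<^esub> \<in> \<Union>C" using ne E.submodule_zero[OF CW(1)] by blast
      show "\<ominus>\<^bsub>E\<^esub> a \<in> \<Union>C" if "a \<in> \<Union>C" for a using that E.submoduleE(3)[OF CW(1)] by blast
      show "r \<odot>\<^bsub>E\<^esub> a \<in> \<Union>C" if "r \<in> carrier R" "a \<in> \<Union>C" for r a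
        using that E.submoduleE(4)[OF CW(1)] by blast
      fix a b assume "a \<in> \<Union>C" "b \<in> \<Union>C"
      then obtain W X where WX: "W \<in> C" "a \<in> W" "X \<in> C" "b \<in> X" by blast
      have "W \<subseteq> X \<or> X \<subseteq> W" using C WX by (auto simp: subset_chain_def)
      then obtain Y where "Y \<in> C" "a \<in> Y" "b \<in> Y" using WX by blast
      then show "a \<oplus>\<^bsub>E\<^esub> b \<in> \<Union>C" using E.submoduleE(5)[OF CW(1)] by blast
    qed
    then show "\<Union>C \<in> \<W>" using CW(2) by (auto simp: \<W>_def)
  qed
  then obtain W where "W \<in> \<W>" and max': "\<forall>X\<in>\<W>. W \<subseteq> X \<longrightarrow> X = W" by blast
  then have W: "submodule W R E" and WT: "\<And>w. w \<in> W \<Longrightarrow> w \<in> tor E \<Longrightarrow> w = \<zero>\<^bsub>E\<^esub>"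
    by (auto simp: \<W>_def)
  have max: "X = W" if "submodule X R E" "\<And>w. w \<in> X \<Longrightarrow> w \<in> tor E \<Longrightarrow> w = \<zero>\<^bsub>E\<^esub>" "W \<subseteq> X" for X
    using that max' by (auto simp: \<W>_def)
  note W' = E.submoduleE[OF W]
  \<comment> \<open>\<open>D y t\<close> says that \<open>t\<close> is the torsion component of
    \<open>y\<close> along \<open>W\<close>. It is the graph of a homomorphism defined so far only
    on the sum of \<open>W\<close> and the torsion; \<open>Dtot\<close> shows that this sum is
    everything.\<close>
  define D where "D y t \<longleftrightarrow> y \<in> carrier E \<and> t \<in> tor E \<and> y \<ominus>\<^bsub>E\<^esub> t \<in> W" for y t
  have Dc: "y \<in> carrier E" "t \<in> carrier E" if "D y t" for y t
    using that tor_carrier[of t E] by (auto simp: D_def)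
  have Dadd: "D (y \<oplus>\<^bsub>E\<^esub> y') (t \<oplus>\<^bsub>E\<^esub> t')" if "D y t" "D y' t'" for y y' t t'
  proof -
    have "(y \<oplus>\<^bsub>E\<^esub> y') \<ominus>\<^bsub>E\<^esub> (t \<oplus>\<^bsub>E\<^esub> t') = (y \<ominus>\<^bsub>E\<^esub> t) \<oplus>\<^bsub>E\<^esub> (y' \<ominus>\<^bsub>E\<^esub> t')"
      using Dc[OF that(1)] Dc[OF that(2)] by (simp add: E.M.diff_simps)
    then show ?thesis using that W'(5) T'(5) by (simp add: D_def)
  qed
  have Dsm: "D (r \<odot>\<^bsub>E\<^esub> y) (r \<odot>\<^bsub>E\<^esub> t)" if "r \<in> carrier R" "D y t" for r y t
  proof -
    have "r \<odot>\<^bsub>E\<^esub> y \<ominus>\<^bsub>E\<^esub> r \<odot>\<^bsub>E\<^esub> t = r \<odot>\<^bsub>E\<^esub> (y \<ominus>\<^bsub>E\<^esub> t)"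
      using that(1) Dc[OF that(2)] by (simp add: E.M.minus_eq E.smult_r_distr E.smult_r_minus)
    then show ?thesis using that W'(4) T'(4) by (simp add: D_def)
  qed
  have Duniq: "t = t'" if "D y t" "D y t'" for y t t'
  proof -
    have "t \<ominus>\<^bsub>E\<^esub> t' = (y \<ominus>\<^bsub>E\<^esub> t') \<ominus>\<^bsub>E\<^esub> (y \<ominus>\<^bsub>E\<^esub> t)"
      using Dc[OF that(1)] Dc[OF that(2)] by (simp add: E.M.diff_simps)
    then have "t \<ominus>\<^bsub>E\<^esub> t' \<in> W" using that E.submodule_diff[OF W] by (simp add: D_def)
    moreover have "t \<ominus>\<^bsub>E\<^esub> t' \<in> tor E" using that E.submodule_diff[OF T] by (simp add: D_def)
    ultimately show ?thesis
      using WT Dc(2)[OF that(1)] Dc(2)[OF that(2)] E.M.diff_eq_zero_iff by blast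
  qed
  have Dtot: "\<exists>t. D v t" if v: "v \<in> carrier E" for v
  proof -
    define H where "H = {y. \<exists>t. D y t}"
    have D0: "D \<zero>\<^bsub>E\<^esub> \<zero>\<^bsub>E\<^esub>"
      using E.submodule_zero[OF T] E.submodule_zero[OF W] by (simp add: D_def E.M.minus_eq W'(3) T'(3))
    have H: "submodule H R E"
    proof (rule E.submoduleI)
      show "H \<subseteq> carrier E" using Dc by (auto simp: H_def)
      show "\<zero>\<^bsub>E\<^esub> \<in> H" using D0 by (auto simp: H_def)
      show "\<ominus>\<^bsub>E\<^esub> a \<in> H" if aH: "a \<in> H" for a
      proof -
        obtain t where t: "D a t" using aH by (auto simp: H_def)
        from Dsm[OF _ t, of "\<ominus> \<one>"] show ?thesis
          using Dc[OF t] by (auto simp: H_def E.smult_l_minus)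
      qed
      show "a \<oplus>\<^bsub>E\<^esub> b \<in> H" if "a \<in> H" "b \<in> H" for a b
        using that Dadd unfolding H_def by blast
      show "r \<odot>\<^bsub>E\<^esub> a \<in> H" if "r \<in> carrier R" "a \<in> H" for r a
        using that Dsm unfolding H_def by blast
    qed
    \<comment> \<open>For \<open>r \<in> J\<close> the multiple \<open>r v\<close> has a torsion
      component \<open>g r\<close>. By \<open>tor_extend_ideal\<close> it equals \<open>r t\<close>
      for a single torsion element \<open>t\<close>; the aim is then
      \<open>v - t \<in> W\<close>.\<close>
    define J where "J = {r \<in> carrier R. r \<odot>\<^bsub>E\<^esub> v \<in> H}"
    have J: "ideal J R" unfolding J_def by (rule ideal_smult_mem[OF EM H v])
    define g where "g r = (THE t. D (r \<odot>\<^bsub>E\<^esub> v) t)" for r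
    have geq: "g r = t" if "D (r \<odot>\<^bsub>E\<^esub> v) t" for r t
      unfolding g_def using that Duniq by blast
    have g: "D (r \<odot>\<^bsub>E\<^esub> v) (g r)" if "r \<in> J" for r
      using that geq by (auto simp: J_def H_def)
    have JR: "r \<in> carrier R" if "r \<in> J" for r using that by (simp add: J_def)
    obtain t where t: "t \<in> tor E" and gt: "\<And>r. r \<in> J \<Longrightarrow> g r = r \<odot>\<^bsub>E\<^esub> t"
    proof (rule tor_extend_ideal[OF E J, of g])
      show "g r \<in> tor E" if "r \<in> J" for r using g[OF that] by (simp add: D_def)
      show "g (r \<oplus> s) = g r \<oplus>\<^bsub>E\<^esub> g s" if "r \<in> J" "s \<in> J" for r s
        using Dadd[OF g[OF that(1)] g[OF that(2)]] JR[OF that(1)] JR[OF that(2)] v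
        by (intro geq) (simp add: E.smult_l_distr)
      show "g (r \<otimes> s) = r \<odot>\<^bsub>E\<^esub> g s" if "r \<in> carrier R" "s \<in> J" for r s
        using Dsm[OF that(1) g[OF that(2)]] that(1) JR[OF that(2)] v
        by (intro geq) (simp add: E.smult_assoc1)
    qed blast
    note tc = tor_carrier[OF t]
    define u where "u = v \<ominus>\<^bsub>E\<^esub> t"
    have u: "u \<in> carrier E" using v tc by (simp add: u_def)
    have Ju: "r \<odot>\<^bsub>E\<^esub> u \<in> W" if "r \<in> J" for r
      using g[OF that] gt[OF that] JR[OF that] v tc
      by (simp add: D_def u_def E.M.minus_eq E.smult_r_distr E.smult_r_minus)
    define X where "X = (\<lambda>(w, r). w \<oplus>\<^bsub>E\<^esub> r \<odot>\<^bsub>E\<^esub> u) ` carrier (direct_sum (E\<lparr>carrier := W\<rparr>) (self_module R))"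
    have Xm: "w \<oplus>\<^bsub>E\<^esub> r \<odot>\<^bsub>E\<^esub> u \<in> X" if "w \<in> W" "r \<in> carrier R" for w r
      using that by (force simp: X_def self_module_def)
    have "submodule X R E"
      unfolding X_def
    proof (rule submodule_image[OF module_direct_sum EM mod_homI])
      show "module R (E\<lparr>carrier := W\<rparr>)" by (rule submodule_module[OF EM W])
      show "module R (self_module R)" by (rule module_self_module[OF is_cring])
    qed (use u W'(1) in \<open>auto simp: self_module_def E.smult_l_distr E.smult_r_distr E.smult_assoc1
           E.M.a_ac subset_iff\<close>)
    \<comment> \<open>If \<open>w + r u\<close> is torsion, then \<open>r v\<close> differs from a
      torsion element by \<open>- w\<close>, so \<open>r \<in> J\<close> and
      \<open>r u \<in> W\<close>. The element then lies in \<open>W\<close> as well as in the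
      torsion. Maximality of \<open>W\<close> now gives \<open>u \<in> W\<close>.\<close>
    moreover have "y = \<zero>\<^bsub>E\<^esub>" if y: "y \<in> X" "y \<in> tor E" for y
    proof -
      obtain w r where wr: "w \<in> W" "r \<in> carrier R" "y = w \<oplus>\<^bsub>E\<^esub> r \<odot>\<^bsub>E\<^esub> u"
        using y(1) by (auto simp: X_def self_module_def)
      have wc: "w \<in> carrier E" using wr(1) W'(1) by blast
      have "r \<odot>\<^bsub>E\<^esub> v \<ominus>\<^bsub>E\<^esub> (y \<oplus>\<^bsub>E\<^esub> r \<odot>\<^bsub>E\<^esub> t) = \<ominus>\<^bsub>E\<^esub> w"
        using wr(2,3) wc v tc by (simp add: u_def E.smult_r_distr E.smult_r_minus E.M.diff_simps)
      then have "D (r \<odot>\<^bsub>E\<^esub> v) (y \<oplus>\<^bsub>E\<^esub> r \<odot>\<^bsub>E\<^esub> t)"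
        using v wr(2) y(2) t T'(4,5) W'(3)[OF wr(1)] by (simp add: D_def)
      then have "r \<in> J" using wr(2) by (auto simp: J_def H_def)
      then have "y \<in> W" using Ju wr W'(5) by simp
      then show ?thesis using WT y(2) by blast
    qed
    moreover have "W \<subseteq> X"
    proof
      fix w assume w: "w \<in> W"
      then show "w \<in> X" using Xm[OF w, of "\<zero>\<^bsub>R\<^esub>"] u W'(1) by auto
    qed
    ultimately have "X = W" using max by blast
    moreover have "u \<in> X" using Xm[OF E.submodule_zero[OF W], of \<one>] u by simp
    ultimately have "D v t" using v t by (simp add: D_def u_def)
    then show ?thesis by blast
  qed
  define p where "p y = (THE t. D y t)" for y
  have peq: "p y = t" if "D y t" for y t
    unfolding p_def using that Duniq by blast
  have p: "D y (p y)" if "y \<in> carrier E" for y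
    using Dtot[OF that] peq by auto
  have pT: "p y \<in> tor E" if "y \<in> carrier E" for y using p[OF that] by (simp add: D_def)
  have ph: "p \<in> mod_hom R E E"
  proof (rule mod_homI)
    show "p u \<in> carrier E" if "u \<in> carrier E" for u using Dc(2)[OF p[OF that]] .
    show "p (u \<oplus>\<^bsub>E\<^esub> v) = p u \<oplus>\<^bsub>E\<^esub> p v" if "u \<in> carrier E" "v \<in> carrier E" for u v
      using Dadd[OF p[OF that(1)] p[OF that(2)]] by (rule peq)
    show "p (r \<odot>\<^bsub>E\<^esub> u) = r \<odot>\<^bsub>E\<^esub> p u" if "r \<in> carrier R" "u \<in> carrier E" for r u
      using Dsm[OF that(1) p[OF that(2)]] by (rule peq)
  qed
  show thesis
  proof (rule that[of "\<lambda>y. y \<ominus>\<^bsub>E\<^esub> p y"])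
    show "(\<lambda>y. y \<ominus>\<^bsub>E\<^esub> p y) \<in> mod_hom R E E"
      by (rule mod_hom_difference[OF EM mod_hom_id ph])
    show "u \<ominus>\<^bsub>E\<^esub> p u = \<zero>\<^bsub>E\<^esub>" if u: "u \<in> tor E" for u
    proof -
      have "D u u"
        using u tor_carrier[OF u] E.submodule_zero[OF W] by (simp add: D_def E.M.minus_eq E.M.r_neg)
      then show ?thesis using tor_carrier[OF u] by (simp add: peq E.M.minus_eq E.M.r_neg)
    qed
    show "y \<ominus>\<^bsub>E\<^esub> (y \<ominus>\<^bsub>E\<^esub> p y) \<in> tor E" if y: "y \<in> carrier E" for y
    proof -
      have "y \<ominus>\<^bsub>E\<^esub> (y \<ominus>\<^bsub>E\<^esub> p y) = p y"
        using y Dc(2)[OF p[OF y]] by (simp add: E.M.diff_simps)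
      then show ?thesis using pT[OF y] by simp
    qed
  qed
qed

text \<open>The resolution \<open>L\<close> of a torsion module is retracted, up to a homotopy \<open>s\<close>, to its torsion.\<close>

lemma tor_injective_resolution_exact:
  assumes inj: "\<And>n. injective_module R (L n)"
    and d: "\<And>n. d n \<in> mod_hom R (L n) (L (Suc n))"
    and dd: "\<And>n y. y \<in> carrier (L n) \<Longrightarrow> d (Suc n) (d n y) = \<zero>\<^bsub>L (Suc (Suc n))\<^esub>"
    and exact: "\<And>n z. z \<in> carrier (L (Suc n)) \<Longrightarrow> d (Suc n) z = \<zero>\<^bsub>L (Suc (Suc n))\<^esub> \<Longrightarrow>
      \<exists>y\<in>carrier (L n). d n y = z"
    and ker: "\<And>z. z \<in> carrier (L 0) \<Longrightarrow> d 0 z = \<zero>\<^bsub>L 1\<^esub> \<Longrightarrow> z \<in> tor (L 0)"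
    and z: "z \<in> tor (L (Suc n))" "d (Suc n) z = \<zero>\<^bsub>L (Suc (Suc n))\<^esub>"
  obtains y where "y \<in> tor (L n)" "d n y = z"
proof -
  have M: "module R (L n)" for n by (rule injective_module_module[OF inj])
  interpret L: module R "L k" for k by (rule M)
  note dc = mod_hom_closed[OF d]
  \<comment> \<open>The claim suffices: a torsion cocycle \<open>z = d n y\<close> satisfies
    \<open>z = d n (p + s z)\<close> with \<open>p\<close> torsion, and \<open>s z\<close> is
    torsion because homomorphisms preserve torsion.\<close>
  have "\<exists>s\<in>mod_hom R (L (Suc n)) (L n). \<forall>y\<in>carrier (L n). \<exists>p\<in>tor (L n).
    d n y \<ominus>\<^bsub>L (Suc n)\<^esub> d n (s (d n y)) = d n p"
  proof (induction n)
    case 0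
    obtain \<sigma> where \<sigma>: "\<sigma> \<in> mod_hom R (L 0) (L 0)" "\<And>u. u \<in> tor (L 0) \<Longrightarrow> \<sigma> u = \<zero>\<^bsub>L 0\<^esub>"
      "\<And>y. y \<in> carrier (L 0) \<Longrightarrow> y \<ominus>\<^bsub>L 0\<^esub> \<sigma> y \<in> tor (L 0)"
      using injective_split_tor[OF inj] by blast
    \<comment> \<open>The kernel of \<open>d 0\<close> is torsion, where \<open>\<sigma>\<close>
      vanishes; so \<open>\<sigma>\<close> factors through \<open>d 0\<close>, and the factor is
      \<open>s\<close>.\<close>
    have "\<sigma> u = \<zero>\<^bsub>L 0\<^esub>" if "u \<in> carrier (L 0)" "d 0 u = \<zero>\<^bsub>L (Suc 0)\<^esub>" for u
      using \<sigma>(2) ker that by simp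
    with injective_module_factor[OF inj M M d \<sigma>(1)] obtain s
      where s: "s \<in> mod_hom R (L (Suc 0)) (L 0)" "\<And>u. u \<in> carrier (L 0) \<Longrightarrow> s (d 0 u) = \<sigma> u"
      by blast
    have "d 0 y \<ominus>\<^bsub>L (Suc 0)\<^esub> d 0 (s (d 0 y)) = d 0 (y \<ominus>\<^bsub>L 0\<^esub> \<sigma> y)" if "y \<in> carrier (L 0)" for y
      using that s(2) mod_hom_diff[OF M M d] mod_hom_closed[OF \<sigma>(1)] by simp
    with s(1) \<sigma>(3) show ?case by blast
  next
    case (Suc n)
    then obtain s where s: "s \<in> mod_hom R (L (Suc n)) (L n)"
      and sp: "\<And>y. y \<in> carrier (L n) \<Longrightarrow> \<exists>p\<in>tor (L n).
        d n y \<ominus>\<^bsub>L (Suc n)\<^esub> d n (s (d n y)) = d n p" by blast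
    obtain \<sigma> where \<sigma>: "\<sigma> \<in> mod_hom R (L (Suc n)) (L (Suc n))"
      "\<And>u. u \<in> tor (L (Suc n)) \<Longrightarrow> \<sigma> u = \<zero>\<^bsub>L (Suc n)\<^esub>"
      "\<And>y. y \<in> carrier (L (Suc n)) \<Longrightarrow> y \<ominus>\<^bsub>L (Suc n)\<^esub> \<sigma> y \<in> tor (L (Suc n))"
      using injective_split_tor[OF inj] by blast
    define c where "c y = y \<ominus>\<^bsub>L (Suc n)\<^esub> d n (s y)" for y
    have c: "c \<in> mod_hom R (L (Suc n)) (L (Suc n))"
      unfolding c_def by (intro mod_hom_difference M mod_hom_id mod_hom_compose[OF s d])
    note cc = mod_hom_closed[OF c] and \<sigma>c = mod_hom_closed[OF \<sigma>(1)] and sc = mod_hom_closed[OF s]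
    \<comment> \<open>By exactness \<open>u\<close> is a coboundary, which \<open>c\<close> sends to
      \<open>d n\<close> of a torsion element, and there \<open>\<sigma>\<close> vanishes. Hence
      \<open>\<sigma> \<circ> c\<close> factors through \<open>d (Suc n)\<close>.\<close>
    have "\<sigma> (c u) = \<zero>\<^bsub>L (Suc n)\<^esub>"
      if u: "u \<in> carrier (L (Suc n))" "d (Suc n) u = \<zero>\<^bsub>L (Suc (Suc n))\<^esub>" for u
    proof -
      obtain y where y: "y \<in> carrier (L n)" "d n y = u" using exact u by blast
      obtain p where "p \<in> tor (L n)" "c u = d n p" using sp[OF y(1)] y(2) by (auto simp: c_def)
      then show ?thesis using \<sigma>(2) tor_hom[OF M M d] by simp
    qed
    with injective_module_factor[OF inj M M d mod_hom_compose[OF c \<sigma>(1)]] obtain s'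
      where s': "s' \<in> mod_hom R (L (Suc (Suc n))) (L (Suc n))"
        "\<And>u. u \<in> carrier (L (Suc n)) \<Longrightarrow> s' (d (Suc n) u) = \<sigma> (c u)"
      by blast
    have "d (Suc n) y \<ominus>\<^bsub>L (Suc (Suc n))\<^esub> d (Suc n) (s' (d (Suc n) y))
      = d (Suc n) (c y \<ominus>\<^bsub>L (Suc n)\<^esub> \<sigma> (c y))" if y: "y \<in> carrier (L (Suc n))" for y
    proof -
      have "d (Suc n) (c y) = d (Suc n) y"
        using mod_hom_diff[OF M M d y dc[OF sc[OF y]]] dd[OF sc[OF y]] dc[OF y]
        by (simp add: c_def L.M.minus_eq)
      then show ?thesis
        using mod_hom_diff[OF M M d cc[OF y] \<sigma>c[OF cc[OF y]]] s'(2)[OF y] by simp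
    qed
    with s'(1) \<sigma>(3) cc show ?case by blast
  qed
  then obtain s where s: "s \<in> mod_hom R (L (Suc n)) (L n)"
    and sp: "\<And>y. y \<in> carrier (L n) \<Longrightarrow> \<exists>p\<in>tor (L n).
      d n y \<ominus>\<^bsub>L (Suc n)\<^esub> d n (s (d n y)) = d n p" by blast
  obtain y where y: "y \<in> carrier (L n)" "d n y = z"
    using exact[OF tor_carrier[OF z(1)] z(2)] by blast
  obtain p where p: "p \<in> tor (L n)" "z \<ominus>\<^bsub>L (Suc n)\<^esub> d n (s z) = d n p"
    using sp[OF y(1)] y(2) by metis
  have sz: "s z \<in> tor (L n)" by (rule tor_hom[OF M M s z(1)])
  have "d n (p \<oplus>\<^bsub>L n\<^esub> s z) = (z \<ominus>\<^bsub>L (Suc n)\<^esub> d n (s z)) \<oplus>\<^bsub>L (Suc n)\<^esub> d n (s z)"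
    using mod_hom_add[OF d tor_carrier[OF p(1)] tor_carrier[OF sz]] p(2) by simp
  also have "\<dots> = z"
    using tor_carrier[OF z(1)] dc[OF tor_carrier[OF sz]] by (simp add: L.M.diff_simps)
  finally show thesis
    using p(1) sz L.submoduleE(5)[OF tor_submodule[OF M]] by (intro that[of "p \<oplus>\<^bsub>L n\<^esub> s z"])
qed

end

section \<open>Quotient modules\<close>

lemma abelian_subgroup_submodule:
  assumes "module R M" and "submodule N R M"
  shows "abelian_subgroup N M"
proof -
  interpret M: module R M by fact
  show ?thesis
    using submodule.axioms(1)[OF assms(2)]
    by (intro abelian_subgroupI3 additive_subgroupI M.M.abelian_group_axioms)
qed

lemma a_r_coset_eq_iff:
  assumes "module R M" and N: "submodule N R M" and u: "u \<in> carrier M" and v: "v \<in> carrier M"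
  shows "N +>\<^bsub>M\<^esub> u = N +>\<^bsub>M\<^esub> v \<longleftrightarrow> u \<ominus>\<^bsub>M\<^esub> v \<in> N"
proof -
  interpret M: module R M by fact
  interpret N: abelian_subgroup N M by (rule abelian_subgroup_submodule) fact+
  have sub: "w \<in> carrier M" if "w \<in> N" for w using that M.submoduleE(1)[OF N] by blast
  show ?thesis
  proof
    assume "N +>\<^bsub>M\<^esub> u = N +>\<^bsub>M\<^esub> v"
    then have "u \<in> N +>\<^bsub>M\<^esub> v" using N.a_rcos_self[OF u] by simp
    then obtain w where w: "w \<in> N" "u = w \<oplus>\<^bsub>M\<^esub> v" by (auto simp: a_r_coset_def')
    then have "u \<ominus>\<^bsub>M\<^esub> v = w" using sub v by (simp add: M.M.diff_simps)
    then show "u \<ominus>\<^bsub>M\<^esub> v \<in> N" using w by simp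
  next
    assume *: "u \<ominus>\<^bsub>M\<^esub> v \<in> N"
    have "u = (u \<ominus>\<^bsub>M\<^esub> v) \<oplus>\<^bsub>M\<^esub> v" using u v by (simp add: M.M.diff_simps)
    then have "u \<in> N +>\<^bsub>M\<^esub> v" using * unfolding a_r_coset_def' by blast
    then show "N +>\<^bsub>M\<^esub> u = N +>\<^bsub>M\<^esub> v"
      by (rule N.a_repr_independence'[OF _ v, symmetric])
  qed
qed

text \<open>The scalar action of \<open>quot_module\<close> is a union of cosets over all
  representatives. The cosets coincide, so the union is the coset of any one multiple.\<close>

lemma mod_hom_quot:
  assumes "module R M" and N: "submodule N R M"
  shows "(\<lambda>u. N +>\<^bsub>M\<^esub> u) \<in> mod_hom R M (quot_module M N)"
proof -
  interpret M: module R M by fact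
  interpret N: abelian_subgroup N M by (rule abelian_subgroup_submodule) fact+
  have "(\<Union>v\<in>N +>\<^bsub>M\<^esub> u. N +>\<^bsub>M\<^esub> (r \<odot>\<^bsub>M\<^esub> v)) = N +>\<^bsub>M\<^esub> (r \<odot>\<^bsub>M\<^esub> u)"
    if r: "r \<in> carrier R" and u: "u \<in> carrier M" for r u
  proof -
    have "N +>\<^bsub>M\<^esub> (r \<odot>\<^bsub>M\<^esub> v) = N +>\<^bsub>M\<^esub> (r \<odot>\<^bsub>M\<^esub> u)" if v: "v \<in> N +>\<^bsub>M\<^esub> u" for v
    proof -
      have vc: "v \<in> carrier M" using v N.a_elemrcos_carrier[OF u] by blast
      have "N +>\<^bsub>M\<^esub> v = N +>\<^bsub>M\<^esub> u" using N.a_repr_independence'[OF v u] by simp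
      then have "v \<ominus>\<^bsub>M\<^esub> u \<in> N" using a_r_coset_eq_iff[OF assms vc u] by simp
      then have "r \<odot>\<^bsub>M\<^esub> (v \<ominus>\<^bsub>M\<^esub> u) \<in> N" by (rule M.submoduleE(4)[OF N r])
      then have "r \<odot>\<^bsub>M\<^esub> v \<ominus>\<^bsub>M\<^esub> r \<odot>\<^bsub>M\<^esub> u \<in> N"
        using r u vc by (simp add: M.M.minus_eq M.smult_r_distr M.smult_r_minus)
      then show ?thesis using a_r_coset_eq_iff[OF assms] r u vc by simp
    qed
    moreover have "u \<in> N +>\<^bsub>M\<^esub> u" by (rule N.a_rcos_self[OF u])
    ultimately show ?thesis by blast
  qed
  then show ?thesis
    by (intro mod_homI)
       (auto simp: quot_module_def N.a_rcos_sum A_RCOSETS_def')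
qed

lemma quot_module_simps [simp]:
  "carrier (quot_module M N) = (\<lambda>u. N +>\<^bsub>M\<^esub> u) ` carrier M"
  "\<zero>\<^bsub>quot_module M N\<^esub> = N"
  by (auto simp: quot_module_def A_RCOSETS_def')

section \<open>Mapping cones\<close>

definition cochain_complex ::
    "('a, 'k) ring_scheme \<Rightarrow> (nat \<Rightarrow> ('a, 'c) module) \<Rightarrow> (nat \<Rightarrow> 'c \<Rightarrow> 'c) \<Rightarrow> bool"
  where "cochain_complex R C d \<longleftrightarrow>
    (\<forall>n. module R (C n)) \<and>
    (\<forall>n. d n \<in> mod_hom R (C n) (C (Suc n))) \<and>
    (\<forall>n. \<forall>u\<in>carrier (C n). d (Suc n) (d n u) = \<zero>\<^bsub>C (Suc (Suc n))\<^esub>)"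

definition cochain_map ::
    "('a, 'k) ring_scheme \<Rightarrow> (nat \<Rightarrow> ('a, 'c) module) \<Rightarrow> (nat \<Rightarrow> 'c \<Rightarrow> 'c) \<Rightarrow>
     (nat \<Rightarrow> ('a, 'd) module) \<Rightarrow> (nat \<Rightarrow> 'd \<Rightarrow> 'd) \<Rightarrow> (nat \<Rightarrow> 'c \<Rightarrow> 'd) \<Rightarrow> bool"
  where "cochain_map R C d D d' f \<longleftrightarrow>
    (\<forall>n. f n \<in> mod_hom R (C n) (D n)) \<and>
    (\<forall>n. \<forall>u\<in>carrier (C n). f (Suc n) (d n u) = d' n (f n u))"

lemma cochain_complexD:
  assumes "cochain_complex R C d"
  shows "module R (C n)" and "d n \<in> mod_hom R (C n) (C (Suc n))"
    and "u \<in> carrier (C n) \<Longrightarrow> d (Suc n) (d n u) = \<zero>\<^bsub>C (Suc (Suc n))\<^esub>"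
  using assms by (auto simp: cochain_complex_def)

lemma cochain_mapD:
  assumes "cochain_map R C d D d' f"
  shows "f n \<in> mod_hom R (C n) (D n)"
    and "u \<in> carrier (C n) \<Longrightarrow> f (Suc n) (d n u) = d' n (f n u)"
  using assms by (auto simp: cochain_map_def)

text \<open>Index \<open>n\<close> holds degree \<open>n - 1\<close>. Degree -1 is a zero module
  with the zero of \<open>C 0\<close>, so that no new type arises and formulas with a preceding term
  hold in degree 0 without a case distinction.\<close>

fun shift_mod :: "(nat \<Rightarrow> ('a, 'c) module) \<Rightarrow> nat \<Rightarrow> ('a, 'c) module"
  where
    "shift_mod C 0 = (C 0)\<lparr>carrier := {\<zero>\<^bsub>C 0\<^esub>}\<rparr>"
  | "shift_mod C (Suc n) = C n"

fun shift_diff :: "(nat \<Rightarrow> ('a, 'c) module) \<Rightarrow> (nat \<Rightarrow> 'c \<Rightarrow> 'c) \<Rightarrow> nat \<Rightarrow> 'c \<Rightarrow> 'c"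
  where
    "shift_diff C d 0 = (\<lambda>_. \<zero>\<^bsub>C 0\<^esub>)"
  | "shift_diff C d (Suc n) = d n"

lemma injective_shift_mod:
  assumes "\<And>n. injective_module R (C n)"
  shows "injective_module R (shift_mod C n)"
  using assms injective_zero_module[OF injective_module_module] by (cases n) auto

lemma cochain_complex_shift:
  assumes "cochain_complex R C d"
  shows "cochain_complex R (shift_mod C) (shift_diff C d)"
proof -
  note C = cochain_complexD[OF assms]
  have "module R (shift_mod C n)" for n
  proof (cases n)
    case 0
    interpret M: module R "C 0" by (rule C)
    have "submodule {\<zero>\<^bsub>C 0\<^esub>} R (C 0)" by (rule M.submoduleI) auto
    then show ?thesis using 0 submodule_module[OF C(1)] by simp
  qed (simp add: C)
  moreover have "shift_diff C d n \<in> mod_hom R (shift_mod C n) (shift_mod C (Suc n))" for n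
    using C(2) mod_hom_const_zero[OF C(1)] by (cases n) auto
  moreover have "shift_diff C d (Suc n) (shift_diff C d n u) = \<zero>\<^bsub>shift_mod C (Suc (Suc n))\<^esub>"
    if "u \<in> carrier (shift_mod C n)" for n u
    using that C mod_hom_zero[OF C(1,1,2)] by (cases n) auto
  ultimately show ?thesis by (auto simp: cochain_complex_def)
qed

text \<open>The mapping cone in the numbering in which \<open>C\<close> keeps its degrees and
  \<open>D\<close> moves up by one.\<close>

definition cone_mod ::
    "(nat \<Rightarrow> ('a, 'c) module) \<Rightarrow> (nat \<Rightarrow> ('a, 'd) module) \<Rightarrow> nat \<Rightarrow> ('a, 'c \<times> 'd) module"
  where "cone_mod C D n = direct_sum (C n) (shift_mod D n)"

text \<open>Subtracting the shifted differential makes \<open>f d u\<close> and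
  \<open>d' f u\<close> cancel in the square of the differential.\<close>

definition cone_diff ::
    "(nat \<Rightarrow> ('a, 'd) module) \<Rightarrow> (nat \<Rightarrow> 'c \<Rightarrow> 'c) \<Rightarrow> (nat \<Rightarrow> 'd \<Rightarrow> 'd) \<Rightarrow>
     (nat \<Rightarrow> 'c \<Rightarrow> 'd) \<Rightarrow> nat \<Rightarrow> 'c \<times> 'd \<Rightarrow> 'c \<times> 'd"
  where "cone_diff D d d' f n = (\<lambda>(u, v). (d n u, f n u \<ominus>\<^bsub>D n\<^esub> shift_diff D d' n v))"

lemma injective_cone_mod:
  assumes "\<And>n. injective_module R (C n)" and "\<And>n. injective_module R (D n)"
  shows "injective_module R (cone_mod C D n)"
  unfolding cone_mod_def by (intro injective_direct_sum injective_shift_mod assms)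

lemma cochain_complex_cone:
  assumes C: "cochain_complex R C d" and D: "cochain_complex R D d'"
    and f: "cochain_map R C d D d' f"
  shows "cochain_complex R (cone_mod C D) (cone_diff D d d' f)"
proof -
  note CD = cochain_complexD[OF C] and DD = cochain_complexD[OF D] and fD = cochain_mapD[OF f]
  note SD = cochain_complexD[OF cochain_complex_shift[OF D]]
  have M: "module R (cone_mod C D n)" for n
    unfolding cone_mod_def by (intro module_direct_sum CD SD)
  have h: "(\<lambda>p. (d n (fst p), f n (fst p) \<ominus>\<^bsub>D n\<^esub> shift_diff D d' n (snd p)))
      \<in> mod_hom R (cone_mod C D n) (cone_mod C D (Suc n))" for n
    unfolding cone_mod_def
    using SD(2)[of n] CD(2) fD(1) DD(1)
    by (intro mod_hom_Pair mod_hom_compose[OF mod_hom_fst])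
       (auto intro!: mod_hom_difference mod_hom_compose[OF mod_hom_fst] mod_hom_compose[OF mod_hom_snd])
  have dd: "cone_diff D d d' f (Suc n) (cone_diff D d d' f n p) = \<zero>\<^bsub>cone_mod C D (Suc (Suc n))\<^esub>"
    if p: "p \<in> carrier (cone_mod C D n)" for n p
  proof -
    obtain u v where uv: "p = (u, v)" "u \<in> carrier (C n)" "v \<in> carrier (shift_mod D n)"
      using p by (auto simp: cone_mod_def)
    interpret N: module R "D (Suc n)" by (rule DD)
    have sv: "shift_diff D d' n v \<in> carrier (D n)" using mod_hom_closed[OF SD(2) uv(3)] by simp
    have fu: "f n u \<in> carrier (D n)" by (rule mod_hom_closed[OF fD(1) uv(2)])
    have "d' n (shift_diff D d' n v) = \<zero>\<^bsub>D (Suc n)\<^esub>" using SD(3)[OF uv(3)] by simp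
    then show ?thesis
      using uv(1,2) CD(3) fD(2) mod_hom_diff[OF DD(1,1,2) fu sv] mod_hom_closed[OF DD(2) fu]
      by (simp add: cone_diff_def cone_mod_def N.M.diff_simps)
  qed
  show ?thesis
    using M h dd by (auto simp: cochain_complex_def cone_diff_def case_prod_unfold)
qed

text \<open>The two hypotheses hold when \<open>f\<close> is onto on cohomology in degree \<open>n\<close> and one-to-one on
  cohomology in degree \<open>n + 1\<close>.\<close>

lemma cone_exact:
  assumes C: "cochain_complex R C d" and D: "cochain_complex R D d'"
    and f: "cochain_map R C d D d' f"
    and onto: "\<And>y. y \<in> carrier (D n) \<Longrightarrow> d' n y = \<zero>\<^bsub>D (Suc n)\<^esub> \<Longrightarrow>
      \<exists>u\<in>carrier (C n). \<exists>v\<in>carrier (shift_mod D n).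
        d n u = \<zero>\<^bsub>C (Suc n)\<^esub> \<and> f n u \<ominus>\<^bsub>D n\<^esub> shift_diff D d' n v = y"
    and inj: "\<And>u v. u \<in> carrier (C (Suc n)) \<Longrightarrow> d (Suc n) u = \<zero>\<^bsub>C (Suc (Suc n))\<^esub> \<Longrightarrow>
      v \<in> carrier (D n) \<Longrightarrow> f (Suc n) u = d' n v \<Longrightarrow> \<exists>u'\<in>carrier (C n). d n u' = u"
    and p: "p \<in> carrier (cone_mod C D (Suc n))"
      "cone_diff D d d' f (Suc n) p = \<zero>\<^bsub>cone_mod C D (Suc (Suc n))\<^esub>"
  shows "\<exists>q\<in>carrier (cone_mod C D n). cone_diff D d d' f n q = p"
proof -
  note CD = cochain_complexD[OF C] and DD = cochain_complexD[OF D] and fD = cochain_mapD[OF f]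
  note SD = cochain_complexD[OF cochain_complex_shift[OF D]]
  interpret C0: module R "C n" by (rule CD)
  interpret C1: module R "C (Suc n)" by (rule CD)
  interpret D0: module R "D n" by (rule DD)
  interpret S0: module R "shift_mod D n" by (rule SD)
  interpret D1: module R "D (Suc n)" by (rule DD)
  obtain u v where uv: "p = (u, v)" "u \<in> carrier (C (Suc n))" "v \<in> carrier (D n)"
    using p(1) by (auto simp: cone_mod_def)
  have du: "d (Suc n) u = \<zero>\<^bsub>C (Suc (Suc n))\<^esub>"
    and fu: "f (Suc n) u \<ominus>\<^bsub>D (Suc n)\<^esub> d' n v = \<zero>\<^bsub>D (Suc n)\<^esub>"
    using p(2) uv by (auto simp: cone_diff_def cone_mod_def)
  have fu: "f (Suc n) u = d' n v"
    using fu D1.M.diff_eq_zero_iff[OF mod_hom_closed[OF fD(1) uv(2)] mod_hom_closed[OF DD(2) uv(3)]]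
    by simp
  obtain u' where u': "u' \<in> carrier (C n)" "d n u' = u" using inj[OF uv(2) du uv(3) fu] by blast
  note fu' = mod_hom_closed[OF fD(1) u'(1)]
  \<comment> \<open>The lift \<open>u'\<close> of \<open>u\<close> is correct in the first component
    and misses the second by the cocycle \<open>y\<close>. By \<open>onto\<close>, \<open>y\<close>
    comes from a cocycle \<open>u''\<close> up to a coboundary, and subtracting a cocycle leaves the
    first component alone.\<close>
  define y where "y = f n u' \<ominus>\<^bsub>D n\<^esub> v"
  have "d' n y = d' n (f n u') \<ominus>\<^bsub>D (Suc n)\<^esub> d' n v"
    unfolding y_def by (rule mod_hom_diff[OF DD(1,1,2) fu' uv(3)])
  also have "\<dots> = \<zero>\<^bsub>D (Suc n)\<^esub>"
    using fD(2)[OF u'(1)] u'(2) fu mod_hom_closed[OF DD(2) uv(3)] by (simp add: D1.M.diff_simps)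
  finally have "d' n y = \<zero>\<^bsub>D (Suc n)\<^esub>" .
  moreover have "y \<in> carrier (D n)" using fu' uv(3) by (simp add: y_def)
  ultimately obtain u'' v'' where u'': "u'' \<in> carrier (C n)" "d n u'' = \<zero>\<^bsub>C (Suc n)\<^esub>"
    and v'': "v'' \<in> carrier (shift_mod D n)" and y: "f n u'' \<ominus>\<^bsub>D n\<^esub> shift_diff D d' n v'' = y"
    using onto by blast
  note fu'' = mod_hom_closed[OF fD(1) u''(1)]
  have dv'': "shift_diff D d' n v'' \<in> carrier (D n)" using mod_hom_closed[OF SD(2) v''] by simp
  have "d n (u' \<ominus>\<^bsub>C n\<^esub> u'') = u"
    using mod_hom_diff[OF CD(1,1,2) u'(1) u''(1)] u' u'' uv(2) by (simp add: C1.M.minus_eq)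
  moreover have "f n (u' \<ominus>\<^bsub>C n\<^esub> u'') \<ominus>\<^bsub>D n\<^esub> shift_diff D d' n (\<ominus>\<^bsub>shift_mod D n\<^esub> v'') = v"
  proof -
    have "shift_diff D d' n (\<ominus>\<^bsub>shift_mod D n\<^esub> v'') = \<ominus>\<^bsub>D n\<^esub> shift_diff D d' n v''"
      using mod_hom_minus[OF SD(1,1,2) v''] by simp
    moreover have "f n (u' \<ominus>\<^bsub>C n\<^esub> u'') = f n u' \<ominus>\<^bsub>D n\<^esub> f n u''"
      by (rule mod_hom_diff[OF CD(1) DD(1) fD(1) u'(1) u''(1)])
    moreover have "f n u' \<ominus>\<^bsub>D n\<^esub> f n u'' \<ominus>\<^bsub>D n\<^esub> \<ominus>\<^bsub>D n\<^esub> shift_diff D d' n v'' = f n u' \<ominus>\<^bsub>D n\<^esub> y"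
      unfolding y[symmetric] using fu' fu'' dv'' by (simp add: D0.M.diff_simps)
    ultimately show ?thesis using fu' uv(3) by (simp add: y_def D0.M.diff_simps)
  qed
  ultimately show ?thesis
    using u'(1) u''(1) v'' uv(1)
    by (intro bexI[of _ "(u' \<ominus>\<^bsub>C n\<^esub> u'', \<ominus>\<^bsub>shift_mod D n\<^esub> v'')"]) (auto simp: cone_diff_def cone_mod_def)
qed

text \<open>The invariant \<open>P\<close> says that the map in degree \<open>n\<close> sends
  cocycles to cocycles. So \<open>d' n \<circ> g\<close> vanishes on the kernel of
  \<open>d n\<close> and extends along \<open>d n\<close> into an injective module. Exactness of
  \<open>C\<close> in positive degrees reproduces the invariant one degree higher.\<close>

lemma comparison_map:
  assumes C: "cochain_complex R C d" and D: "cochain_complex R D d'"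
    and inj: "\<And>n. injective_module R (D n)"
    and exact: "\<And>n z. z \<in> carrier (C (Suc n)) \<Longrightarrow> d (Suc n) z = \<zero>\<^bsub>C (Suc (Suc n))\<^esub> \<Longrightarrow>
      \<exists>y\<in>carrier (C n). d n y = z"
    and f0: "f0 \<in> mod_hom R (C 0) (D 0)"
    and ker: "\<And>u. u \<in> carrier (C 0) \<Longrightarrow> d 0 u = \<zero>\<^bsub>C 1\<^esub> \<Longrightarrow> d' 0 (f0 u) = \<zero>\<^bsub>D 1\<^esub>"
  obtains f where "cochain_map R C d D d' f" "f 0 = f0"
proof -
  note CD = cochain_complexD[OF C] and DD = cochain_complexD[OF D]
  define P where "P n g \<longleftrightarrow> g \<in> mod_hom R (C n) (D n) \<and> (n = 0 \<longrightarrow> g = f0) \<and>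
    (\<forall>u\<in>carrier (C n). d n u = \<zero>\<^bsub>C (Suc n)\<^esub> \<longrightarrow> d' n (g u) = \<zero>\<^bsub>D (Suc n)\<^esub>)" for n g
  define Q where "Q n g h \<longleftrightarrow> (\<forall>u\<in>carrier (C n). h (d n u) = d' n (g u))"
    for n g h
  have "\<exists>f. \<forall>n. P n (f n) \<and> Q n (f n) (f (Suc n))"
  proof (rule dependent_nat_choice)
    show "\<exists>g. P 0 g" using f0 ker by (auto simp: P_def)
    fix g n assume g: "P n g"
    have gh: "g \<in> mod_hom R (C n) (D n)" using g by (simp add: P_def)
    obtain h where h: "h \<in> mod_hom R (C (Suc n)) (D (Suc n))"
      and hg: "\<And>u. u \<in> carrier (C n) \<Longrightarrow> h (d n u) = d' n (g u)"
    proof (rule injective_module_factor[OF inj CD(1,1,2) mod_hom_compose[OF gh DD(2)]])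
      show "d' n (g u) = \<zero>\<^bsub>D (Suc n)\<^esub>" if "u \<in> carrier (C n)" "d n u = \<zero>\<^bsub>C (Suc n)\<^esub>" for u
        using g that by (simp add: P_def)
    qed blast
    have "d' (Suc n) (h u) = \<zero>\<^bsub>D (Suc (Suc n))\<^esub>"
      if u: "u \<in> carrier (C (Suc n))" "d (Suc n) u = \<zero>\<^bsub>C (Suc (Suc n))\<^esub>" for u
    proof -
      obtain w where w: "w \<in> carrier (C n)" "d n w = u" using exact[OF u] by blast
      then show ?thesis using hg[OF w(1)] DD(3)[OF mod_hom_closed[OF gh w(1)]] by simp
    qed
    then have "P (Suc n) h" using h by (simp add: P_def)
    moreover have "Q n g h" using hg by (simp add: Q_def)
    ultimately show "\<exists>h. P (Suc n) h \<and> Q n g h" by blast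
  qed
  then obtain f where "\<forall>n. P n (f n) \<and> Q n (f n) (f (Suc n))" ..
  then show thesis
    by (intro that[of f]) (auto simp: P_def Q_def cochain_map_def)
qed

lemma injective_resolutionD:
  assumes "injective_resolution R M E d e"
  shows "injective_module R (E n)" and "cochain_complex R E d"
    and "e \<in> mod_hom R M (E 0)" and "inj_on e (carrier M)"
    and "m \<in> carrier M \<Longrightarrow> d 0 (e m) = \<zero>\<^bsub>E 1\<^esub>"
    and "z \<in> carrier (E 0) \<Longrightarrow> d 0 z = \<zero>\<^bsub>E 1\<^esub> \<Longrightarrow> \<exists>m\<in>carrier M. e m = z"
    and "y \<in> carrier (E (Suc n)) \<Longrightarrow> d (Suc n) y = \<zero>\<^bsub>E (Suc (Suc n))\<^esub> \<Longrightarrow>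
      \<exists>w\<in>carrier (E n). d n w = y"
proof -
  note * = assms[unfolded injective_resolution_def]
  show "injective_module R (E n)" "e \<in> mod_hom R M (E 0)" "inj_on e (carrier M)"
    using * by blast+
  have im: "e ` carrier M = {z \<in> carrier (E 0). d 0 z = \<zero>\<^bsub>E 1\<^esub>}"
    and ex: "\<And>n. d n ` carrier (E n) = {z \<in> carrier (E (Suc n)). d (Suc n) z = \<zero>\<^bsub>E (Suc (Suc n))\<^esub>}"
    using * by blast+
  show "m \<in> carrier M \<Longrightarrow> d 0 (e m) = \<zero>\<^bsub>E 1\<^esub>" using im by blast
  show "\<exists>m\<in>carrier M. e m = z" if "z \<in> carrier (E 0)" "d 0 z = \<zero>\<^bsub>E 1\<^esub>"
  proof -
    have "z \<in> e ` carrier M" using im that by simp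
    then show ?thesis by auto
  qed
  show "\<exists>w\<in>carrier (E n). d n w = y"
    if "y \<in> carrier (E (Suc n))" "d (Suc n) y = \<zero>\<^bsub>E (Suc (Suc n))\<^esub>"
  proof -
    have "y \<in> d n ` carrier (E n)" using ex that by simp
    then show ?thesis by auto
  qed
  have "d (Suc n) (d n u) = \<zero>\<^bsub>E (Suc (Suc n))\<^esub>" if "u \<in> carrier (E n)" for n u
  proof -
    have "d n u \<in> d n ` carrier (E n)" using that by simp
    then show ?thesis unfolding ex by simp
  qed
  moreover have "module R (E n)" "d n \<in> mod_hom R (E n) (E (Suc n))" for n
    using * by (simp_all add: injective_module_def)
  ultimately show "cochain_complex R E d" by (simp add: cochain_complex_def)
qed

lemma cochain_map_smult:
  assumes "cring R" and C: "cochain_complex R C d" and x: "x \<in> carrier R"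
  shows "cochain_map R C d C d (\<lambda>n u. x \<odot>\<^bsub>C n\<^esub> u)"
  using mod_hom_smult_const[OF cochain_complexD(1)[OF C] x] mod_hom_smult[OF cochain_complexD(2)[OF C] x]
  by (simp add: cochain_map_def)

abbreviation mult_cone :: "(nat \<Rightarrow> ('a, 'c) module) \<Rightarrow> nat \<Rightarrow> ('a, 'c \<times> 'c) module"
  where "mult_cone E \<equiv> cone_mod E E"

abbreviation mult_cone_diff ::
    "(nat \<Rightarrow> ('a, 'c) module) \<Rightarrow> (nat \<Rightarrow> 'c \<Rightarrow> 'c) \<Rightarrow> 'a \<Rightarrow> nat \<Rightarrow> 'c \<times> 'c \<Rightarrow> 'c \<times> 'c"
  where "mult_cone_diff E d x \<equiv> cone_diff E d d (\<lambda>n u. x \<odot>\<^bsub>E n\<^esub> u)"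

text \<open>\<open>E\<close> is exact in positive degrees, so the surjectivity hypothesis of
  \<open>cone_exact\<close> holds with \<open>u = 0\<close>, and the other one is exactness itself.
  Left over are the cohomologies of the cone in degrees 0 and 1.\<close>

lemma mult_cone_exact:
  assumes "cring R" and C: "cochain_complex R E d" and x: "x \<in> carrier R"
    and exact: "\<And>n y. y \<in> carrier (E (Suc n)) \<Longrightarrow> d (Suc n) y = \<zero>\<^bsub>E (Suc (Suc n))\<^esub> \<Longrightarrow>
      \<exists>w\<in>carrier (E n). d n w = y"
    and p: "p \<in> carrier (mult_cone E (Suc (Suc n)))"
      "mult_cone_diff E d x (Suc (Suc n)) p = \<zero>\<^bsub>mult_cone E (Suc (Suc (Suc n)))\<^esub>"
  shows "\<exists>q\<in>carrier (mult_cone E (Suc n)). mult_cone_diff E d x (Suc n) q = p"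
proof (rule cone_exact[OF C C cochain_map_smult[OF assms(1) C x] _ _ p])
  note CD = cochain_complexD[OF C]
  fix y assume y: "y \<in> carrier (E (Suc n))" "d (Suc n) y = \<zero>\<^bsub>E (Suc (Suc n))\<^esub>"
  then obtain w where w: "w \<in> carrier (E n)" "d n w = y" using exact by blast
  interpret A: module R "E n" by (rule CD)
  interpret B: module R "E (Suc n)" by (rule CD)
  show "\<exists>u\<in>carrier (E (Suc n)). \<exists>v\<in>carrier (shift_mod E (Suc n)).
    d (Suc n) u = \<zero>\<^bsub>E (Suc (Suc n))\<^esub> \<and>
    x \<odot>\<^bsub>E (Suc n)\<^esub> u \<ominus>\<^bsub>E (Suc n)\<^esub> shift_diff E d (Suc n) v = y"
    using w y(1) x mod_hom_zero[OF CD(1,1,2)] mod_hom_minus[OF CD(1,1,2) w(1)]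
    by (intro bexI[of _ "\<zero>\<^bsub>E (Suc n)\<^esub>"] bexI[of _ "\<ominus>\<^bsub>E n\<^esub> w"]) (auto simp: B.M.minus_eq)
qed (use exact in blast)

section \<open>Torsion of cones, and the comparison of the cone of \<open>x\<close> with a
  resolution of \<open>M / x M\<close>\<close>

context noetherian_ideal
begin

text \<open>A cone of a map between complexes of injectives consists of injectives. Here the cone of
  \<open>f : C \<rightarrow> D\<close> resolves its \<open>0\<close>-th cohomology, so torsion there makes \<open>\<Gamma>\<^sub>\<aa> f\<close> a quasi-isomorphism.\<close>

lemma tor_cone_quasi_iso:
  assumes C: "cochain_complex R C d" and D: "cochain_complex R D d'"
    and f: "cochain_map R C d D d' f"
    and injC: "\<And>n. injective_module R (C n)" and injD: "\<And>n. injective_module R (D n)"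
    and onto: "\<And>n y. y \<in> carrier (D n) \<Longrightarrow> d' n y = \<zero>\<^bsub>D (Suc n)\<^esub> \<Longrightarrow>
      \<exists>u\<in>carrier (C n). \<exists>v\<in>carrier (shift_mod D n).
        d n u = \<zero>\<^bsub>C (Suc n)\<^esub> \<and> f n u \<ominus>\<^bsub>D n\<^esub> shift_diff D d' n v = y"
    and inj: "\<And>n u v. u \<in> carrier (C (Suc n)) \<Longrightarrow> d (Suc n) u = \<zero>\<^bsub>C (Suc (Suc n))\<^esub> \<Longrightarrow>
      v \<in> carrier (D n) \<Longrightarrow> f (Suc n) u = d' n v \<Longrightarrow> \<exists>u'\<in>carrier (C n). d n u' = u"
    and ker: "\<And>u. u \<in> carrier (C 0) \<Longrightarrow> d 0 u = \<zero>\<^bsub>C 1\<^esub> \<Longrightarrow> f 0 u = \<zero>\<^bsub>D 0\<^esub> \<Longrightarrow> u \<in> tor (C 0)"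
    and uv: "u \<in> tor (C (Suc n))" "d (Suc n) u = \<zero>\<^bsub>C (Suc (Suc n))\<^esub>"
      "v \<in> tor (D n)" "f (Suc n) u = d' n v"
  obtains u' v' where "u' \<in> tor (C n)" "d n u' = u"
    "v' \<in> tor (shift_mod D n)" "f n u' \<ominus>\<^bsub>D n\<^esub> shift_diff D d' n v' = v"
proof -
  define L where "L = cone_mod C D"
  define dL where "dL = cone_diff D d d' f"
  note CD = cochain_complexD[OF C] and DD = cochain_complexD[OF D] and fD = cochain_mapD[OF f]
  have Lc: "cochain_complex R L dL"
    unfolding L_def dL_def by (rule cochain_complex_cone[OF C D f])
  note LD = cochain_complexD[OF Lc]
  interpret D1: module R "D (Suc n)" by (rule DD)
  interpret D0: module R "D 0" by (rule DD)
  have ker': "p \<in> tor (L 0)" if p: "p \<in> carrier (L 0)" "dL 0 p = \<zero>\<^bsub>L 1\<^esub>" for p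
  proof -
    obtain u where u: "p = (u, \<zero>\<^bsub>D 0\<^esub>)" "u \<in> carrier (C 0)"
      using p(1) by (auto simp: L_def cone_mod_def)
    have "d 0 u = \<zero>\<^bsub>C 1\<^esub>" "f 0 u = \<zero>\<^bsub>D 0\<^esub>"
      using p(2) u mod_hom_closed[OF fD(1) u(2)]
      by (auto simp: L_def dL_def cone_mod_def cone_diff_def D0.M.diff_zero)
    then have "u \<in> tor (C 0)" by (rule ker[OF u(2)])
    moreover have "\<zero>\<^bsub>D 0\<^esub> \<in> tor (shift_mod D 0)"
      by (rule torI[where n = 0]) (simp_all add: ideal_power_carrier[of _ 0])
    ultimately show ?thesis using u(1) by (simp add: L_def cone_mod_def tor_direct_sum)
  qed
  \<comment> \<open>The assumptions \<open>uv\<close> say that \<open>(u, v)\<close> is a torsion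
    cocycle of the cone; a torsion preimage of it in degree \<open>n\<close> is the pair
    sought.\<close>
  have 1: "(u, v) \<in> tor (L (Suc n))"
    using uv by (simp add: L_def cone_mod_def tor_direct_sum)
  have 2: "dL (Suc n) (u, v) = \<zero>\<^bsub>L (Suc (Suc n))\<^esub>"
    using uv mod_hom_closed[OF DD(2) tor_carrier[OF uv(3)]]
    by (simp add: dL_def L_def cone_mod_def cone_diff_def D1.M.diff_simps)
  have inj': "injective_module R (L n)" for n
    unfolding L_def by (rule injective_cone_mod[OF injC injD])
  have exact: "\<exists>q\<in>carrier (L n). dL n q = p"
    if "p \<in> carrier (L (Suc n))" "dL (Suc n) p = \<zero>\<^bsub>L (Suc (Suc n))\<^esub>" for n p
    unfolding L_def dL_def by (rule cone_exact[OF C D f onto inj that[unfolded L_def dL_def]])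
  obtain q where q: "q \<in> tor (L n)" "dL n q = (u, v)"
    by (rule tor_injective_resolution_exact[where L = L and d = dL, OF inj' LD(2,3) exact ker' 1 2])
  then show thesis
    by (cases q) (auto simp: L_def dL_def cone_mod_def cone_diff_def tor_direct_sum intro: that)
qed

text \<open>Degrees are shifted by one: the cone of \<open>x : E \<rightarrow> E\<close> has \<open>E\<^sup>0\<close> in degree \<open>0\<close>, where its
  cohomology is \<open>0 :\<^sub>M x\<close>, and it has cohomology \<open>M / x M\<close> in degree \<open>1\<close>.\<close>

lemma quotient_resolution_comparison:
  assumes M: "module R M" and E: "injective_resolution R M E d e"
    and E': "injective_resolution R (quot_module M (smult_image M x)) E' d' e'"
    and x: "x \<in> carrier R" and tors: "\<And>m. m \<in> carrier M \<Longrightarrow> x \<odot>\<^bsub>M\<^esub> m = \<zero>\<^bsub>M\<^esub> \<Longrightarrow> m \<in> tor M"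
  obtains \<phi> where
    "\<And>n. \<phi> n \<in> mod_hom R (mult_cone E (Suc n)) (E' n)"
    "\<And>n p. p \<in> tor (mult_cone E n) \<Longrightarrow>
      \<phi> n (mult_cone_diff E d x n p) \<in> shift_diff E' d' n ` tor (shift_mod E' n)"
    "\<And>n p. p \<in> carrier (mult_cone E (Suc n)) \<Longrightarrow>
      mult_cone_diff E d x (Suc n) p = \<zero>\<^bsub>mult_cone E (Suc (Suc n))\<^esub> \<Longrightarrow>
      d' n (\<phi> n p) = \<zero>\<^bsub>E' (Suc n)\<^esub>"
    "\<And>n z. z \<in> tor (E' n) \<Longrightarrow> d' n z = \<zero>\<^bsub>E' (Suc n)\<^esub> \<Longrightarrow>
      \<exists>p\<in>tor (mult_cone E (Suc n)). \<exists>v\<in>tor (shift_mod E' n).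
        mult_cone_diff E d x (Suc n) p = \<zero>\<^bsub>mult_cone E (Suc (Suc n))\<^esub> \<and>
        \<phi> n p \<ominus>\<^bsub>E' n\<^esub> shift_diff E' d' n v = z"
    "\<And>n p v. p \<in> tor (mult_cone E (Suc n)) \<Longrightarrow>
      mult_cone_diff E d x (Suc n) p = \<zero>\<^bsub>mult_cone E (Suc (Suc n))\<^esub> \<Longrightarrow>
      v \<in> tor (shift_mod E' n) \<Longrightarrow> \<phi> n p = shift_diff E' d' n v \<Longrightarrow>
      \<exists>q\<in>tor (mult_cone E n). mult_cone_diff E d x n q = p"
proof -
  define N where "N = smult_image M x"
  define K where "K = mult_cone E"
  define dK where "dK = mult_cone_diff E d x"
  note ED = injective_resolutionD[OF E] and ED' = injective_resolutionD[OF E'[folded N_def]]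
  note EC = cochain_complexD[OF ED(2)] and EC' = cochain_complexD[OF ED'(2)]
  have Kc: "cochain_complex R K dK"
    unfolding K_def dK_def
    by (rule cochain_complex_cone[OF ED(2) ED(2) cochain_map_smult[OF is_cring ED(2) x]])
  note KD = cochain_complexD[OF Kc]
  interpret M: module R M by fact
  interpret E0: module R "E 0" by (rule EC)
  interpret E1: module R "E (Suc 0)" by (rule EC)
  interpret F0: module R "E' 0" by (rule EC')
  have N: "submodule N R M"
    unfolding N_def smult_image_def by (rule submodule_image[OF M M mod_hom_smult_const[OF M x]])
  have eq: "(\<lambda>m. e' (N +>\<^bsub>M\<^esub> m)) \<in> mod_hom R M (E' 0)"
    by (rule mod_hom_compose[OF mod_hom_quot[OF M N] ED'(3)])
  have eq0: "e' (N +>\<^bsub>M\<^esub> m) = \<zero>\<^bsub>E' 0\<^esub> \<longleftrightarrow> (\<exists>m'\<in>carrier M. m = x \<odot>\<^bsub>M\<^esub> m')" if m: "m \<in> carrier M" for m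
  proof -
    have "e' (N +>\<^bsub>M\<^esub> m) = \<zero>\<^bsub>E' 0\<^esub> \<longleftrightarrow> e' (N +>\<^bsub>M\<^esub> m) = e' (N +>\<^bsub>M\<^esub> \<zero>\<^bsub>M\<^esub>)"
      using mod_hom_zero[OF M EC'(1) eq] by simp
    also have "\<dots> \<longleftrightarrow> N +>\<^bsub>M\<^esub> m = N +>\<^bsub>M\<^esub> \<zero>\<^bsub>M\<^esub>"
      using inj_on_eq_iff[OF ED'(4)] m by simp
    also have "\<dots> \<longleftrightarrow> m \<in> N"
      using a_r_coset_eq_iff[OF M N m M.M.zero_closed] m by (simp add: M.M.diff_zero)
    finally show ?thesis by (auto simp: N_def smult_image_def)
  qed
  have dK: "dK n (u, v) = (d n u, x \<odot>\<^bsub>E n\<^esub> u \<ominus>\<^bsub>E n\<^esub> shift_diff E d n v)" for n u v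
    by (simp add: dK_def cone_diff_def)
  \<comment> \<open>The values of \<open>\<iota>\<close> are exactly the cocycles of the cone in
    degree 1: the first component is \<open>d w\<close> by exactness, and subtracting
    \<open>x w\<close> from the second leaves some \<open>e m\<close>. Sending such a cocycle to the
    class of \<open>m\<close> in \<open>M / x M\<close> prescribes \<open>f0\<close> on the image of
    \<open>\<iota>\<close>.\<close>
  define A where "A = direct_sum (E 0) M"
  have A: "module R A" unfolding A_def by (rule module_direct_sum[OF EC(1) M])
  define \<iota> where "\<iota> = (\<lambda>p. (d 0 (fst p), x \<odot>\<^bsub>E 0\<^esub> fst p \<oplus>\<^bsub>E 0\<^esub> e (snd p)))"
  have \<iota>: "\<iota> \<in> mod_hom R A (K 1)"
    unfolding \<iota>_def A_def K_def cone_mod_def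
    using EC(1,2)[of 0] ED(3)
    by (auto intro!: mod_hom_Pair mod_hom_sum mod_hom_smult_const x
        mod_hom_compose[OF mod_hom_fst] mod_hom_compose[OF mod_hom_snd])
  have g: "(\<lambda>p. e' (N +>\<^bsub>M\<^esub> snd p)) \<in> mod_hom R A (E' 0)"
    unfolding A_def by (rule mod_hom_compose[OF mod_hom_snd eq])
  obtain f0 where f0: "f0 \<in> mod_hom R (K 1) (E' 0)"
    and f0\<iota>: "\<And>p. p \<in> carrier A \<Longrightarrow> f0 (\<iota> p) = e' (N +>\<^bsub>M\<^esub> snd p)"
  proof (rule injective_module_factor[OF ED'(1) A KD(1) \<iota> g])
    \<comment> \<open>The kernel of \<open>\<iota>\<close> consists of the pairs
      \<open>(e m', - x m')\<close>, whose second component has class 0 in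
      \<open>M / x M\<close>.\<close>
    fix p assume p: "p \<in> carrier A" "\<iota> p = \<zero>\<^bsub>K 1\<^esub>"
    obtain w m where wm: "p = (w, m)" "w \<in> carrier (E 0)" "m \<in> carrier M"
      using p(1) by (auto simp: A_def)
    have dw: "d 0 w = \<zero>\<^bsub>E 1\<^esub>" and xw: "x \<odot>\<^bsub>E 0\<^esub> w \<oplus>\<^bsub>E 0\<^esub> e m = \<zero>\<^bsub>E 0\<^esub>"
      using p(2) wm by (auto simp: \<iota>_def K_def cone_mod_def)
    obtain m' where m': "m' \<in> carrier M" "e m' = w" using ED(6)[OF wm(2) dw] by blast
    have "e (x \<odot>\<^bsub>M\<^esub> m' \<oplus>\<^bsub>M\<^esub> m) = e \<zero>\<^bsub>M\<^esub>"
      using xw m' wm(3) x mod_hom_add[OF ED(3)] mod_hom_smult[OF ED(3)] mod_hom_zero[OF M EC(1) ED(3)]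
      by simp
    then have "x \<odot>\<^bsub>M\<^esub> m' \<oplus>\<^bsub>M\<^esub> m = \<zero>\<^bsub>M\<^esub>"
      using inj_onD[OF ED(4)] m'(1) wm(3) x by simp
    then have "m = \<ominus>\<^bsub>M\<^esub> (x \<odot>\<^bsub>M\<^esub> m')"
      using m'(1) wm(3) x by (simp add: M.M.minus_equality M.M.a_comm)
    also have "\<dots> = x \<odot>\<^bsub>M\<^esub> (\<ominus>\<^bsub>M\<^esub> m')" using m'(1) x by (simp add: M.smult_r_minus)
    finally show "e' (N +>\<^bsub>M\<^esub> snd p) = \<zero>\<^bsub>E' 0\<^esub>"
      using eq0[OF wm(3)] wm(1) m'(1) by auto
  qed blast
  have \<iota>_onto: "\<exists>p\<in>carrier A. \<iota> p = u" if u: "u \<in> carrier (K 1)" "dK 1 u = \<zero>\<^bsub>K 2\<^esub>" for u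
  proof -
    obtain a b where ab: "u = (a, b)" "a \<in> carrier (E 1)" "b \<in> carrier (E 0)"
      using u(1) by (auto simp: K_def cone_mod_def)
    have da: "d 1 a = \<zero>\<^bsub>E 2\<^esub>" and xa: "x \<odot>\<^bsub>E 1\<^esub> a \<ominus>\<^bsub>E 1\<^esub> d 0 b = \<zero>\<^bsub>E 1\<^esub>"
      using u(2) ab by (auto simp: dK K_def cone_mod_def numeral_2_eq_2)
    obtain w where w: "w \<in> carrier (E 0)" "d 0 w = a"
      using ED(7)[of a 0] ab(2) da by (auto simp: numeral_2_eq_2)
    have "d 0 (b \<ominus>\<^bsub>E 0\<^esub> x \<odot>\<^bsub>E 0\<^esub> w) = d 0 b \<ominus>\<^bsub>E 1\<^esub> x \<odot>\<^bsub>E 1\<^esub> a"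
      using mod_hom_diff[OF EC(1,1,2) ab(3), of "x \<odot>\<^bsub>E 0\<^esub> w"] mod_hom_smult[OF EC(2) x w(1)] w x by simp
    also have "\<dots> = \<zero>\<^bsub>E 1\<^esub>"
      using xa x ab(2) mod_hom_closed[OF EC(2) ab(3)] by (simp add: E1.M.diff_eq_zero_iff)
    finally obtain m where m: "m \<in> carrier M" "e m = b \<ominus>\<^bsub>E 0\<^esub> x \<odot>\<^bsub>E 0\<^esub> w"
      using ED(6)[of "b \<ominus>\<^bsub>E 0\<^esub> x \<odot>\<^bsub>E 0\<^esub> w"] ab(3) w(1) x by auto
    have "\<iota> (w, m) = u"
      using ab(1,3) w m x by (simp add: \<iota>_def E0.M.diff_simps)
    then show ?thesis using w(1) m(1) by (intro bexI[of _ "(w, m)"]) (auto simp: A_def)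
  qed
  have f0dK: "f0 (dK 0 p) = \<zero>\<^bsub>E' 0\<^esub>" if p: "p \<in> carrier (K 0)" for p
  proof -
    obtain w where w: "p = (w, \<zero>\<^bsub>E 0\<^esub>)" "w \<in> carrier (E 0)"
      using p by (auto simp: K_def cone_mod_def)
    have "dK 0 p = \<iota> (w, \<zero>\<^bsub>M\<^esub>)"
      using w x mod_hom_zero[OF M EC(1) ED(3)] by (simp add: dK \<iota>_def E0.M.minus_eq)
    then show ?thesis
      using f0\<iota>[of "(w, \<zero>\<^bsub>M\<^esub>)"] w(2) mod_hom_zero[OF M EC'(1) eq] by (simp add: A_def)
  qed
  \<comment> \<open>Degree 0 of the cone is dropped, so that the comparison starts where the cone
    carries \<open>M / x M\<close>.\<close>
  have KS: "cochain_complex R (\<lambda>n. K (Suc n)) (\<lambda>n. dK (Suc n))"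
    using Kc by (simp add: cochain_complex_def)
  have Kexact: "\<exists>q\<in>carrier (K (Suc n)). dK (Suc n) q = p"
    if "p \<in> carrier (K (Suc (Suc n)))" "dK (Suc (Suc n)) p = \<zero>\<^bsub>K (Suc (Suc (Suc n)))\<^esub>" for n p
    unfolding K_def dK_def
    by (rule mult_cone_exact[OF is_cring ED(2) x ED(7) that[unfolded K_def dK_def]])
  obtain \<phi> where \<phi>: "cochain_map R (\<lambda>n. K (Suc n)) (\<lambda>n. dK (Suc n)) E' d' \<phi>" and \<phi>0: "\<phi> 0 = f0"
  proof (rule comparison_map[OF KS ED'(2,1) Kexact])
    show "f0 \<in> mod_hom R (K (Suc 0)) (E' 0)" using f0 by simp
    fix u assume "u \<in> carrier (K (Suc 0))" "dK (Suc 0) u = \<zero>\<^bsub>K (Suc 1)\<^esub>"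
    then obtain p where p: "p \<in> carrier A" "\<iota> p = u"
      using \<iota>_onto[of u] by (auto simp: numeral_2_eq_2)
    then have "snd p \<in> carrier M" by (auto simp: A_def)
    then show "d' 0 (f0 u) = \<zero>\<^bsub>E' 1\<^esub>" using f0\<iota>[OF p(1)] p(2) ED'(5) by auto
  qed blast
  note \<phi>D = cochain_mapD[OF \<phi>]
  \<comment> \<open>To cover the whole cone again, \<open>E'\<close> is moved up by one degree and
    \<open>\<phi>\<close> is extended by 0. Compatibility in the lowest degree is
    \<open>f0dK\<close>: a coboundary of degree 1 has class 0 in \<open>M / x M\<close>.\<close>
  define f where "f n = (case n of 0 \<Rightarrow> \<lambda>_. \<zero>\<^bsub>E' 0\<^esub> | Suc m \<Rightarrow> \<phi> m)" for n
  define S where "S = shift_mod E'"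
  define dS where "dS = shift_diff E' d'"
  have Sc: "cochain_complex R S dS" unfolding S_def dS_def by (rule cochain_complex_shift[OF ED'(2)])
  note SD = cochain_complexD[OF Sc]
  have f: "cochain_map R K dK S dS f"
    unfolding cochain_map_def
  proof (intro conjI allI ballI)
    show "f n \<in> mod_hom R (K n) (S n)" for n
      using \<phi>D(1) mod_hom_const_zero[OF SD(1)[of 0]] by (cases n) (auto simp: f_def S_def)
    show "f (Suc n) (dK n u) = dS n (f n u)" if "u \<in> carrier (K n)" for n u
      using that \<phi>D(2) f0dK \<phi>0 by (cases n) (auto simp: f_def dS_def)
  qed
  have onto: "\<exists>u\<in>carrier (K n). \<exists>v\<in>carrier (shift_mod S n).
      dK n u = \<zero>\<^bsub>K (Suc n)\<^esub> \<and> f n u \<ominus>\<^bsub>S n\<^esub> shift_diff S dS n v = y"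
    if y: "y \<in> carrier (S n)" "dS n y = \<zero>\<^bsub>S (Suc n)\<^esub>" for n y
  proof -
    interpret Kn: module R "K n" by (rule KD)
    interpret Sn: module R "S n" by (rule SD)
    show ?thesis
    proof (cases "n = 1")
      \<comment> \<open>Degree 1 is the only one in which \<open>S\<close> has cohomology, namely
        \<open>M / x M\<close>; the class of \<open>m\<close> is the image of the cocycle
        \<open>(0, e m)\<close>.\<close>
      case True
      have y': "y \<in> carrier (E' 0)" "d' 0 y = \<zero>\<^bsub>E' 1\<^esub>" using y True by (auto simp: S_def dS_def)
      obtain c where "c \<in> carrier (quot_module M N)" "e' c = y" using ED'(6)[OF y'] by blast
      then obtain m where m: "m \<in> carrier M" "e' (N +>\<^bsub>M\<^esub> m) = y" by auto
      note em = mod_hom_closed[OF ED(3) m(1)]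
      have i: "\<iota> (\<zero>\<^bsub>E 0\<^esub>, m) = (\<zero>\<^bsub>E 1\<^esub>, e m)"
        using em x mod_hom_zero[OF EC(1,1,2)] by (simp add: \<iota>_def)
      have "dK 1 (\<zero>\<^bsub>E 1\<^esub>, e m) = \<zero>\<^bsub>K 2\<^esub>"
        using ED(5)[OF m(1)] mod_hom_zero[OF EC(1,1,2), of 1] x
        by (simp add: dK K_def cone_mod_def E1.M.minus_eq numeral_2_eq_2)
      moreover have "f 1 (\<zero>\<^bsub>E 1\<^esub>, e m) = y"
        using f0\<iota>[of "(\<zero>\<^bsub>E 0\<^esub>, m)"] m i \<phi>0 by (simp add: f_def A_def)
      moreover have "(\<zero>\<^bsub>E 1\<^esub>, e m) \<in> carrier (K 1)" using em by (simp add: K_def cone_mod_def)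
      ultimately show ?thesis
        using True y'(1) by (intro bexI[of _ "(\<zero>\<^bsub>E 1\<^esub>, e m)"] bexI[of _ "\<zero>\<^bsub>E' 0\<^esub>"])
          (auto simp: S_def dS_def numeral_2_eq_2 F0.M.minus_eq)
    next
      case False
      have "\<exists>v\<in>carrier (shift_mod S n). shift_diff S dS n v = y"
      proof (cases n)
        case 0
        then show ?thesis using y by (auto simp: S_def)
      next
        case (Suc k)
        with False obtain l where l: "k = Suc l" by (cases k) auto
        have "y \<in> carrier (E' (Suc l))" "d' (Suc l) y = \<zero>\<^bsub>E' (Suc (Suc l))\<^esub>"
          using y Suc l by (auto simp: S_def dS_def)
        then show ?thesis using ED'(7) Suc l by (auto simp: S_def dS_def)
      qed
      then obtain v where v: "v \<in> carrier (shift_mod S n)" "shift_diff S dS n v = y" by blast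
      note SS = cochain_complexD[OF cochain_complex_shift[OF Sc]]
      interpret T: module R "shift_mod S n" by (rule SS)
      have "shift_diff S dS n (\<ominus>\<^bsub>shift_mod S n\<^esub> v) = \<ominus>\<^bsub>S n\<^esub> y"
        using mod_hom_minus[OF SS(1,1,2) v(1)] v(2) by simp
      then show ?thesis
        using v(1) y(1) mod_hom_zero[OF KD(1,1,2)] mod_hom_zero[OF KD(1) SD(1) cochain_mapD(1)[OF f]]
        by (intro bexI[of _ "\<zero>\<^bsub>K n\<^esub>"] bexI[of _ "\<ominus>\<^bsub>shift_mod S n\<^esub> v"]) (auto simp: Sn.M.minus_eq)
    qed
  qed
  have inj: "\<exists>u'\<in>carrier (K n). dK n u' = u"
    if u: "u \<in> carrier (K (Suc n))" "dK (Suc n) u = \<zero>\<^bsub>K (Suc (Suc n))\<^esub>"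
      and v: "v \<in> carrier (S n)" "f (Suc n) u = dS n v" for n u v
  proof (cases n)
    case 0
    \<comment> \<open>A cocycle \<open>\<iota> (w, m)\<close> sent to 0 has \<open>m = x m'\<close>.
      Replacing \<open>w\<close> by \<open>w + e m'\<close> exhibits it as a coboundary, since
      \<open>d 0\<close> kills \<open>e m'\<close>.\<close>
    have fu: "f0 u = \<zero>\<^bsub>E' 0\<^esub>" using v 0 \<phi>0 by (simp add: f_def dS_def)
    obtain p where p: "p \<in> carrier A" "\<iota> p = u" using \<iota>_onto[of u] u 0 by (auto simp: numeral_2_eq_2)
    obtain w m where wm: "p = (w, m)" "w \<in> carrier (E 0)" "m \<in> carrier M"
      using p(1) by (auto simp: A_def)
    have "e' (N +>\<^bsub>M\<^esub> m) = \<zero>\<^bsub>E' 0\<^esub>" using f0\<iota>[OF p(1)] p(2) wm(1) fu by simp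
    then obtain m' where m': "m' \<in> carrier M" "m = x \<odot>\<^bsub>M\<^esub> m'" using eq0[OF wm(3)] by blast
    note em' = mod_hom_closed[OF ED(3) m'(1)]
    have "dK 0 (w \<oplus>\<^bsub>E 0\<^esub> e m', \<zero>\<^bsub>E 0\<^esub>) = u"
      using p(2)[symmetric] wm(1,2) em' m' x mod_hom_add[OF EC(2) wm(2) em'] ED(5)[OF m'(1)]
        mod_hom_smult[OF ED(3) x m'(1)] mod_hom_closed[OF EC(2) wm(2)]
      by (simp add: dK \<iota>_def E0.M.minus_eq E0.smult_r_distr)
    moreover have "(w \<oplus>\<^bsub>E 0\<^esub> e m', \<zero>\<^bsub>E 0\<^esub>) \<in> carrier (K 0)"
      using wm(2) em' by (simp add: K_def cone_mod_def)
    ultimately show ?thesis using 0 by blast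
  next
    case (Suc k)
    then show ?thesis using Kexact u by blast
  qed
  have ker: "u \<in> tor (K 0)" if u: "u \<in> carrier (K 0)" "dK 0 u = \<zero>\<^bsub>K 1\<^esub>" for u
  proof -
    obtain w where w: "u = (w, \<zero>\<^bsub>E 0\<^esub>)" "w \<in> carrier (E 0)"
      using u(1) by (auto simp: K_def cone_mod_def)
    have dw: "d 0 w = \<zero>\<^bsub>E 1\<^esub>" "x \<odot>\<^bsub>E 0\<^esub> w = \<zero>\<^bsub>E 0\<^esub>"
      using u(2) w x by (auto simp: dK K_def cone_mod_def E0.M.diff_zero)
    obtain m where m: "m \<in> carrier M" "e m = w" using ED(6)[OF w(2) dw(1)] by blast
    have "e (x \<odot>\<^bsub>M\<^esub> m) = e \<zero>\<^bsub>M\<^esub>"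
      using mod_hom_smult[OF ED(3) x m(1)] m(2) dw(2) mod_hom_zero[OF M EC(1) ED(3)] by simp
    then have "x \<odot>\<^bsub>M\<^esub> m = \<zero>\<^bsub>M\<^esub>" using inj_onD[OF ED(4)] m(1) x by simp
    then have "m \<in> tor M" by (rule tors[OF m(1)])
    then have "w \<in> tor (E 0)" using tor_hom[OF M EC(1) ED(3)] m(2) by blast
    moreover have "\<zero>\<^bsub>E 0\<^esub> \<in> tor (shift_mod E 0)"
      by (rule torI[where n = 0]) (simp_all add: ideal_power_carrier[of _ 0])
    ultimately show ?thesis using w(1) by (simp add: K_def cone_mod_def tor_direct_sum)
  qed
  have injK: "injective_module R (K n)" for n
    unfolding K_def by (rule injective_cone_mod[OF ED(1) ED(1)])
  have injS: "injective_module R (S n)" for n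
    unfolding S_def by (rule injective_shift_mod[OF ED'(1)])
  have quasi: "\<exists>u'\<in>tor (K n). \<exists>v'\<in>tor (shift_mod S n).
      dK n u' = u \<and> f n u' \<ominus>\<^bsub>S n\<^esub> shift_diff S dS n v' = v"
    if "u \<in> tor (K (Suc n))" "dK (Suc n) u = \<zero>\<^bsub>K (Suc (Suc n))\<^esub>"
      "v \<in> tor (S n)" "f (Suc n) u = dS n v" for n u v
    by (rule tor_cone_quasi_iso[OF Kc Sc f injK injS onto inj ker that]) blast+
  show thesis
  proof (rule that[folded K_def dK_def S_def dS_def])
    show "\<phi> n \<in> mod_hom R (K (Suc n)) (E' n)" for n by (rule \<phi>D(1))
    show "\<phi> n (dK n p) \<in> dS n ` tor (S n)" if p: "p \<in> tor (K n)" for n p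
      using cochain_mapD(2)[OF f tor_carrier[OF p]] tor_hom[OF KD(1) SD(1) cochain_mapD(1)[OF f] p]
      by (simp add: f_def)
    show "d' n (\<phi> n p) = \<zero>\<^bsub>E' (Suc n)\<^esub>"
      if "p \<in> carrier (K (Suc n))" "dK (Suc n) p = \<zero>\<^bsub>K (Suc (Suc n))\<^esub>" for n p
      using \<phi>D(2)[OF that(1)] that(2) mod_hom_zero[OF KD(1) EC'(1) \<phi>D(1)] by simp
    show "\<exists>p\<in>tor (K (Suc n)). \<exists>v\<in>tor (S n).
        dK (Suc n) p = \<zero>\<^bsub>K (Suc (Suc n))\<^esub> \<and> \<phi> n p \<ominus>\<^bsub>E' n\<^esub> dS n v = z"
      if z: "z \<in> tor (E' n)" "d' n z = \<zero>\<^bsub>E' (Suc n)\<^esub>" for n z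
    proof -
      interpret K1: module R "K (Suc (Suc n))" by (rule KD)
      have 1: "\<zero>\<^bsub>K (Suc (Suc n))\<^esub> \<in> tor (K (Suc (Suc n)))"
        by (rule K1.submodule_zero[OF tor_submodule[OF KD(1)]])
      have 2: "dK (Suc (Suc n)) \<zero>\<^bsub>K (Suc (Suc n))\<^esub> = \<zero>\<^bsub>K (Suc (Suc (Suc n)))\<^esub>"
        by (rule mod_hom_zero[OF KD(1,1,2)])
      have 3: "z \<in> tor (S (Suc n))" using z(1) by (simp add: S_def)
      have 4: "f (Suc (Suc n)) \<zero>\<^bsub>K (Suc (Suc n))\<^esub> = dS (Suc n) z"
        using mod_hom_zero[OF KD(1) EC'(1) \<phi>D(1), of "Suc n"] z(2) by (simp add: f_def dS_def)
      from quasi[OF 1 2 3 4] show ?thesis by (auto simp: f_def S_def)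
    qed
    show "\<exists>q\<in>tor (K n). dK n q = p"
      if p: "p \<in> tor (K (Suc n))" "dK (Suc n) p = \<zero>\<^bsub>K (Suc (Suc n))\<^esub>" "v \<in> tor (S n)"
        and \<phi>p: "\<phi> n p = dS n v" for n p v
    proof -
      have "f (Suc n) p = dS n v" using \<phi>p by (simp add: f_def)
      with quasi[OF p] show ?thesis by blast
    qed
  qed
qed

end

section \<open>Splitting the cohomology of the cone\<close>

lemma coboundaries_eq: "coboundaries C d n = shift_diff C d n ` carrier (shift_mod C n)"
  by (cases n) auto

lemma submodule_coboundaries:
  assumes "cochain_complex R C d"
  shows "submodule (coboundaries C d n) R (C n)"
proof -
  note S = cochain_complexD[OF cochain_complex_shift[OF assms]]
  have "shift_diff C d n \<in> mod_hom R (shift_mod C n) (C n)" using S(2)[of n] by simp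
  then show ?thesis
    unfolding coboundaries_eq by (rule submodule_image[OF S(1) cochain_complexD(1)[OF assms]])
qed

lemma submodule_cocycles:
  assumes "cochain_complex R C d"
  shows "submodule (cocycles C d n) R (C n)"
proof -
  note C = cochain_complexD[OF assms]
  interpret M: module R "C (Suc n)" by (rule C)
  have "submodule {\<zero>\<^bsub>C (Suc n)\<^esub>} R (C (Suc n))" by (rule M.submoduleI) auto
  from submodule_preimage[OF C(1) C(1) C(2) this] show ?thesis by (simp add: cocycles_def)
qed

lemma coboundaries_subset_cocycles:
  assumes "cochain_complex R C d"
  shows "coboundaries C d n \<subseteq> cocycles C d n"
proof (cases n)
  case 0
  note C = cochain_complexD[OF assms]
  interpret M: module R "C 0" by (rule C)
  show ?thesis using 0 mod_hom_zero[OF C(1,1,2)] by (simp add: cocycles_def)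
next
  case (Suc k)
  then show ?thesis
    using cochain_complexD[OF assms] mod_hom_closed[OF cochain_complexD(2)[OF assms]]
    by (auto simp: cocycles_def)
qed

abbreviation cocycle_module ::
    "(nat \<Rightarrow> ('a, 'c) module) \<Rightarrow> (nat \<Rightarrow> 'c \<Rightarrow> 'c) \<Rightarrow> nat \<Rightarrow> ('a, 'c) module"
  where "cocycle_module C d n \<equiv> (C n)\<lparr>carrier := cocycles C d n\<rparr>"

definition cohomology_class ::
    "(nat \<Rightarrow> ('a, 'c) module) \<Rightarrow> (nat \<Rightarrow> 'c \<Rightarrow> 'c) \<Rightarrow> nat \<Rightarrow> 'c \<Rightarrow> 'c set"
  where "cohomology_class C d n u = coboundaries C d n +>\<^bsub>cocycle_module C d n\<^esub> u"

lemma cohomology_class: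
  assumes C: "cochain_complex R C d"
  shows module_cocycle_module: "module R (cocycle_module C d n)"
    and cohomology_class_hom:
      "cohomology_class C d n \<in> mod_hom R (cocycle_module C d n) (cohomology C d n)"
    and carrier_cohomology:
      "carrier (cohomology C d n) = cohomology_class C d n ` cocycles C d n"
    and cohomology_class_eq: "\<And>u v. u \<in> cocycles C d n \<Longrightarrow> v \<in> cocycles C d n \<Longrightarrow>
      cohomology_class C d n u = cohomology_class C d n v \<longleftrightarrow>
      u \<ominus>\<^bsub>cocycle_module C d n\<^esub> v \<in> coboundaries C d n"
    and cohomology_class_zero: "\<And>u. u \<in> cocycles C d n \<Longrightarrow>
      cohomology_class C d n u = \<zero>\<^bsub>cohomology C d n\<^esub> \<longleftrightarrow> u \<in> coboundaries C d n"
proof -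
  note CD = cochain_complexD[OF C]
  show Z: "module R (cocycle_module C d n)"
    by (rule submodule_module[OF CD(1) submodule_cocycles[OF C]])
  interpret C: module R "C n" by (rule CD)
  interpret Z: module R "cocycle_module C d n" by (rule Z)
  note B' = C.submoduleE[OF submodule_coboundaries[OF C]]
  have B: "submodule (coboundaries C d n) R (cocycle_module C d n)"
    by (rule Z.submoduleI_nonempty) (use B' coboundaries_subset_cocycles[OF C] in auto)
  have cls: "cohomology_class C d n = (\<lambda>u. coboundaries C d n +>\<^bsub>cocycle_module C d n\<^esub> u)"
    by (simp add: cohomology_class_def fun_eq_iff)
  show hom: "cohomology_class C d n \<in> mod_hom R (cocycle_module C d n) (cohomology C d n)"
    unfolding cls cohomology_def by (rule mod_hom_quot[OF Z B])
  show "carrier (cohomology C d n) = cohomology_class C d n ` cocycles C d n"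
    by (simp add: cls cohomology_def)
  show eq: "cohomology_class C d n u = cohomology_class C d n v \<longleftrightarrow>
      u \<ominus>\<^bsub>cocycle_module C d n\<^esub> v \<in> coboundaries C d n"
    if "u \<in> cocycles C d n" "v \<in> cocycles C d n" for u v
    unfolding cls using a_r_coset_eq_iff[OF Z B] that by simp
  show "cohomology_class C d n u = \<zero>\<^bsub>cohomology C d n\<^esub> \<longleftrightarrow> u \<in> coboundaries C d n"
    if u: "u \<in> cocycles C d n" for u
  proof -
    have z: "\<zero>\<^bsub>C n\<^esub> \<in> cocycles C d n" using C.submodule_zero[OF submodule_cocycles[OF C]] .
    have "\<zero>\<^bsub>cohomology C d n\<^esub> = coboundaries C d n" by (simp add: cohomology_def)
    also have "\<dots> = cohomology_class C d n \<zero>\<^bsub>C n\<^esub>"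
      using B'(1) by (auto simp: cohomology_class_def a_r_coset_def' subset_iff)
    finally have "cohomology_class C d n u = \<zero>\<^bsub>cohomology C d n\<^esub> \<longleftrightarrow>
      u \<ominus>\<^bsub>cocycle_module C d n\<^esub> \<zero>\<^bsub>C n\<^esub> \<in> coboundaries C d n"
      using eq[OF u z] by simp
    then show ?thesis using Z.M.diff_zero[of u] u by simp
  qed
qed

text \<open>\<open>G\<close> is the graph of a splitting \<open>c' \<mapsto> c\<close> of the projection of the cone to its second component,
  single-valued up to coboundaries. For \<open>x = a b\<close> it sends \<open>c'\<close> to \<open>a s\<close> where \<open>d s = b c'\<close>; the choice
  of \<open>s\<close> does not matter, since \<open>a\<close> kills the cohomology in degree \<open>n\<close>.\<close>

lemma splitting_relation:
  assumes C: "cochain_complex R C d" and I: "ideal I R" and J: "ideal J R"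
    and kill: "\<And>a z. a \<in> I \<Longrightarrow> z \<in> cocycles C d n \<Longrightarrow> a \<odot>\<^bsub>C n\<^esub> z \<in> coboundaries C d n"
    and x: "x \<in> ideal_prod R I J"
    and D_def: "D = {c \<in> cocycles C d (Suc n). \<forall>b\<in>J. b \<odot>\<^bsub>C (Suc n)\<^esub> c \<in> coboundaries C d (Suc n)}"
  shows "\<exists>G. submodule G R (direct_sum (C n) (C (Suc n))) \<and> snd ` G = D \<and>
    (\<forall>(c, c')\<in>G. d n c = x \<odot>\<^bsub>C (Suc n)\<^esub> c') \<and>
    (\<forall>w\<in>carrier (C n). \<forall>c. (c, d n w) \<in> G \<longrightarrow> c \<ominus>\<^bsub>C n\<^esub> x \<odot>\<^bsub>C n\<^esub> w \<in> coboundaries C d n)"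
  using x
proof induction
  note CD = cochain_complexD[OF C]
  interpret C0: module R "C n" by (rule CD)
  interpret C1: module R "C (Suc n)" by (rule CD)
  interpret S: module R "direct_sum (C n) (C (Suc n))" by (rule module_direct_sum[OF CD(1,1)])
  note B0 = C0.submoduleE[OF submodule_coboundaries[OF C]]
  note B1 = C1.submoduleE[OF submodule_coboundaries[OF C]]
  note Z1 = C1.submoduleE[OF submodule_cocycles[OF C]]
  have Dc: "c \<in> carrier (C (Suc n))" if "c \<in> D" for c using that Z1(1) by (auto simp: D_def)
  have Dadd: "c \<oplus>\<^bsub>C (Suc n)\<^esub> k \<in> D" if "c \<in> D" "k \<in> D" for c k
    using that Dc[OF that(1)] Dc[OF that(2)] Z1(5) B1(5) ideal.Icarr[OF J]
    by (auto simp: D_def C1.smult_r_distr)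
  have Dsm: "r \<odot>\<^bsub>C (Suc n)\<^esub> c \<in> D" if "r \<in> carrier R" "c \<in> D" for r c
  proof -
    have "b \<odot>\<^bsub>C (Suc n)\<^esub> (r \<odot>\<^bsub>C (Suc n)\<^esub> c) = r \<odot>\<^bsub>C (Suc n)\<^esub> (b \<odot>\<^bsub>C (Suc n)\<^esub> c)" if "b \<in> J" for b
      using \<open>r \<in> carrier R\<close> Dc[OF \<open>c \<in> D\<close>] ideal.Icarr[OF J that]
      by (simp add: C0.R.m_comm flip: C1.smult_assoc1)
    then show ?thesis using that Z1(4) B1(4) by (auto simp: D_def)
  qed
  {
    case (prod a b)
    note aR = ideal.Icarr[OF I prod(1)] and bR = ideal.Icarr[OF J prod(2)]
    define G where "G = {(a \<odot>\<^bsub>C n\<^esub> s, c) | s c. s \<in> carrier (C n) \<and> c \<in> D \<and> d n s = b \<odot>\<^bsub>C (Suc n)\<^esub> c}"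
    have GI: "(a \<odot>\<^bsub>C n\<^esub> s, c) \<in> G" if "s \<in> carrier (C n)" "c \<in> D" "d n s = b \<odot>\<^bsub>C (Suc n)\<^esub> c" for s c
      using that unfolding G_def by blast
    have "\<exists>s. (a \<odot>\<^bsub>C n\<^esub> s, c) \<in> G" if c: "c \<in> D" for c
    proof -
      have "b \<odot>\<^bsub>C (Suc n)\<^esub> c \<in> d n ` carrier (C n)" using c prod(2) by (simp add: D_def)
      then obtain s where "s \<in> carrier (C n)" "d n s = b \<odot>\<^bsub>C (Suc n)\<^esub> c" by auto
      then show ?thesis using GI c by blast
    qed
    then have "D \<subseteq> snd ` G" by (metis image_eqI snd_conv subsetI)
    moreover have "snd ` G \<subseteq> D" by (auto simp: G_def)
    ultimately have sndG: "snd ` G = D" by (rule equalityI[rotated])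
    have "submodule G R (direct_sum (C n) (C (Suc n)))"
    proof (rule S.submoduleI_nonempty)
      show "G \<subseteq> carrier (direct_sum (C n) (C (Suc n)))" using aR Dc by (auto simp: G_def)
      have "\<zero>\<^bsub>C (Suc n)\<^esub> \<in> D"
        using ideal.Icarr[OF J] C1.submodule_zero[OF submodule_cocycles[OF C]]
          C1.submodule_zero[OF submodule_coboundaries[OF C]] by (auto simp: D_def)
      then show "G \<noteq> {}" using sndG by blast
      fix g h assume "g \<in> G" "h \<in> G"
      then obtain s c t k where g: "g = (a \<odot>\<^bsub>C n\<^esub> s, c)" "s \<in> carrier (C n)" "c \<in> D" "d n s = b \<odot>\<^bsub>C (Suc n)\<^esub> c"
        and h: "h = (a \<odot>\<^bsub>C n\<^esub> t, k)" "t \<in> carrier (C n)" "k \<in> D" "d n t = b \<odot>\<^bsub>C (Suc n)\<^esub> k"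
        unfolding G_def by blast
      have "d n (s \<oplus>\<^bsub>C n\<^esub> t) = b \<odot>\<^bsub>C (Suc n)\<^esub> (c \<oplus>\<^bsub>C (Suc n)\<^esub> k)"
        using mod_hom_add[OF CD(2) g(2) h(2)] g(4) h(4) bR Dc[OF g(3)] Dc[OF h(3)]
        by (simp add: C1.smult_r_distr)
      from GI[OF _ Dadd[OF g(3) h(3)] this] show "g \<oplus>\<^bsub>direct_sum (C n) (C (Suc n))\<^esub> h \<in> G"
        using g(1,2) h(1,2) aR by (simp add: C0.smult_r_distr)
    next
      fix r g assume r: "r \<in> carrier R" and "g \<in> G"
      then obtain s c where g: "g = (a \<odot>\<^bsub>C n\<^esub> s, c)" "s \<in> carrier (C n)" "c \<in> D" "d n s = b \<odot>\<^bsub>C (Suc n)\<^esub> c"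
        unfolding G_def by blast
      have "d n (r \<odot>\<^bsub>C n\<^esub> s) = b \<odot>\<^bsub>C (Suc n)\<^esub> (r \<odot>\<^bsub>C (Suc n)\<^esub> c)"
        using mod_hom_smult[OF CD(2) r g(2)] g(4) bR r Dc[OF g(3)]
        by (simp add: C0.R.m_comm flip: C1.smult_assoc1)
      from GI[OF _ Dsm[OF r g(3)] this] show "r \<odot>\<^bsub>direct_sum (C n) (C (Suc n))\<^esub> g \<in> G"
        using g(1,2) aR r by (simp add: C0.R.m_comm flip: C0.smult_assoc1)
    qed
    moreover have "d n c = (a \<otimes>\<^bsub>R\<^esub> b) \<odot>\<^bsub>C (Suc n)\<^esub> c'" if "(c, c') \<in> G" for c c'
    proof -
      obtain s where s: "c = a \<odot>\<^bsub>C n\<^esub> s" "s \<in> carrier (C n)" "c' \<in> D" "d n s = b \<odot>\<^bsub>C (Suc n)\<^esub> c'"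
        using \<open>(c, c') \<in> G\<close> unfolding G_def by blast
      then show ?thesis
        using mod_hom_smult[OF CD(2) aR s(2)] aR bR Dc[OF s(3)] by (simp add: C1.smult_assoc1)
    qed
    moreover have "c \<ominus>\<^bsub>C n\<^esub> (a \<otimes>\<^bsub>R\<^esub> b) \<odot>\<^bsub>C n\<^esub> w \<in> coboundaries C d n"
      if w: "w \<in> carrier (C n)" and cw: "(c, d n w) \<in> G" for w c
    proof -
      obtain s where s: "c = a \<odot>\<^bsub>C n\<^esub> s" "s \<in> carrier (C n)" "d n s = b \<odot>\<^bsub>C (Suc n)\<^esub> d n w"
        using cw unfolding G_def by blast
      define z where "z = s \<ominus>\<^bsub>C n\<^esub> b \<odot>\<^bsub>C n\<^esub> w"
      have "d n z = \<zero>\<^bsub>C (Suc n)\<^esub>"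
        using mod_hom_diff[OF CD(1,1,2) s(2), of "b \<odot>\<^bsub>C n\<^esub> w"] mod_hom_smult[OF CD(2) bR w] s(3) bR w
          mod_hom_closed[OF CD(2) w]
        by (simp add: z_def C1.M.minus_eq C1.M.r_neg)
      then have "z \<in> cocycles C d n" using s(2) bR w by (simp add: z_def cocycles_def)
      then have "a \<odot>\<^bsub>C n\<^esub> z \<in> coboundaries C d n" by (rule kill[OF prod(1)])
      moreover have "a \<odot>\<^bsub>C n\<^esub> z = c \<ominus>\<^bsub>C n\<^esub> (a \<otimes>\<^bsub>R\<^esub> b) \<odot>\<^bsub>C n\<^esub> w"
        using s(1,2) aR bR w
        by (simp add: z_def C0.M.minus_eq C0.smult_r_distr C0.smult_r_minus C0.smult_assoc1)
      ultimately show ?thesis by simp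
    qed
    ultimately show ?case using sndG by blast
  next
    case (sum x y)
    have xR: "x \<in> carrier R" and yR: "y \<in> carrier R"
      using sum.hyps C0.R.ideal_prod_in_carrier[OF I J] by auto
    obtain G where G: "submodule G R (direct_sum (C n) (C (Suc n)))" "snd ` G = D"
      "\<And>c c'. (c, c') \<in> G \<Longrightarrow> d n c = x \<odot>\<^bsub>C (Suc n)\<^esub> c'"
      "\<And>w c. w \<in> carrier (C n) \<Longrightarrow> (c, d n w) \<in> G \<Longrightarrow> c \<ominus>\<^bsub>C n\<^esub> x \<odot>\<^bsub>C n\<^esub> w \<in> coboundaries C d n"
      using sum.IH(1) by blast
    obtain H where H: "submodule H R (direct_sum (C n) (C (Suc n)))" "snd ` H = D"
      "\<And>c c'. (c, c') \<in> H \<Longrightarrow> d n c = y \<odot>\<^bsub>C (Suc n)\<^esub> c'"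
      "\<And>w c. w \<in> carrier (C n) \<Longrightarrow> (c, d n w) \<in> H \<Longrightarrow> c \<ominus>\<^bsub>C n\<^esub> y \<odot>\<^bsub>C n\<^esub> w \<in> coboundaries C d n"
      using sum.IH(2) by blast
    note GE = S.submoduleE[OF G(1)] and HE = S.submoduleE[OF H(1)]
    define F where "F = {(c \<oplus>\<^bsub>C n\<^esub> k, c') | c k c'. (c, c') \<in> G \<and> (k, c') \<in> H}"
    have FI: "(c \<oplus>\<^bsub>C n\<^esub> k, c') \<in> F" if "(c, c') \<in> G" "(k, c') \<in> H" for c k c'
      using that unfolding F_def by blast
    have Gc: "c \<in> carrier (C n)" "c' \<in> carrier (C (Suc n))" if "(c, c') \<in> G" for c c'
      using that GE(1) by auto
    have Hc: "c \<in> carrier (C n)" if "(c, c') \<in> H" for c c'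
      using that HE(1) by auto
    have "\<exists>c. (c, c') \<in> F" if "c' \<in> D" for c'
    proof -
      have "c' \<in> snd ` G" "c' \<in> snd ` H" using that G(2) H(2) by simp_all
      then obtain c k where "(c, c') \<in> G" "(k, c') \<in> H" by auto
      then show ?thesis using FI by blast
    qed
    moreover have "c' \<in> D" if "(c, c') \<in> F" for c c'
    proof -
      obtain k where "(k, c') \<in> G" using \<open>(c, c') \<in> F\<close> unfolding F_def by blast
      then show ?thesis using G(2) by (metis image_eqI snd_conv)
    qed
    ultimately have "D \<subseteq> snd ` F" "snd ` F \<subseteq> D" by (metis image_eqI snd_conv subsetI, auto)
    then have sndF: "snd ` F = D" by (rule equalityI[rotated])
    have "submodule F R (direct_sum (C n) (C (Suc n)))"
    proof (rule S.submoduleI_nonempty)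
      show "F \<subseteq> carrier (direct_sum (C n) (C (Suc n)))" using Gc Hc by (auto simp: F_def)
      show "F \<noteq> {}" using sndF G(2) GE(2) by blast
      fix f g assume "f \<in> F" "g \<in> F"
      then obtain c k c' l m l' where f: "f = (c \<oplus>\<^bsub>C n\<^esub> k, c')" "(c, c') \<in> G" "(k, c') \<in> H"
        and g: "g = (l \<oplus>\<^bsub>C n\<^esub> m, l')" "(l, l') \<in> G" "(m, l') \<in> H"
        unfolding F_def by blast
      have "(c \<oplus>\<^bsub>C n\<^esub> l, c' \<oplus>\<^bsub>C (Suc n)\<^esub> l') \<in> G" "(k \<oplus>\<^bsub>C n\<^esub> m, c' \<oplus>\<^bsub>C (Suc n)\<^esub> l') \<in> H"
        using GE(5)[OF f(2) g(2)] HE(5)[OF f(3) g(3)] by simp_all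
      from FI[OF this] show "f \<oplus>\<^bsub>direct_sum (C n) (C (Suc n))\<^esub> g \<in> F"
        using f(1) g(1) Gc(1)[OF f(2)] Gc(1)[OF g(2)] Hc[OF f(3)] Hc[OF g(3)] by (simp add: C0.M.a_ac)
    next
      fix r f assume r: "r \<in> carrier R" and "f \<in> F"
      then obtain c k c' where f: "f = (c \<oplus>\<^bsub>C n\<^esub> k, c')" "(c, c') \<in> G" "(k, c') \<in> H"
        unfolding F_def by blast
      have "(r \<odot>\<^bsub>C n\<^esub> c, r \<odot>\<^bsub>C (Suc n)\<^esub> c') \<in> G" "(r \<odot>\<^bsub>C n\<^esub> k, r \<odot>\<^bsub>C (Suc n)\<^esub> c') \<in> H"
        using GE(4)[OF r f(2)] HE(4)[OF r f(3)] by simp_all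
      from FI[OF this] show "r \<odot>\<^bsub>direct_sum (C n) (C (Suc n))\<^esub> f \<in> F"
        using f(1) r Gc(1)[OF f(2)] Hc[OF f(3)] by (simp add: C0.smult_r_distr)
    qed
    moreover have "d n c = (x \<oplus>\<^bsub>R\<^esub> y) \<odot>\<^bsub>C (Suc n)\<^esub> c'" if "(c, c') \<in> F" for c c'
    proof -
      obtain k l where kl: "c = k \<oplus>\<^bsub>C n\<^esub> l" "(k, c') \<in> G" "(l, c') \<in> H"
        using \<open>(c, c') \<in> F\<close> unfolding F_def by blast
      then show ?thesis
        using mod_hom_add[OF CD(2) Gc(1)[OF kl(2)] Hc[OF kl(3)]] G(3)[OF kl(2)] H(3)[OF kl(3)]
          xR yR Gc(2)[OF kl(2)] by (simp add: C1.smult_l_distr)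
    qed
    moreover have "c \<ominus>\<^bsub>C n\<^esub> (x \<oplus>\<^bsub>R\<^esub> y) \<odot>\<^bsub>C n\<^esub> w \<in> coboundaries C d n"
      if w: "w \<in> carrier (C n)" and cw: "(c, d n w) \<in> F" for w c
    proof -
      obtain k l where kl: "c = k \<oplus>\<^bsub>C n\<^esub> l" "(k, d n w) \<in> G" "(l, d n w) \<in> H"
        using cw unfolding F_def by blast
      have "(k \<ominus>\<^bsub>C n\<^esub> x \<odot>\<^bsub>C n\<^esub> w) \<oplus>\<^bsub>C n\<^esub> (l \<ominus>\<^bsub>C n\<^esub> y \<odot>\<^bsub>C n\<^esub> w) \<in> coboundaries C d n"
        by (rule B0(5)[OF G(4)[OF w kl(2)] H(4)[OF w kl(3)]])
      moreover have "(k \<ominus>\<^bsub>C n\<^esub> x \<odot>\<^bsub>C n\<^esub> w) \<oplus>\<^bsub>C n\<^esub> (l \<ominus>\<^bsub>C n\<^esub> y \<odot>\<^bsub>C n\<^esub> w) = c \<ominus>\<^bsub>C n\<^esub> (x \<oplus>\<^bsub>R\<^esub> y) \<odot>\<^bsub>C n\<^esub> w"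
        using kl(1) Gc(1)[OF kl(2)] Hc[OF kl(3)] w xR yR
        by (simp add: C0.smult_l_distr C0.M.diff_simps)
      ultimately show ?thesis by simp
    qed
    ultimately show ?case using sndF by blast
  }
qed

lemma cone_cohomology_splits:
  fixes C :: "nat \<Rightarrow> ('a, 'c) module" and C' :: "nat \<Rightarrow> ('a, 'd) module"
  assumes C: "cochain_complex R C d" and C': "cochain_complex R C' d'"
    and I: "ideal I R" and x: "x \<in> ideal_prod R I I"
    and kill: "annihilates I (cohomology C d n)"
    and \<phi>: "\<phi> \<in> mod_hom R (direct_sum (C (Suc n)) (C n)) (C' n)"
    and cocycle: "\<And>u v. u \<in> carrier (C (Suc n)) \<Longrightarrow> v \<in> carrier (C n) \<Longrightarrow>
      d (Suc n) u = \<zero>\<^bsub>C (Suc (Suc n))\<^esub> \<Longrightarrow> x \<odot>\<^bsub>C (Suc n)\<^esub> u = d n v \<Longrightarrow>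
      d' n (\<phi> (u, v)) = \<zero>\<^bsub>C' (Suc n)\<^esub>"
    and coboundary: "\<And>w b. w \<in> carrier (C n) \<Longrightarrow> b \<in> coboundaries C d n \<Longrightarrow>
      \<phi> (d n w, x \<odot>\<^bsub>C n\<^esub> w \<oplus>\<^bsub>C n\<^esub> b) \<in> coboundaries C' d' n"
    and onto: "\<And>z. z \<in> cocycles C' d' n \<Longrightarrow> \<exists>u\<in>carrier (C (Suc n)). \<exists>v\<in>carrier (C n).
      \<exists>b\<in>coboundaries C' d' n. d (Suc n) u = \<zero>\<^bsub>C (Suc (Suc n))\<^esub> \<and>
        x \<odot>\<^bsub>C (Suc n)\<^esub> u = d n v \<and> z = \<phi> (u, v) \<oplus>\<^bsub>C' n\<^esub> b"
    and inj: "\<And>u v. u \<in> carrier (C (Suc n)) \<Longrightarrow> v \<in> carrier (C n) \<Longrightarrow>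
      d (Suc n) u = \<zero>\<^bsub>C (Suc (Suc n))\<^esub> \<Longrightarrow> x \<odot>\<^bsub>C (Suc n)\<^esub> u = d n v \<Longrightarrow>
      \<phi> (u, v) \<in> coboundaries C' d' n \<Longrightarrow>
      \<exists>w\<in>carrier (C n). \<exists>b\<in>coboundaries C d n. u = d n w \<and> v = x \<odot>\<^bsub>C n\<^esub> w \<oplus>\<^bsub>C n\<^esub> b"
  shows "mod_isomorphic R (zero_colon (cohomology C' d' n) I)
      (direct_sum (cohomology C d n) (zero_colon (cohomology C d (Suc n)) I))" (is ?iso)
    and "annihilates I (cohomology C d (Suc n)) \<Longrightarrow> annihilates I (cohomology C' d' n)" (is "?A \<Longrightarrow> ?A'")
proof -
  note CD = cochain_complexD[OF C] and CD' = cochain_complexD[OF C']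
  interpret C0: module R "C n" by (rule CD)
  interpret C1: module R "C (Suc n)" by (rule CD)
  interpret F: module R "C' n" by (rule CD')
  note B0 = C0.submoduleE[OF submodule_coboundaries[OF C]]
  note B1 = C1.submoduleE[OF submodule_coboundaries[OF C]]
  note B' = F.submoduleE[OF submodule_coboundaries[OF C']]
  note Z0 = C0.submoduleE[OF submodule_cocycles[OF C]]
  note Z1 = C1.submoduleE[OF submodule_cocycles[OF C]]
  note Z' = F.submoduleE[OF submodule_cocycles[OF C']]
  define cls where "cls = cohomology_class C d n"
  define cls1 where "cls1 = cohomology_class C d (Suc n)"
  define cls' where "cls' = cohomology_class C' d' n"
  note H0 = cohomology_class[OF C, where n = n, folded cls_def]
  note H1 = cohomology_class[OF C, where n = "Suc n", folded cls1_def]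
  note H' = cohomology_class[OF C', where n = n, folded cls'_def]
  have IR: "a \<in> carrier R" if "a \<in> I" for a by (rule ideal.Icarr[OF I that])
  have xR: "x \<in> carrier R" using x C0.R.ideal_prod_in_carrier[OF I I] by blast
  have sm0: "a \<odot>\<^bsub>cohomology C d n\<^esub> cls z = \<zero>\<^bsub>cohomology C d n\<^esub> \<longleftrightarrow> a \<odot>\<^bsub>C n\<^esub> z \<in> coboundaries C d n"
    if "a \<in> carrier R" "z \<in> cocycles C d n" for a z
    using mod_hom_smult[OF H0(2), of a z] H0(5)[of "a \<odot>\<^bsub>C n\<^esub> z"] that Z0(4) by simp
  have sm1: "a \<odot>\<^bsub>cohomology C d (Suc n)\<^esub> cls1 z = \<zero>\<^bsub>cohomology C d (Suc n)\<^esub> \<longleftrightarrow>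
      a \<odot>\<^bsub>C (Suc n)\<^esub> z \<in> coboundaries C d (Suc n)"
    if "a \<in> carrier R" "z \<in> cocycles C d (Suc n)" for a z
    using mod_hom_smult[OF H1(2), of a z] H1(5)[of "a \<odot>\<^bsub>C (Suc n)\<^esub> z"] that Z1(4) by simp
  have sm': "a \<odot>\<^bsub>cohomology C' d' n\<^esub> cls' z = \<zero>\<^bsub>cohomology C' d' n\<^esub> \<longleftrightarrow>
      a \<odot>\<^bsub>C' n\<^esub> z \<in> coboundaries C' d' n"
    if "a \<in> carrier R" "z \<in> cocycles C' d' n" for a z
    using mod_hom_smult[OF H'(2), of a z] H'(5)[of "a \<odot>\<^bsub>C' n\<^esub> z"] that Z'(4) by simp
  have kill': "a \<odot>\<^bsub>C n\<^esub> z \<in> coboundaries C d n" if "a \<in> I" "z \<in> cocycles C d n" for a z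
    using kill that H0(3) sm0[OF IR[OF that(1)] that(2)] by (auto simp: annihilates_def)
  define D where "D = {c \<in> cocycles C d (Suc n). \<forall>b\<in>I. b \<odot>\<^bsub>C (Suc n)\<^esub> c \<in> coboundaries C d (Suc n)}"
  obtain G where G: "submodule G R (direct_sum (C n) (C (Suc n)))" and sndG: "snd ` G = D"
    and Gd: "\<And>c c'. (c, c') \<in> G \<Longrightarrow> d n c = x \<odot>\<^bsub>C (Suc n)\<^esub> c'"
    and Gu: "\<And>w c. w \<in> carrier (C n) \<Longrightarrow> (c, d n w) \<in> G \<Longrightarrow> c \<ominus>\<^bsub>C n\<^esub> x \<odot>\<^bsub>C n\<^esub> w \<in> coboundaries C d n"
    using splitting_relation[OF C I I kill' x D_def] by blast
  have S: "module R (direct_sum (C n) (C (Suc n)))" by (rule module_direct_sum[OF CD(1,1)])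
  interpret S: module R "direct_sum (C n) (C (Suc n))" by (rule S)
  note GE = S.submoduleE[OF G]
  have Gc: "c \<in> carrier (C n)" "c' \<in> carrier (C (Suc n))" "c' \<in> D" if "(c, c') \<in> G" for c c'
    using that GE(1) sndG by force+
  define U where "U = (direct_sum (C n) (direct_sum (C n) (C (Suc n))))\<lparr>carrier := cocycles C d n \<times> G\<rparr>"
  have U: "module R U"
    unfolding U_def
    by (intro submodule_module module_direct_sum CD S submodule_Times submodule_cocycles C G)
  interpret U: module R U by (rule U)
  have Uc: "carrier U = cocycles C d n \<times> G" by (simp add: U_def)
  have Uadd: "(z, c, c') \<oplus>\<^bsub>U\<^esub> (y, k, k') = (z \<oplus>\<^bsub>C n\<^esub> y, c \<oplus>\<^bsub>C n\<^esub> k, c' \<oplus>\<^bsub>C (Suc n)\<^esub> k')" for z c c' y k k'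
    by (simp add: U_def)
  have Usm: "r \<odot>\<^bsub>U\<^esub> (z, c, c') = (r \<odot>\<^bsub>C n\<^esub> z, r \<odot>\<^bsub>C n\<^esub> c, r \<odot>\<^bsub>C (Suc n)\<^esub> c')" for r z c c'
    by (simp add: U_def)
  define \<psi> where "\<psi> = (\<lambda>(z, c, c'). \<phi> (c', z \<oplus>\<^bsub>C n\<^esub> c))"
  have mem: "z \<in> carrier (C n)" "d n z = \<zero>\<^bsub>C (Suc n)\<^esub>" if "z \<in> cocycles C d n" for z
    using that by (auto simp: cocycles_def)
  have \<psi>: "\<psi> \<in> mod_hom R U (cocycle_module C' d' n)"
  proof (rule mod_hom_corestrict)
    show "\<psi> \<in> mod_hom R U (C' n)"
    proof (rule mod_homI)
      fix s t assume "s \<in> carrier U" "t \<in> carrier U"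
      then obtain z c c' y k k' where st: "s = (z, c, c')" "z \<in> cocycles C d n" "(c, c') \<in> G"
        "t = (y, k, k')" "y \<in> cocycles C d n" "(k, k') \<in> G"
        by (auto simp: Uc)
      show "\<psi> (s \<oplus>\<^bsub>U\<^esub> t) = \<psi> s \<oplus>\<^bsub>C' n\<^esub> \<psi> t"
        using mod_hom_add[OF \<phi>, of "(c', z \<oplus>\<^bsub>C n\<^esub> c)" "(k', y \<oplus>\<^bsub>C n\<^esub> k)"] st
          mem(1)[OF st(2)] mem(1)[OF st(5)] Gc[OF st(3)] Gc[OF st(6)]
        by (simp add: \<psi>_def Uadd C0.M.a_ac)
    next
      fix r s assume r: "r \<in> carrier R" and "s \<in> carrier U"
      then obtain z c c' where s: "s = (z, c, c')" "z \<in> cocycles C d n" "(c, c') \<in> G"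
        by (auto simp: Uc)
      show "\<psi> (r \<odot>\<^bsub>U\<^esub> s) = r \<odot>\<^bsub>C' n\<^esub> \<psi> s"
        using mod_hom_smult[OF \<phi> r, of "(c', z \<oplus>\<^bsub>C n\<^esub> c)"] s mem(1)[OF s(2)] Gc[OF s(3)] r
        by (simp add: \<psi>_def Usm C0.smult_r_distr)
    qed (auto simp: Uc \<psi>_def mem(1) Gc(1,2) intro!: mod_hom_closed[OF \<phi>])
    fix s assume "s \<in> carrier U"
    then obtain z c c' where s: "s = (z, c, c')" "z \<in> cocycles C d n" "(c, c') \<in> G"
      by (auto simp: Uc)
    note c = Gc[OF s(3)] and z = mem[OF s(2)]
    have "d n (z \<oplus>\<^bsub>C n\<^esub> c) = x \<odot>\<^bsub>C (Suc n)\<^esub> c'"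
      using mod_hom_add[OF CD(2) z(1) c(1)] z(2) Gd[OF s(3)] c(2) xR by simp
    moreover have "d (Suc n) c' = \<zero>\<^bsub>C (Suc (Suc n))\<^esub>" using c(3) by (simp add: D_def cocycles_def)
    ultimately have "d' n (\<phi> (c', z \<oplus>\<^bsub>C n\<^esub> c)) = \<zero>\<^bsub>C' (Suc n)\<^esub>"
      using cocycle[of c' "z \<oplus>\<^bsub>C n\<^esub> c"] c z(1) by simp
    then show "\<psi> s \<in> cocycles C' d' n"
      using s(1) c z(1) by (auto simp: \<psi>_def cocycles_def intro!: mod_hom_closed[OF \<phi>])
  qed
  have key: "\<psi> s \<in> coboundaries C' d' n \<longleftrightarrow>
      fst s \<in> coboundaries C d n \<and> snd (snd s) \<in> coboundaries C d (Suc n)"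
    if sU: "s \<in> carrier U" for s
  proof -
    obtain z c c' where s: "s = (z, c, c')" "z \<in> cocycles C d n" "(c, c') \<in> G"
      using sU by (auto simp: Uc)
    note c = Gc[OF s(3)] and z = mem[OF s(2)]
    show ?thesis
    proof
      assume "\<psi> s \<in> coboundaries C' d' n"
      then have "\<phi> (c', z \<oplus>\<^bsub>C n\<^esub> c) \<in> coboundaries C' d' n" by (simp add: s(1) \<psi>_def)
      moreover have "x \<odot>\<^bsub>C (Suc n)\<^esub> c' = d n (z \<oplus>\<^bsub>C n\<^esub> c)"
        using mod_hom_add[OF CD(2) z(1) c(1)] z(2) Gd[OF s(3)] c(2) xR by simp
      moreover have "d (Suc n) c' = \<zero>\<^bsub>C (Suc (Suc n))\<^esub>" using c(3) by (simp add: D_def cocycles_def)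
      ultimately obtain w b where w: "w \<in> carrier (C n)" "c' = d n w"
        and b: "b \<in> coboundaries C d n" "z \<oplus>\<^bsub>C n\<^esub> c = x \<odot>\<^bsub>C n\<^esub> w \<oplus>\<^bsub>C n\<^esub> b"
        using inj[of c' "z \<oplus>\<^bsub>C n\<^esub> c"] c z(1) by auto
      have bc: "b \<in> carrier (C n)" using b(1) B0(1) by blast
      have cB: "c \<ominus>\<^bsub>C n\<^esub> x \<odot>\<^bsub>C n\<^esub> w \<in> coboundaries C d n" using Gu[OF w(1)] s(3) w(2) by simp
      have "z = (z \<oplus>\<^bsub>C n\<^esub> c) \<ominus>\<^bsub>C n\<^esub> c" using z(1) c(1) by (simp add: C0.M.diff_simps)
      also have "\<dots> = b \<ominus>\<^bsub>C n\<^esub> (c \<ominus>\<^bsub>C n\<^esub> x \<odot>\<^bsub>C n\<^esub> w)"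
        unfolding b(2) using bc w(1) c(1) xR by (simp add: C0.M.diff_simps)
      also have "\<dots> \<in> coboundaries C d n"
        by (rule C0.submodule_diff[OF submodule_coboundaries[OF C] b(1) cB])
      finally show "fst s \<in> coboundaries C d n \<and> snd (snd s) \<in> coboundaries C d (Suc n)"
        using s(1) w by simp
    next
      assume "fst s \<in> coboundaries C d n \<and> snd (snd s) \<in> coboundaries C d (Suc n)"
      then obtain w where zB: "z \<in> coboundaries C d n" and w: "w \<in> carrier (C n)" "c' = d n w"
        using s(1) by auto
      have cB: "c \<ominus>\<^bsub>C n\<^esub> x \<odot>\<^bsub>C n\<^esub> w \<in> coboundaries C d n" using Gu[OF w(1)] s(3) w(2) by simp
      have "z \<oplus>\<^bsub>C n\<^esub> c = x \<odot>\<^bsub>C n\<^esub> w \<oplus>\<^bsub>C n\<^esub> (z \<oplus>\<^bsub>C n\<^esub> (c \<ominus>\<^bsub>C n\<^esub> x \<odot>\<^bsub>C n\<^esub> w))"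
        using z(1) c(1) w(1) xR by (simp add: C0.M.diff_simps)
      then show "\<psi> s \<in> coboundaries C' d' n"
        using coboundary[OF w(1) B0(5)[OF zB cB]] w(2) by (simp add: s(1) \<psi>_def)
    qed
  qed
  define p where "p s = cls' (\<psi> s)" for s
  define q where "q s = (cls (fst s), cls1 (snd (snd s)))" for s :: "'c \<times> 'c \<times> 'c"
  have fstU: "fst \<in> mod_hom R U (cocycle_module C d n)"
    by (rule mod_homI) (auto simp: Uc Uadd Usm)
  have sndU: "(\<lambda>s. snd (snd s)) \<in> mod_hom R U (cocycle_module C d (Suc n))"
    by (rule mod_homI) (auto simp: Uc Uadd Usm D_def dest: Gc(3))
  have p: "p \<in> mod_hom R U (cohomology C' d' n)"
    unfolding p_def by (rule mod_hom_compose[OF \<psi> H'(2)])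
  have pI: "a \<odot>\<^bsub>cohomology C' d' n\<^esub> p s = \<zero>\<^bsub>cohomology C' d' n\<^esub>" if a: "a \<in> I" and sU: "s \<in> carrier U" for a s
  proof -
    obtain z c c' where s: "s = (z, c, c')" "z \<in> cocycles C d n" "(c, c') \<in> G"
      using sU by (auto simp: Uc)
    have "a \<odot>\<^bsub>U\<^esub> s \<in> carrier U" using sU IR[OF a] by simp
    moreover have "a \<odot>\<^bsub>C n\<^esub> z \<in> coboundaries C d n" by (rule kill'[OF a s(2)])
    moreover have "a \<odot>\<^bsub>C (Suc n)\<^esub> c' \<in> coboundaries C d (Suc n)"
      using Gc(3)[OF s(3)] a by (simp add: D_def)
    ultimately have "\<psi> (a \<odot>\<^bsub>U\<^esub> s) \<in> coboundaries C' d' n" using key s(1) by (simp add: Usm)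
    then have "a \<odot>\<^bsub>C' n\<^esub> \<psi> s \<in> coboundaries C' d' n" using mod_hom_smult[OF \<psi> IR[OF a] sU] by simp
    then show ?thesis using sm'[OF IR[OF a]] mod_hom_closed[OF \<psi> sU] by (simp add: p_def)
  qed
  have lift: "\<exists>s\<in>carrier U. p s = cls' (\<phi> (u, v) \<oplus>\<^bsub>C' n\<^esub> b)"
    if u: "u \<in> D" and v: "v \<in> carrier (C n)" and xu: "x \<odot>\<^bsub>C (Suc n)\<^esub> u = d n v"
      and b: "b \<in> coboundaries C' d' n" for u v b
  proof -
    obtain c where c: "(c, u) \<in> G" using u sndG by auto
    note c' = Gc[OF c]
    have "d n (v \<ominus>\<^bsub>C n\<^esub> c) = \<zero>\<^bsub>C (Suc n)\<^esub>"
      using mod_hom_diff[OF CD(1,1,2) v c'(1)] Gd[OF c] xu mod_hom_closed[OF CD(2) v]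
      by (simp add: C1.M.minus_eq C1.M.r_neg)
    then have z: "v \<ominus>\<^bsub>C n\<^esub> c \<in> cocycles C d n" using v c' by (simp add: cocycles_def)
    then have sU: "(v \<ominus>\<^bsub>C n\<^esub> c, c, u) \<in> carrier U" using c by (simp add: Uc)
    have \<psi>s: "\<psi> (v \<ominus>\<^bsub>C n\<^esub> c, c, u) = \<phi> (u, v)" using v c' by (simp add: \<psi>_def C0.M.diff_simps)
    then have \<phi>Z: "\<phi> (u, v) \<in> cocycles C' d' n" using mod_hom_closed[OF \<psi> sU] by simp
    have bZ: "b \<in> cocycles C' d' n" using coboundaries_subset_cocycles[OF C'] b by blast
    interpret Z: module R "cocycle_module C' d' n" by (rule H')
    have "(\<phi> (u, v) \<oplus>\<^bsub>C' n\<^esub> b) \<ominus>\<^bsub>cocycle_module C' d' n\<^esub> \<phi> (u, v) = b"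
      using Z.M.add_diff_cancel_left[of "\<phi> (u, v)" b] \<phi>Z bZ by simp
    then have "cls' (\<phi> (u, v) \<oplus>\<^bsub>C' n\<^esub> b) = cls' (\<phi> (u, v))"
      using H'(4)[OF Z'(5)[OF \<phi>Z bZ] \<phi>Z] b by simp
    then show ?thesis using sU \<psi>s by (intro bexI[of _ "(v \<ominus>\<^bsub>C n\<^esub> c, c, u)"]) (auto simp: p_def)
  qed
  show ?iso
  proof (rule mod_isomorphic_span[OF _ _ U])
    show "p \<in> mod_hom R U (zero_colon (cohomology C' d' n) I)"
      unfolding zero_colon_def
      by (rule mod_hom_corestrict[OF p]) (use mod_hom_closed[OF p] pI in auto)
    have q1: "a \<odot>\<^bsub>cohomology C d (Suc n)\<^esub> cls1 (snd (snd s)) = \<zero>\<^bsub>cohomology C d (Suc n)\<^esub>"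
      if "a \<in> I" "s \<in> carrier U" for a s
    proof -
      have "snd (snd s) \<in> D" using that(2) Gc(3) by (auto simp: Uc)
      then show ?thesis using sm1[OF IR[OF that(1)]] that(1) by (simp add: D_def)
    qed
    show "q \<in> mod_hom R U (direct_sum (cohomology C d n) (zero_colon (cohomology C d (Suc n)) I))"
      unfolding q_def zero_colon_def
      by (intro mod_hom_Pair mod_hom_corestrict mod_hom_compose[OF fstU H0(2)] mod_hom_compose[OF sndU H1(2)])
         (use q1 mod_hom_closed[OF mod_hom_compose[OF sndU H1(2)]] in auto)
    then have qsub: "q ` carrier U \<subseteq> carrier (direct_sum (cohomology C d n) (zero_colon (cohomology C d (Suc n)) I))"
      by (intro image_subsetI) (rule mod_hom_closed)
    show "q ` carrier U = carrier (direct_sum (cohomology C d n) (zero_colon (cohomology C d (Suc n)) I))"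
    proof (rule equalityI[OF qsub], rule subsetI)
      fix y assume "y \<in> carrier (direct_sum (cohomology C d n) (zero_colon (cohomology C d (Suc n)) I))"
      then obtain z c' where z: "z \<in> cocycles C d n" and c': "c' \<in> cocycles C d (Suc n)"
        and y: "y = (cls z, cls1 c')"
        and "\<forall>a\<in>I. a \<odot>\<^bsub>cohomology C d (Suc n)\<^esub> cls1 c' = \<zero>\<^bsub>cohomology C d (Suc n)\<^esub>"
        by (auto simp: zero_colon_def H0(3) H1(3))
      then have "c' \<in> D" using sm1[OF IR _] c' by (simp add: D_def)
      then obtain c where "(c, c') \<in> G" using sndG by auto
      then have "(z, c, c') \<in> carrier U" using z by (simp add: Uc)
      then show "y \<in> q ` carrier U" using y by (auto simp: q_def intro!: image_eqI)
    qed
    show "p ` carrier U = carrier (zero_colon (cohomology C' d' n) I)"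
    proof (rule equalityI; rule subsetI)
      show "y \<in> carrier (zero_colon (cohomology C' d' n) I)" if "y \<in> p ` carrier U" for y
        using that mod_hom_closed[OF p] pI by (auto simp: zero_colon_def)
      fix y assume "y \<in> carrier (zero_colon (cohomology C' d' n) I)"
      then obtain y0 where y0: "y0 \<in> cocycles C' d' n" "y = cls' y0"
        and "\<And>a. a \<in> I \<Longrightarrow> a \<odot>\<^bsub>cohomology C' d' n\<^esub> cls' y0 = \<zero>\<^bsub>cohomology C' d' n\<^esub>"
        by (auto simp: zero_colon_def H'(3))
      then have ay: "a \<odot>\<^bsub>C' n\<^esub> y0 \<in> coboundaries C' d' n" if "a \<in> I" for a
        using sm'[OF IR[OF that] y0(1)] that by simp
      obtain u v b where uv: "u \<in> carrier (C (Suc n))" "v \<in> carrier (C n)" "b \<in> coboundaries C' d' n"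
        "d (Suc n) u = \<zero>\<^bsub>C (Suc (Suc n))\<^esub>" "x \<odot>\<^bsub>C (Suc n)\<^esub> u = d n v" "y0 = \<phi> (u, v) \<oplus>\<^bsub>C' n\<^esub> b"
        using onto[OF y0(1)] by auto
      have \<phi>c: "\<phi> (u, v) \<in> carrier (C' n)" using mod_hom_closed[OF \<phi>] uv(1,2) by simp
      have bc: "b \<in> carrier (C' n)" using uv(3) B'(1) by blast
      have "a \<odot>\<^bsub>C (Suc n)\<^esub> u \<in> coboundaries C d (Suc n)" if a: "a \<in> I" for a
      proof -
        note aR = IR[OF a]
        have "\<phi> (a \<odot>\<^bsub>C (Suc n)\<^esub> u, a \<odot>\<^bsub>C n\<^esub> v) = a \<odot>\<^bsub>C' n\<^esub> \<phi> (u, v)"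
          using mod_hom_smult[OF \<phi> aR, of "(u, v)"] uv(1,2) by simp
        also have "\<dots> = a \<odot>\<^bsub>C' n\<^esub> y0 \<ominus>\<^bsub>C' n\<^esub> a \<odot>\<^bsub>C' n\<^esub> b"
          unfolding uv(6) using aR \<phi>c bc by (simp add: F.smult_r_distr F.M.diff_simps)
        also have "\<dots> \<in> coboundaries C' d' n"
          by (rule F.submodule_diff[OF submodule_coboundaries[OF C'] ay[OF a] B'(4)[OF aR uv(3)]])
        finally have 1: "\<phi> (a \<odot>\<^bsub>C (Suc n)\<^esub> u, a \<odot>\<^bsub>C n\<^esub> v) \<in> coboundaries C' d' n" .
        have 2: "d (Suc n) (a \<odot>\<^bsub>C (Suc n)\<^esub> u) = \<zero>\<^bsub>C (Suc (Suc n))\<^esub>"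
          using mod_hom_smult[OF CD(2) aR uv(1)] uv(4) module.smult_r_null[OF CD(1) aR] by simp
        have "x \<odot>\<^bsub>C (Suc n)\<^esub> (a \<odot>\<^bsub>C (Suc n)\<^esub> u) = a \<odot>\<^bsub>C (Suc n)\<^esub> (x \<odot>\<^bsub>C (Suc n)\<^esub> u)"
          using aR xR uv(1) by (simp add: C0.R.m_comm flip: C1.smult_assoc1)
        then have 3: "x \<odot>\<^bsub>C (Suc n)\<^esub> (a \<odot>\<^bsub>C (Suc n)\<^esub> u) = d n (a \<odot>\<^bsub>C n\<^esub> v)"
          using mod_hom_smult[OF CD(2) aR uv(2)] uv(5) by simp
        show ?thesis using inj[OF _ _ 2 3 1] aR uv(1,2) by auto
      qed
      then have "u \<in> D" using uv(1,4) by (simp add: D_def cocycles_def)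
      then obtain s where "s \<in> carrier U" "p s = cls' (\<phi> (u, v) \<oplus>\<^bsub>C' n\<^esub> b)"
        using lift uv by blast
      then show "y \<in> p ` carrier U" using y0(2) uv(6) by auto
    qed
    fix s t assume st: "s \<in> carrier U" "t \<in> carrier U"
    define r where "r = s \<ominus>\<^bsub>U\<^esub> t"
    have r: "r \<in> carrier U" using st by (simp add: r_def)
    have "p s = p t \<longleftrightarrow> \<psi> r \<in> coboundaries C' d' n"
      using H'(4)[of "\<psi> s" "\<psi> t"] mod_hom_closed[OF \<psi> st(1)] mod_hom_closed[OF \<psi> st(2)]
        mod_hom_diff[OF U H'(1) \<psi> st] by (simp add: p_def r_def)
    also have "\<dots> \<longleftrightarrow> fst r \<in> coboundaries C d n \<and> snd (snd r) \<in> coboundaries C d (Suc n)"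
      by (rule key[OF r])
    also have "fst r \<in> coboundaries C d n \<longleftrightarrow> cls (fst s) = cls (fst t)"
      using H0(4)[of "fst s" "fst t"] mod_hom_closed[OF fstU st(1)] mod_hom_closed[OF fstU st(2)]
        mod_hom_diff[OF U H0(1) fstU st] by (simp add: r_def)
    also have "snd (snd r) \<in> coboundaries C d (Suc n) \<longleftrightarrow> cls1 (snd (snd s)) = cls1 (snd (snd t))"
      using H1(4)[of "snd (snd s)" "snd (snd t)"] mod_hom_closed[OF sndU st(1)] mod_hom_closed[OF sndU st(2)]
        mod_hom_diff[OF U H1(1) sndU st] by (simp add: r_def)
    finally show "p s = p t \<longleftrightarrow> q s = q t" by (simp add: q_def)
  qed
  show ?A' if ann: ?A
    unfolding annihilates_def
  proof (intro ballI)
    fix a y assume a: "a \<in> I" and "y \<in> carrier (cohomology C' d' n)"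
    then obtain y0 where y0: "y0 \<in> cocycles C' d' n" "y = cls' y0" by (auto simp: H'(3))
    obtain u v b where uv: "u \<in> carrier (C (Suc n))" "v \<in> carrier (C n)" "b \<in> coboundaries C' d' n"
      "d (Suc n) u = \<zero>\<^bsub>C (Suc (Suc n))\<^esub>" "x \<odot>\<^bsub>C (Suc n)\<^esub> u = d n v" "y0 = \<phi> (u, v) \<oplus>\<^bsub>C' n\<^esub> b"
      using onto[OF y0(1)] by auto
    have uZ: "u \<in> cocycles C d (Suc n)" using uv(1,4) by (simp add: cocycles_def)
    then have "cls1 u \<in> carrier (cohomology C d (Suc n))" by (simp add: H1(3))
    then have "u \<in> D"
      using ann sm1[OF IR uZ] uZ by (auto simp: D_def annihilates_def)
    then obtain s where "s \<in> carrier U" "p s = cls' (\<phi> (u, v) \<oplus>\<^bsub>C' n\<^esub> b)"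
      using lift uv by blast
    then show "a \<odot>\<^bsub>cohomology C' d' n\<^esub> y = \<zero>\<^bsub>cohomology C' d' n\<^esub>"
      using pI[OF a] y0(2) uv(6) by metis
  qed
qed

context noetherian_ideal
begin

lemma cochain_complex_tor:
  assumes C: "cochain_complex R E d"
  shows "cochain_complex R (\<lambda>n. torsion_part R \<aa> (E n)) d"
proof -
  note CD = cochain_complexD[OF C]
  have 0: "\<zero>\<^bsub>torsion_part R \<aa> M\<^esub> = \<zero>\<^bsub>M\<^esub>" for M :: "('a, 'c) module"
    by (simp add: torsion_part_def)
  have "d n \<in> mod_hom R (torsion_part R \<aa> (E n)) (torsion_part R \<aa> (E (Suc n)))" for n
  proof (rule mod_homI)
    show "d n u \<in> tor (E (Suc n))" if "u \<in> tor (E n)" for u by (rule tor_hom[OF CD(1,1,2) that])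
  qed (use mod_homD[OF CD(2)] tor_carrier in \<open>auto simp: torsion_part_def\<close>)
  then show ?thesis
    using CD(3) tor_module[OF CD(1)] by (simp add: cochain_complex_def 0 tor_carrier)
qed

lemma coboundaries_tor:
  assumes C: "cochain_complex R E d"
  shows "coboundaries (\<lambda>n. torsion_part R \<aa> (E n)) d n = shift_diff E d n ` tor (shift_mod E n)"
proof (cases n)
  case 0
  interpret M: module R "shift_mod E 0" by (rule cochain_complexD(1)[OF cochain_complex_shift[OF C]])
  have "\<zero>\<^bsub>shift_mod E 0\<^esub> \<in> tor (shift_mod E 0)"
    by (rule M.submodule_zero[OF tor_submodule[OF M.module_axioms]])
  then show ?thesis using 0 by (auto simp: torsion_part_def)
qed simp

lemma coboundaries_tor_minus:
  assumes C: "cochain_complex R E d" and v: "v \<in> tor (shift_mod E n)"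
  shows "\<ominus>\<^bsub>E n\<^esub> shift_diff E d n v \<in> coboundaries (\<lambda>n. torsion_part R \<aa> (E n)) d n"
proof -
  note S = cochain_complexD[OF cochain_complex_shift[OF C]]
  interpret M: module R "shift_mod E n" by (rule S)
  have "\<ominus>\<^bsub>E n\<^esub> shift_diff E d n v = shift_diff E d n (\<ominus>\<^bsub>shift_mod E n\<^esub> v)"
    using mod_hom_minus[OF S(1,1,2) tor_carrier[OF v]] by simp
  then show ?thesis
    using M.submoduleE(3)[OF tor_submodule[OF S(1)] v] by (simp add: coboundaries_tor[OF C])
qed

lemma local_cohomology_quotient_splits:
  assumes M: "module R M" and E: "injective_resolution R M E d e"
    and x: "x \<in> ideal_prod R (power m) (power m)" and fr: "filter_regular R \<aa> M x"
    and E': "injective_resolution R (quot_module M (smult_image M x)) E' d' e'"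
    and kill: "annihilates (power m) (local_cohomology R \<aa> E d n)"
  shows "mod_isomorphic R (zero_colon (local_cohomology R \<aa> E' d' n) (power m))
      (direct_sum (local_cohomology R \<aa> E d n)
        (zero_colon (local_cohomology R \<aa> E d (Suc n)) (power m)))" (is ?iso)
    and "annihilates (power m) (local_cohomology R \<aa> E d (Suc n)) \<Longrightarrow>
      annihilates (power m) (local_cohomology R \<aa> E' d' n)" (is "?A \<Longrightarrow> ?A'")
proof -
  define T where "T = (\<lambda>n. torsion_part R \<aa> (E n))"
  define T' where "T' = (\<lambda>n. torsion_part R \<aa> (E' n))"
  note C = injective_resolutionD(2)[OF E] and C' = injective_resolutionD(2)[OF E']
  note CD = cochain_complexD[OF C] and CD' = cochain_complexD[OF C']
  interpret A: module R "E n" by (rule CD)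
  interpret B: module R "E (Suc n)" by (rule CD)
  interpret F: module R "E' n" by (rule CD')
  have xR: "x \<in> carrier R" using fr Icarr by (simp add: filter_regular_def)
  have Tsimps [simp]: "carrier (T k) = tor (E k)" "\<zero>\<^bsub>T k\<^esub> = \<zero>\<^bsub>E k\<^esub>" "u \<oplus>\<^bsub>T k\<^esub> v = u \<oplus>\<^bsub>E k\<^esub> v"
    "r \<odot>\<^bsub>T k\<^esub> u = r \<odot>\<^bsub>E k\<^esub> u" for k u v r
    by (simp_all add: T_def torsion_part_def)
  have T'simps [simp]: "carrier (T' k) = tor (E' k)" "\<zero>\<^bsub>T' k\<^esub> = \<zero>\<^bsub>E' k\<^esub>" "u \<oplus>\<^bsub>T' k\<^esub> v = u \<oplus>\<^bsub>E' k\<^esub> v"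
    "r \<odot>\<^bsub>T' k\<^esub> u = r \<odot>\<^bsub>E' k\<^esub> u" for k u v r
    by (simp_all add: T'_def torsion_part_def)
  have TC: "cochain_complex R T d" unfolding T_def by (rule cochain_complex_tor[OF C])
  have TC': "cochain_complex R T' d'" unfolding T'_def by (rule cochain_complex_tor[OF C'])
  have cb: "coboundaries T d n = shift_diff E d n ` tor (shift_mod E n)"
    unfolding T_def by (rule coboundaries_tor[OF C])
  have cb': "coboundaries T' d' n = shift_diff E' d' n ` tor (shift_mod E' n)"
    unfolding T'_def by (rule coboundaries_tor[OF C'])
  note SD = cochain_complexD[OF cochain_complex_shift[OF C]]
  note SD' = cochain_complexD[OF cochain_complex_shift[OF C']]
  have sd: "shift_diff E d n v \<in> carrier (E n)" if "v \<in> tor (shift_mod E n)" for v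
    using mod_hom_closed[OF SD(2) tor_carrier[OF that]] by simp
  have sd': "shift_diff E' d' n v \<in> carrier (E' n)" if "v \<in> tor (shift_mod E' n)" for v
    using mod_hom_closed[OF SD'(2) tor_carrier[OF that]] by simp
  obtain \<phi> where \<phi>: "\<And>n. \<phi> n \<in> mod_hom R (mult_cone E (Suc n)) (E' n)"
    and \<phi>cb: "\<And>n p. p \<in> tor (mult_cone E n) \<Longrightarrow>
      \<phi> n (mult_cone_diff E d x n p) \<in> shift_diff E' d' n ` tor (shift_mod E' n)"
    and \<phi>cc: "\<And>n p. p \<in> carrier (mult_cone E (Suc n)) \<Longrightarrow>
      mult_cone_diff E d x (Suc n) p = \<zero>\<^bsub>mult_cone E (Suc (Suc n))\<^esub> \<Longrightarrow>
      d' n (\<phi> n p) = \<zero>\<^bsub>E' (Suc n)\<^esub>"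
    and \<phi>onto: "\<And>n z. z \<in> tor (E' n) \<Longrightarrow> d' n z = \<zero>\<^bsub>E' (Suc n)\<^esub> \<Longrightarrow>
      \<exists>p\<in>tor (mult_cone E (Suc n)). \<exists>v\<in>tor (shift_mod E' n).
        mult_cone_diff E d x (Suc n) p = \<zero>\<^bsub>mult_cone E (Suc (Suc n))\<^esub> \<and>
        \<phi> n p \<ominus>\<^bsub>E' n\<^esub> shift_diff E' d' n v = z"
    and \<phi>inj: "\<And>n p v. p \<in> tor (mult_cone E (Suc n)) \<Longrightarrow>
      mult_cone_diff E d x (Suc n) p = \<zero>\<^bsub>mult_cone E (Suc (Suc n))\<^esub> \<Longrightarrow>
      v \<in> tor (shift_mod E' n) \<Longrightarrow> \<phi> n p = shift_diff E' d' n v \<Longrightarrow>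
      \<exists>q\<in>tor (mult_cone E n). mult_cone_diff E d x n q = p"
    by (rule quotient_resolution_comparison[OF M E E' xR filter_regular_zero_divisor_tor[OF M fr]]) blast+
  have dc: "d k u \<in> carrier (E (Suc k))" if "u \<in> carrier (E k)" for k u
    by (rule mod_hom_closed[OF CD(2) that])
  have cocycle_iff: "mult_cone_diff E d x (Suc n) (u, v) = \<zero>\<^bsub>mult_cone E (Suc (Suc n))\<^esub> \<longleftrightarrow>
      d (Suc n) u = \<zero>\<^bsub>E (Suc (Suc n))\<^esub> \<and> x \<odot>\<^bsub>E (Suc n)\<^esub> u = d n v"
    if "u \<in> carrier (E (Suc n))" "v \<in> carrier (E n)" for u v
    using that xR dc by (simp add: cone_diff_def cone_mod_def B.M.diff_eq_zero_iff)
  have tor_cone: "tor (mult_cone E (Suc n)) = tor (E (Suc n)) \<times> tor (E n)"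
    by (simp add: cone_mod_def tor_direct_sum)
  have tor_cone0: "tor (mult_cone E n) = tor (E n) \<times> tor (shift_mod E n)"
    by (simp add: cone_mod_def tor_direct_sum)
  have \<phi>tor: "\<phi> n (u, v) \<in> tor (E' n)" if "u \<in> tor (E (Suc n))" "v \<in> tor (E n)" for u v
    using tor_hom[OF _ CD'(1) \<phi>] that tor_cone module_direct_sum[OF CD(1,1)]
    by (simp add: cone_mod_def)
  have \<phi>T: "\<phi> n \<in> mod_hom R (direct_sum (T (Suc n)) (T n)) (T' n)"
    using mod_homD[OF \<phi>[of n]] \<phi>tor by (intro mod_homI) (auto simp: cone_mod_def tor_carrier)
  note splits = cone_cohomology_splits[OF TC TC' ideal_power_ideal x
      kill[unfolded local_cohomology_def, folded T_def] \<phi>T]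
  have c1: "d' n (\<phi> n (u, v)) = \<zero>\<^bsub>T' (Suc n)\<^esub>"
    if "u \<in> carrier (T (Suc n))" "v \<in> carrier (T n)" "d (Suc n) u = \<zero>\<^bsub>T (Suc (Suc n))\<^esub>"
      "x \<odot>\<^bsub>T (Suc n)\<^esub> u = d n v" for u v
    using \<phi>cc[of "(u, v)" n] cocycle_iff[of u v] that by (simp add: cone_mod_def tor_carrier)
  have c2: "\<phi> n (d n w, x \<odot>\<^bsub>T n\<^esub> w \<oplus>\<^bsub>T n\<^esub> b) \<in> coboundaries T' d' n"
    if w: "w \<in> carrier (T n)" and b: "b \<in> coboundaries T d n" for w b
  proof -
    obtain v where v: "v \<in> tor (shift_mod E n)" "b = shift_diff E d n v" using b cb by auto
    interpret S: module R "shift_mod E n" by (rule SD)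
    note v' = S.submoduleE(3)[OF tor_submodule[OF SD(1)] v(1)]
    have "shift_diff E d n (\<ominus>\<^bsub>shift_mod E n\<^esub> v) = \<ominus>\<^bsub>E n\<^esub> b"
      using mod_hom_minus[OF SD(1,1,2) tor_carrier[OF v(1)]] v(2) by simp
    then have "mult_cone_diff E d x n (w, \<ominus>\<^bsub>shift_mod E n\<^esub> v) = (d n w, x \<odot>\<^bsub>E n\<^esub> w \<oplus>\<^bsub>E n\<^esub> b)"
      using sd[OF v(1)] v(2) by (simp add: cone_diff_def A.M.minus_eq)
    with \<phi>cb[of "(w, \<ominus>\<^bsub>shift_mod E n\<^esub> v)" n] show ?thesis
      using v' w by (simp add: tor_cone0 cb')
  qed
  have c3: "\<exists>u\<in>carrier (T (Suc n)). \<exists>v\<in>carrier (T n). \<exists>b\<in>coboundaries T' d' n.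
      d (Suc n) u = \<zero>\<^bsub>T (Suc (Suc n))\<^esub> \<and> x \<odot>\<^bsub>T (Suc n)\<^esub> u = d n v \<and> z = \<phi> n (u, v) \<oplus>\<^bsub>T' n\<^esub> b"
    if z: "z \<in> cocycles T' d' n" for z
  proof -
    have "z \<in> tor (E' n)" "d' n z = \<zero>\<^bsub>E' (Suc n)\<^esub>" using z by (auto simp: cocycles_def)
    from \<phi>onto[OF this] obtain p v where p: "p \<in> tor (mult_cone E (Suc n))"
      "mult_cone_diff E d x (Suc n) p = \<zero>\<^bsub>mult_cone E (Suc (Suc n))\<^esub>"
      and v: "v \<in> tor (shift_mod E' n)" "\<phi> n p \<ominus>\<^bsub>E' n\<^esub> shift_diff E' d' n v = z" by auto
    obtain a b where ab: "p = (a, b)" "a \<in> tor (E (Suc n))" "b \<in> tor (E n)"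
      using p(1) tor_cone by auto
    have "\<ominus>\<^bsub>E' n\<^esub> shift_diff E' d' n v \<in> coboundaries T' d' n"
      unfolding T'_def by (rule coboundaries_tor_minus[OF C' v(1)])
    moreover have "z = \<phi> n (a, b) \<oplus>\<^bsub>T' n\<^esub> \<ominus>\<^bsub>E' n\<^esub> shift_diff E' d' n v"
      using v(2) ab(1) by (simp add: F.M.minus_eq)
    moreover have "d (Suc n) a = \<zero>\<^bsub>T (Suc (Suc n))\<^esub>" "x \<odot>\<^bsub>T (Suc n)\<^esub> a = d n b"
      using p(2) ab cocycle_iff[OF tor_carrier[OF ab(2)] tor_carrier[OF ab(3)]] by simp_all
    ultimately show ?thesis using ab(2,3) by (intro bexI conjI) simp_all
  qed
  have c4: "\<exists>w\<in>carrier (T n). \<exists>b\<in>coboundaries T d n. u = d n w \<and> v = x \<odot>\<^bsub>T n\<^esub> w \<oplus>\<^bsub>T n\<^esub> b"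
    if u: "u \<in> carrier (T (Suc n))" "v \<in> carrier (T n)" "d (Suc n) u = \<zero>\<^bsub>T (Suc (Suc n))\<^esub>"
      "x \<odot>\<^bsub>T (Suc n)\<^esub> u = d n v" and \<phi>B: "\<phi> n (u, v) \<in> coboundaries T' d' n" for u v
  proof -
    obtain y where y: "y \<in> tor (shift_mod E' n)" "\<phi> n (u, v) = shift_diff E' d' n y"
      using \<phi>B cb' by auto
    have "(u, v) \<in> tor (mult_cone E (Suc n))" using u(1,2) tor_cone by simp
    moreover have "mult_cone_diff E d x (Suc n) (u, v) = \<zero>\<^bsub>mult_cone E (Suc (Suc n))\<^esub>"
      using cocycle_iff[of u v] u by (simp add: tor_carrier)
    ultimately obtain q where q: "q \<in> tor (mult_cone E n)" "mult_cone_diff E d x n q = (u, v)"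
      using \<phi>inj[OF _ _ y] by auto
    obtain w k where wk: "q = (w, k)" "w \<in> tor (E n)" "k \<in> tor (shift_mod E n)"
      using q(1) tor_cone0 by auto
    have "\<ominus>\<^bsub>E n\<^esub> shift_diff E d n k \<in> coboundaries T d n"
      unfolding T_def by (rule coboundaries_tor_minus[OF C wk(3)])
    moreover have "u = d n w" "v = x \<odot>\<^bsub>T n\<^esub> w \<oplus>\<^bsub>T n\<^esub> \<ominus>\<^bsub>E n\<^esub> shift_diff E d n k"
      using q(2) wk(1) by (auto simp: cone_diff_def A.M.minus_eq)
    ultimately show ?thesis using wk(2) by (intro bexI conjI) simp_all
  qed
  have loc: "local_cohomology R \<aa> E d = cohomology T d" "local_cohomology R \<aa> E' d' = cohomology T' d'"
    by (simp_all add: fun_eq_iff local_cohomology_def T_def T'_def)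
  show ?iso unfolding loc by (rule splits(1)[OF c1 c2 c3 c4])
  show ?A' if ?A using that unfolding loc by (rule splits(2)[OF c1 c2 c3 c4, rotated -1])
qed

end

theorem theorem1p1:
  fixes R :: "('a, 'k) ring_scheme"
    and M :: "('a, 'm) module"
    and \<aa> :: "'a set"
    and t n\<^sub>0 :: nat
    and x :: 'a
    and E :: "nat \<Rightarrow> ('a, 'e) module" and d :: "nat \<Rightarrow> 'e \<Rightarrow> 'e" and e :: "'m \<Rightarrow> 'e"
    and E' :: "nat \<Rightarrow> ('a, 'f) module" and d' :: "nat \<Rightarrow> 'f \<Rightarrow> 'f" and e' :: "'m set \<Rightarrow> 'f"
  assumes "cring R" and "noetherian_ring R"
    and "module R M" and "finitely_generated_module R M"
    and "ideal \<aa> R"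
    and "t > 0" and "n\<^sub>0 > 0"
    and "injective_resolution R M E d e"
    and "\<forall>i<t. annihilates (ideal_power R \<aa> n\<^sub>0) (local_cohomology R \<aa> E d i)"
    and "filter_regular R \<aa> M x" and "x \<in> ideal_power R \<aa> (2 * n\<^sub>0)"
    and "injective_resolution R (quot_module M (smult_image M x)) E' d' e'"
  shows "(\<forall>i<t - 1. mod_isomorphic R
            (local_cohomology R \<aa> E' d' i)
            (direct_sum (local_cohomology R \<aa> E d i) (local_cohomology R \<aa> E d (i + 1)))) \<and>
         mod_isomorphic R
            (zero_colon (local_cohomology R \<aa> E' d' (t - 1)) (ideal_power R \<aa> n\<^sub>0))
            (direct_sum (local_cohomology R \<aa> E d (t - 1))
               (zero_colon (local_cohomology R \<aa> E d t) (ideal_power R \<aa> n\<^sub>0)))"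
proof -
  interpret noetherian_ideal R \<aa>
    using assms(1,2,5) by (intro noetherian_ideal.intro)
  have "x \<in> ideal_prod R (power n\<^sub>0) (power n\<^sub>0)"
    using assms(11) ideal_power_add[of n\<^sub>0 n\<^sub>0] by (simp add: mult_2)
  note splits = local_cohomology_quotient_splits[OF assms(3,8) this assms(10,12)]
  note kill = assms(9)[rule_format]
  show ?thesis
  proof (intro conjI allI impI)
    fix i assume i: "i < t - 1"
    have kill1: "annihilates (power n\<^sub>0) (local_cohomology R \<aa> E d (Suc i))"
      using i by (intro kill) simp
    have kill0: "annihilates (power n\<^sub>0) (local_cohomology R \<aa> E d i)"
      using i by (intro kill) simp
    show "mod_isomorphic R (local_cohomology R \<aa> E' d' i)
        (direct_sum (local_cohomology R \<aa> E d i) (local_cohomology R \<aa> E d (i + 1)))"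
      using splits(1)[OF kill0] zero_colon_annihilates[OF kill1]
        zero_colon_annihilates[OF splits(2)[OF kill0 kill1]] by simp
  next
    have "annihilates (power n\<^sub>0) (local_cohomology R \<aa> E d (t - 1))"
      using assms(6) by (intro kill) simp
    from splits(1)[OF this] assms(6)
    show "mod_isomorphic R
        (zero_colon (local_cohomology R \<aa> E' d' (t - 1)) (power n\<^sub>0))
        (direct_sum (local_cohomology R \<aa> E d (t - 1))
          (zero_colon (local_cohomology R \<aa> E d t) (power n\<^sub>0)))"
      by simp
  qed
qed

end
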